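(* The bigraft operad $\mathcal{BG}$ is Koszul.
   Context: $\mathbb{K}$ is a commutative field of any characteristic. The bigraft operad $\mathcal{BG}$ is the binary, quadratic, regular operad (symmetrization of the nonsymmetric operad with the same generators and relations) generated by three binary operations $\ast,\succ,\prec$ (without symmetry), whose algebras are vector spaces $A$ with $\ast,\succ,\prec:A\otimes A\to A$ such that for all $x,y,z\in A$: $(x\ast y)\ast z=x\ast(y\ast z)$, $(x\ast y)\succ z=x\succ(y\succ z)$, $(x\succ y)\ast z=x\succ(y\ast z)$, $(x\prec y)\prec z=x\prec(y\ast z)$, $(x\ast y)\prec z=x\ast(y\prec z)$, $(x\succ y)\prec z=x\succ(y\prec z)$. Koszulness is in the usual sense of Ginzburg–Kapranov for quadratic operads. *)

theory Defs
  imports "HOL-Library.Poly_Mapping" "HOL-Combinatorics.Permutations"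
begin

text \<open>
  The data of a symmetric operad over a field: the vector space of operations of each
  arity, the identity operation, the partial compositions and the symmetric group actions.
  Inputs of an operation of arity \<open>n\<close> are numbered \<open>0, \<dots>, n - 1\<close>.
  \<open>pcomp P m n i p q\<close>, for \<open>p\<close> of arity \<open>m\<close> and \<open>q\<close> of arity \<open>n\<close>, is the operation
  \<open>p(x\<^sub>0, \<dots>, x\<^bsub>i-1\<^esub>, q(x\<^sub>i, \<dots>, x\<^bsub>i+n-1\<^esub>), x\<^bsub>i+n\<^esub>, \<dots>, x\<^bsub>m+n-2\<^esub>)\<close>, and
  \<open>act P n \<sigma> p\<close> is the operation \<open>p(x\<^bsub>\<sigma> 0\<^esub>, \<dots>, x\<^bsub>\<sigma> (n-1)\<^esub>)\<close>.
\<close>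

record ('k, 'a) operad =
  ops :: "nat \<Rightarrow> 'a set"
  zro :: "nat \<Rightarrow> 'a"
  add :: "nat \<Rightarrow> 'a \<Rightarrow> 'a \<Rightarrow> 'a"
  scl :: "nat \<Rightarrow> 'k \<Rightarrow> 'a \<Rightarrow> 'a"
  idn :: 'a
  pcomp :: "nat \<Rightarrow> nat \<Rightarrow> nat \<Rightarrow> 'a \<Rightarrow> 'a \<Rightarrow> 'a"
  act :: "nat \<Rightarrow> (nat \<Rightarrow> nat) \<Rightarrow> 'a \<Rightarrow> 'a"


section \<open>Operads presented by binary generators and relations\<close>

inductive operad_ideal ::
    "('k, 'a) operad \<Rightarrow> (nat \<Rightarrow> 'a set) \<Rightarrow> nat \<Rightarrow> 'a \<Rightarrow> bool"
  for P :: "('k, 'a) operad" and R :: "nat \<Rightarrow> 'a set" where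
  rel: "r \<in> R n \<Longrightarrow> operad_ideal P R n r"
| zro: "operad_ideal P R n (zro P n)"
| add: "operad_ideal P R n p \<Longrightarrow> operad_ideal P R n q \<Longrightarrow> operad_ideal P R n (add P n p q)"
| scl: "operad_ideal P R n p \<Longrightarrow> operad_ideal P R n (scl P n c p)"
| act: "operad_ideal P R n p \<Longrightarrow> \<sigma> permutes {..<n} \<Longrightarrow> operad_ideal P R n (act P n \<sigma> p)"
| comp_left: "operad_ideal P R m p \<Longrightarrow> q \<in> ops P n \<Longrightarrow> i < m \<Longrightarrow>
    operad_ideal P R (m + n - 1) (pcomp P m n i p q)"
| comp_right: "p \<in> ops P m \<Longrightarrow> operad_ideal P R n q \<Longrightarrow> i < m \<Longrightarrow>
    operad_ideal P R (m + n - 1) (pcomp P m n i p q)"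

definition coset :: "('k, 'a) operad \<Rightarrow> (nat \<Rightarrow> 'a \<Rightarrow> bool) \<Rightarrow> nat \<Rightarrow> 'a \<Rightarrow> 'a set" where
  "coset P I n p = {add P n p z |z. I n z}"

definition quotient_operad ::
    "('k, 'a) operad \<Rightarrow> (nat \<Rightarrow> 'a \<Rightarrow> bool) \<Rightarrow> ('k, 'a set) operad" where
  "quotient_operad P I = \<lparr>
     ops = (\<lambda>n. coset P I n ` ops P n),
     zro = (\<lambda>n. coset P I n (zro P n)),
     add = (\<lambda>n A B. \<Union>a\<in>A. \<Union>b\<in>B. coset P I n (add P n a b)),
     scl = (\<lambda>n c A. \<Union>a\<in>A. coset P I n (scl P n c a)),
     idn = coset P I 1 (idn P),
     pcomp = (\<lambda>m n i A B. \<Union>a\<in>A. \<Union>b\<in>B. coset P I (m + n - 1) (pcomp P m n i a b)),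
     act = (\<lambda>n \<sigma> A. \<Union>a\<in>A. coset P I n (act P n \<sigma> a)) \<rparr>"

text \<open>
  Generators are binary operations without symmetry, i.e. the generating
  \<open>S\<^sub>2\<close>-module is the free one on the set \<open>'g\<close>.  A basis of the arity \<open>n\<close> component of the free
  symmetric operad is then given by the multilinear monomials in the \<open>n\<close> variables
  \<open>0, \<dots>, n - 1\<close>.
\<close>

datatype 'g monomial = Var nat | Op 'g "'g monomial" "'g monomial"

fun vars :: "'g monomial \<Rightarrow> nat list" where
  "vars (Var i) = [i]"
| "vars (Op g s t) = vars s @ vars t"

definition monomials :: "nat \<Rightarrow> 'g monomial set" where
  "monomials n = {t. distinct (vars t) \<and> set (vars t) = {..<n}}"

fun substitute :: "(nat \<Rightarrow> 'g monomial) \<Rightarrow> 'g monomial \<Rightarrow> 'g monomial" where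
  "substitute f (Var i) = f i"
| "substitute f (Op g s t) = Op g (substitute f s) (substitute f t)"

definition rename_monomial :: "(nat \<Rightarrow> nat) \<Rightarrow> 'g monomial \<Rightarrow> 'g monomial" where
  "rename_monomial \<sigma> t = substitute (\<lambda>j. Var (\<sigma> j)) t"

definition comp_monomial :: "nat \<Rightarrow> nat \<Rightarrow> 'g monomial \<Rightarrow> 'g monomial \<Rightarrow> 'g monomial" where
  "comp_monomial n i s t =
     substitute (\<lambda>j. if j < i then Var j
                else if j = i then rename_monomial (\<lambda>l. l + i) t
                else Var (j + n - 1)) s"

definition free_operad :: "('k::field, 'g monomial \<Rightarrow>\<^sub>0 'k) operad" where
  "free_operad = \<lparr>
     ops = (\<lambda>n. {p. Poly_Mapping.keys p \<subseteq> monomials n}),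
     zro = (\<lambda>n. 0),
     add = (\<lambda>n p q. p + q),
     scl = (\<lambda>n c p. Poly_Mapping.map (\<lambda>a. c * a) p),
     idn = Poly_Mapping.single (Var 0) 1,
     pcomp = (\<lambda>m n i p q. \<Sum>s\<in>Poly_Mapping.keys p. \<Sum>t\<in>Poly_Mapping.keys q.
       Poly_Mapping.single (comp_monomial n i s t)
         (Poly_Mapping.lookup p s * Poly_Mapping.lookup q t)),
     act = (\<lambda>n \<sigma> p. \<Sum>t\<in>Poly_Mapping.keys p.
       Poly_Mapping.single (rename_monomial \<sigma> t) (Poly_Mapping.lookup p t)) \<rparr>"

definition quadratic_operad ::
    "('g monomial \<Rightarrow>\<^sub>0 'k::field) set \<Rightarrow> ('k, ('g monomial \<Rightarrow>\<^sub>0 'k) set) operad" where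
  "quadratic_operad R =
     quotient_operad free_operad (operad_ideal free_operad (\<lambda>n. if n = 3 then R else {}))"


section \<open>The cobar complex and Koszul operads\<close>

text \<open>
  Trees with a planar structure, leaves labelled by numbers and vertices decorated by operations.
\<close>

datatype 'a dtree = Leaf nat | Node 'a "'a dtree list"

fun leaves :: "'a dtree \<Rightarrow> nat list" where
  "leaves (Leaf i) = [i]"
| "leaves (Node p ts) = concat (map leaves ts)"

fun vertices :: "'a dtree \<Rightarrow> nat" where
  "vertices (Leaf i) = 0"
| "vertices (Node p ts) = Suc (sum_list (map vertices ts))"

fun decorated :: "('k, 'a) operad \<Rightarrow> 'a dtree \<Rightarrow> bool" where
  "decorated P (Leaf i) = True"
| "decorated P (Node p ts) =
     (2 \<le> length ts \<and> p \<in> ops P (length ts) \<and> (\<forall>t\<in>set ts. decorated P t))"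

definition dtrees :: "('k, 'a) operad \<Rightarrow> nat \<Rightarrow> nat \<Rightarrow> 'a dtree set" where
  "dtrees P n v = {t. decorated P t \<and> distinct (leaves t) \<and> set (leaves t) = {..<n} \<and> vertices t = v}"

datatype 'a ctxt = Hole | In 'a "'a dtree list" "'a ctxt" "'a dtree list"

fun plug :: "'a ctxt \<Rightarrow> 'a dtree \<Rightarrow> 'a dtree" where
  "plug Hole t = t"
| "plug (In p ls C rs) t = Node p (ls @ plug C t # rs)"

text \<open>
  The Koszul sign of reordering consecutive blocks of sizes \<open>d!0, d!1, \<dots>\<close> of odd elements
  into the blocks of sizes \<open>d!(\<sigma> 0), d!(\<sigma> 1), \<dots>\<close>.
\<close>

definition koszul_sign :: "(nat \<Rightarrow> nat) \<Rightarrow> nat list \<Rightarrow> 'k::field" where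
  "koszul_sign \<sigma> d =
     (\<Prod>(i, j) \<in> {(i, j). i < j \<and> j < length d \<and> \<sigma> j < \<sigma> i}. (- 1) ^ (d ! \<sigma> i * d ! \<sigma> j))"

text \<open>
  The cochains are the elements of \<open>\<Oplus>\<^sub>T P(T)\<^sup>* \<otimes> det(T)\<close>, where \<open>T\<close> ranges over the
  (non-planar, reduced) \<open>n\<close>-trees with \<open>v\<close> vertices, i.e. with \<open>v - 1\<close> internal edges,
  \<open>P(T)\<close> is the tensor product over the vertices \<open>u\<close> of \<open>P(in(u))\<close>, and \<open>det(T)\<close> is the
  top exterior power of the vector space spanned by the internal edges of \<open>T\<close>.

  A linear form on \<open>P(T)\<close> is a function of the decorations that is linear in each of them.
  A decorated planar tree stands for its underlying tree together with the orientation that lists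
  the internal edges in preorder.  The planar structure is discarded by the third condition: an
  operation with permuted inputs is the original operation on permuted subtrees.  In preorder, a
  subtree \<open>t\<close> of a vertex contributes a block of \<open>vertices t\<close> consecutive internal edges
  (the edge leading to its root included), whence the sign.
\<close>

definition cochain :: "('k::field, 'a) operad \<Rightarrow> nat \<Rightarrow> nat \<Rightarrow> ('a dtree \<Rightarrow> 'k) \<Rightarrow> bool" where
  "cochain P n v \<phi> \<longleftrightarrow>
     (\<forall>C p q ts. plug C (Node p ts) \<in> dtrees P n v \<and> plug C (Node q ts) \<in> dtrees P n v \<longrightarrow>
        \<phi> (plug C (Node (add P (length ts) p q) ts)) =
        \<phi> (plug C (Node p ts)) + \<phi> (plug C (Node q ts))) \<and>
     (\<forall>C c p ts. plug C (Node p ts) \<in> dtrees P n v \<longrightarrow>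
        \<phi> (plug C (Node (scl P (length ts) c p) ts)) = c * \<phi> (plug C (Node p ts))) \<and>
     (\<forall>C \<sigma> p ts. plug C (Node p ts) \<in> dtrees P n v \<and> \<sigma> permutes {..<length ts} \<longrightarrow>
        \<phi> (plug C (Node (act P (length ts) \<sigma> p) ts)) =
        koszul_sign \<sigma> (map vertices ts) *
        \<phi> (plug C (Node p (map (\<lambda>i. ts ! \<sigma> i) [0..<length ts]))))"

text \<open>
  \<open>contract_edge P p ls t rs\<close>: the contraction, if \<open>t\<close> is not a leaf, of the edge from \<open>t\<close> to
  the vertex above it, which has decoration \<open>p\<close> and subtrees \<open>ls @ t # rs\<close>.
  \<open>contractions P t\<close>: the contractions of all internal edges of \<open>t\<close>, in preorder.
\<close>

fun contract_edge ::
    "('k, 'a) operad \<Rightarrow> 'a \<Rightarrow> 'a dtree list \<Rightarrow> 'a dtree \<Rightarrow> 'a dtree list \<Rightarrow> 'a dtree list" where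
  "contract_edge P p ls (Leaf i) rs = []"
| "contract_edge P p ls (Node q ss) rs =
     [Node (pcomp P (length ls + 1 + length rs) (length ss) (length ls) p q) (ls @ ss @ rs)]"

function contractions :: "('k, 'a) operad \<Rightarrow> 'a dtree \<Rightarrow> 'a dtree list" where
  "contractions P (Leaf i) = []"
| "contractions P (Node p ts) =
     concat (map (\<lambda>i. contract_edge P p (take i ts) (ts ! i) (drop (Suc i) ts) @
                      map (\<lambda>t. Node p (ts[i := t])) (contractions P (ts ! i)))
                 [0..<length ts])"
  by pat_completeness auto
termination
  by (relation "Wellfounded.measure (\<lambda>(P, t). size t)")
     (auto simp: less_Suc_eq_le intro: size_list_estimation' nth_mem)

definition codiff :: "('k::field, 'a) operad \<Rightarrow> ('a dtree \<Rightarrow> 'k) \<Rightarrow> 'a dtree \<Rightarrow> 'k" where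
  "codiff P \<phi> t = (\<Sum>j<length (contractions P t). (- 1) ^ j * \<phi> (contractions P t ! j))"

text \<open>
  For a quadratic operad \<open>P\<close> with binary generators (and \<open>P(1)\<close> spanned by the identity):
  \<open>P\<close> is Koszul if, for every \<open>n \<ge> 2\<close>, the complex
  \<open>P(n)\<^sup>* \<rightarrow> \<Oplus>\<^bsub>T with 1 internal edge\<^esub> P(T)\<^sup>* \<otimes> det(T) \<rightarrow> \<dots> \<rightarrow> \<Oplus>\<^bsub>T binary\<^esub> P(T)\<^sup>* \<otimes> det(T)\<close>
  is exact everywhere but at its right end, that is (Ginzburg--Kapranov), if the canonical map
  from the dual dg operad of \<open>P\<close> to the quadratic dual of \<open>P\<close> is a quasi-isomorphism.
  The binary trees are those with \<open>n - 1\<close> vertices.  For \<open>v = 0\<close> there are no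
  trees with \<open>v\<close> vertices, and the condition is injectivity of the first map.
\<close>

definition koszul :: "('k::field, 'a) operad \<Rightarrow> bool" where
  "koszul P \<longleftrightarrow>
     (\<forall>n\<ge>2. \<forall>v. Suc v < n - 1 \<longrightarrow>
       (\<forall>\<phi>. cochain P n (Suc v) \<phi> \<and> (\<forall>t\<in>dtrees P n (Suc (Suc v)). codiff P \<phi> t = 0) \<longrightarrow>
         (\<exists>\<psi>. cochain P n v \<psi> \<and> (\<forall>t\<in>dtrees P n (Suc v). \<phi> t = codiff P \<psi> t))))"


section \<open>The bigraft operad\<close>

datatype bigraft_gen = Ast | Succ | Prec

text \<open>\<open>(x a y) b z = x c (y d z)\<close>\<close>

definition bigraft_rel ::
    "bigraft_gen \<Rightarrow> bigraft_gen \<Rightarrow> bigraft_gen \<Rightarrow> bigraft_gen \<Rightarrow> bigraft_gen monomial \<Rightarrow>\<^sub>0 'k::field" where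
  "bigraft_rel a b c d =
     Poly_Mapping.single (Op b (Op a (Var 0) (Var 1)) (Var 2)) 1 -
     Poly_Mapping.single (Op c (Var 0) (Op d (Var 1) (Var 2))) 1"

definition bigraft :: "('k::field, (bigraft_gen monomial \<Rightarrow>\<^sub>0 'k) set) operad" where
  "bigraft = quadratic_operad
     {bigraft_rel Ast Ast Ast Ast,
      bigraft_rel Ast Succ Succ Succ,
      bigraft_rel Succ Ast Succ Ast,
      bigraft_rel Prec Prec Prec Ast,
      bigraft_rel Ast Prec Ast Prec,
      bigraft_rel Succ Prec Succ Prec}"

end

theory Submission
  imports Defs "HOL-Library.Nat_Bijection"
begin

text \<open>
  The six relations of a bigraft algebra identify monomials, so they can be read as rewrite
  rules.  Two of them are read from right to left:
  \<open>(x \<ast> y) \<ast> z \<rightarrow> x \<ast> (y \<ast> z)\<close>, \<open>(x \<ast> y) \<succ> z \<rightarrow> x \<succ> (y \<succ> z)\<close>, \<open>x \<succ> (y \<ast> z) \<rightarrow> (x \<succ> y) \<ast> z\<close>,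
  \<open>x \<prec> (y \<ast> z) \<rightarrow> (x \<prec> y) \<prec> z\<close>, \<open>(x \<ast> y) \<prec> z \<rightarrow> x \<ast> (y \<prec> z)\<close>, \<open>(x \<succ> y) \<prec> z \<rightarrow> x \<succ> (y \<prec> z)\<close>.
  With this choice of directions the system terminates and is confluent, and a monomial is normal
  as soon as each pair of adjacent operations in it is (for the opposite direction of the third
  rule, confluence fails in arity four).  In other words, the operad has a quadratic Groebner
  basis, and Koszulness follows from it by an explicit contraction of the cobar complex.

  Confluence is not checked on critical pairs.  The normal form of an operation applied to two
  normal forms is given by a recursive function \<open>join\<close>, and \<open>join_relations\<close> says that \<open>join\<close>
  satisfies the six relations.  Hence evaluation by \<open>join\<close> vanishes on the ideal of relations
  (\<open>lin_evaluate_ideal\<close>), and therefore the normal monomials are linearly independent.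

  A tree whose vertices are decorated by normal monomials is a single binary tree of generators in
  which the roots of the decorations are marked.  Contracting an internal edge removes a mark and
  normalises the decoration that arises; this is the function \<open>nrm\<close>.  A mark is identified with the
  set of leaves below it, and edges ordered by a code of this set give every tree an orientation
  that does not depend on its planar structure.  The sign of the preorder list of edges relative
  to this orientation turns a cochain into a form that is invariant under the symmetric groups
  without signs (\<open>cochain_iff_invariant_form\<close>).  Invariant forms on decorated trees are then the
  same as functions on marked trees: \<open>expand\<close> writes a decorated tree as a linear combination
  of marked trees, \<open>realise\<close> is a section of it, and \<open>form_expand\<close> recovers a form from its values
  on the section.  The codifferential becomes the signed sum \<open>delta\<close> over the removal of marks
  (\<open>expand_contractions\<close>, \<open>codiff_expand\<close>).

  The complex of marked trees is exact below the top degree (\<open>delta_primitive\<close>).  In a fixed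
  binary tree, removing the mark of an edge along which no rule applies changes no generator,
  while removing any other mark makes a rewriting step necessary and so lowers a weight in the
  natural numbers.  Up to trees of lower weight, the complex is therefore a sum of cubes, one for
  each binary tree, whose directions are the edges along which no rule applies.  Choosing one of
  these edges and toggling its mark contracts the cube.  There is no such edge only if all inner
  nodes are marked, and then the decorated tree is binary.  The primitive of a cocycle is built by
  recursion on the weight.
\<close>

section \<open>Products of normal monomials\<close>

text \<open>
  A marked tree encodes a tree of monomials: an operation carries \<open>True\<close> if it is the root of one
  of these monomials, and \<open>False\<close> if it belongs to the same monomial as its parent.
\<close>

type_synonym marked = "(bool \<times> bigraft_gen) monomial"

text \<open>
  The products of two normal monomials, computed by the rewrite rules.  Marked operations match
  none of the patterns, so that a subtree with marked root is treated like a variable.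
\<close>

fun join_ast :: "marked \<Rightarrow> marked \<Rightarrow> marked" where
  "join_ast (Op (False, Ast) x y) z = Op (False, Ast) x (join_ast y z)"
| "join_ast x z = Op (False, Ast) x z"

text \<open>
  The functions \<open>insert_succ\<close> and \<open>insert_prec\<close> take care of the case in which no rule matches the left
  factor, but the right factor may still be a product.
\<close>

fun insert_succ :: "marked \<Rightarrow> marked \<Rightarrow> marked" where
  "insert_succ x (Op (False, Ast) y z) = Op (False, Ast) (insert_succ x y) z"
| "insert_succ x z = Op (False, Succ) x z"

fun join_succ :: "marked \<Rightarrow> marked \<Rightarrow> marked" where
  "join_succ (Op (False, Ast) x y) z = join_succ x (join_succ y z)"
| "join_succ x z = insert_succ x z"

fun insert_prec :: "marked \<Rightarrow> marked \<Rightarrow> marked" where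
  "insert_prec x (Op (False, Ast) y z) = insert_prec (Op (False, Prec) x y) z"
| "insert_prec x z = Op (False, Prec) x z"

fun join_prec :: "marked \<Rightarrow> marked \<Rightarrow> marked" where
  "join_prec (Op (False, Ast) x y) z = Op (False, Ast) x (join_prec y z)"
| "join_prec (Op (False, Succ) x y) z = Op (False, Succ) x (join_prec y z)"
| "join_prec x z = insert_prec x z"

fun join :: "bigraft_gen \<Rightarrow> marked \<Rightarrow> marked \<Rightarrow> marked" where
  "join Ast = join_ast"
| "join Succ = join_succ"
| "join Prec = join_prec"

text \<open>
  The generator that can take part in a rewriting step with the parent.
\<close>

fun plain_root :: "marked \<Rightarrow> bigraft_gen option" where
  "plain_root (Op (False, g) x y) = Some g"
| "plain_root x = None"

lemma join_ast_base: "plain_root x \<noteq> Some Ast \<Longrightarrow> join_ast x z = Op (False, Ast) x z"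
  by (cases "(x, z)" rule: join_ast.cases) auto

lemma insert_succ_base: "plain_root z \<noteq> Some Ast \<Longrightarrow> insert_succ x z = Op (False, Succ) x z"
  by (cases "(x, z)" rule: insert_succ.cases) auto

lemma join_succ_base: "plain_root x \<noteq> Some Ast \<Longrightarrow> join_succ x z = insert_succ x z"
  by (cases "(x, z)" rule: join_succ.cases) auto

lemma insert_prec_base: "plain_root z \<noteq> Some Ast \<Longrightarrow> insert_prec x z = Op (False, Prec) x z"
  by (cases "(x, z)" rule: insert_prec.cases) auto

lemma join_prec_base:
  "plain_root x \<noteq> Some Ast \<Longrightarrow> plain_root x \<noteq> Some Succ \<Longrightarrow> join_prec x z = insert_prec x z"
  by (cases "(x, z)" rule: join_prec.cases) auto

lemma plain_root_Some: "plain_root x = Some g \<longleftrightarrow> (\<exists>y z. x = Op (False, g) y z)"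
  by (cases x rule: plain_root.cases) auto

text \<open>
  A product recurses along the spine of \<open>\<ast>\<close> in one of its factors, and is an explicit tree or
  another product as soon as the root is anything else.
\<close>

lemma induct_ast [case_names Ast Other]:
  assumes "\<And>y z. P y \<Longrightarrow> P z \<Longrightarrow> P (Op (False, Ast) y z)"
    and "\<And>x. plain_root x \<noteq> Some Ast \<Longrightarrow> P x"
  shows "P (x :: marked)"
proof (induction x)
  case (Op a x y)
  then show ?case using assms by (cases "plain_root (Op a x y) = Some Ast") (auto simp: plain_root_Some)
qed (use assms(2) in auto)

text \<open>
  Each relation holds by induction on the spine of the first factor, preceded, where a rule moves
  material out of the second factor, by an induction on the spine of that one.
\<close>

lemma join_ast_ast: "join_ast (join_ast x y) z = join_ast x (join_ast y z)"
  by (induction x rule: induct_ast) (auto simp: join_ast_base)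

lemma join_ast_succ: "join_succ (join_ast x y) z = join_succ x (join_succ y z)"
  by (induction x rule: induct_ast) (auto simp: join_ast_base)

lemma insert_succ_ast: "join_ast (insert_succ x y) z = insert_succ x (join_ast y z)"
  by (induction y rule: induct_ast) (auto simp: join_ast_base insert_succ_base)

lemma join_succ_ast: "join_ast (join_succ x y) z = join_succ x (join_ast y z)"
  by (induction x arbitrary: y rule: induct_ast) (auto simp: join_succ_base insert_succ_ast)

lemma insert_prec_ast: "insert_prec x (join_ast y z) = insert_prec (insert_prec x y) z"
  by (induction y arbitrary: x rule: induct_ast) (auto simp: join_ast_base insert_prec_base)

lemma plain_root_insert_prec: "plain_root (insert_prec x y) = Some Prec"
  by (induction x y rule: insert_prec.induct) auto

lemma induct_ast_succ [case_names Ast Succ Other]: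
  assumes "\<And>y z. P y \<Longrightarrow> P z \<Longrightarrow> P (Op (False, Ast) y z)"
    and "\<And>y z. P y \<Longrightarrow> P z \<Longrightarrow> P (Op (False, Succ) y z)"
    and "\<And>x. plain_root x \<noteq> Some Ast \<Longrightarrow> plain_root x \<noteq> Some Succ \<Longrightarrow> P x"
  shows "P (x :: marked)"
proof (induction x)
  case (Op a x y)
  then show ?case using assms
    by (cases "plain_root (Op a x y) = Some Ast \<or> plain_root (Op a x y) = Some Succ")
       (auto simp: plain_root_Some)
qed (use assms(3) in auto)

lemma join_prec_prec: "join_prec (join_prec x y) z = join_prec x (join_ast y z)"
  by (induction x rule: induct_ast_succ)
     (auto simp: join_prec_base insert_prec_ast plain_root_insert_prec)

lemma join_ast_prec: "join_prec (join_ast x y) z = join_ast x (join_prec y z)"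
  by (induction x rule: induct_ast) (auto simp: join_ast_base)

text \<open>
  Grafting on the right does not create a product, so it does not trigger the rule for
  \<open>x \<succ> (y \<ast> z)\<close> in the next lemma.
\<close>

lemma plain_root_join_prec:
  "plain_root y \<noteq> Some Ast \<Longrightarrow> plain_root (join_prec y z) \<noteq> Some Ast"
  by (induction y rule: induct_ast_succ) (auto simp: join_prec_base plain_root_insert_prec)

lemma insert_succ_prec: "join_prec (insert_succ x y) z = insert_succ x (join_prec y z)"
  by (induction y rule: induct_ast) (auto simp: insert_succ_base plain_root_join_prec)

lemma join_succ_prec: "join_prec (join_succ x y) z = join_succ x (join_prec y z)"
  by (induction x arbitrary: y rule: induct_ast) (auto simp: join_succ_base insert_succ_prec)

text \<open>
  This is the confluence of the rewriting system: the products of normal forms are the operations of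
  a bigraft algebra.
\<close>

lemmas join_relations =
  join_ast_ast join_ast_succ join_succ_ast join_prec_prec join_ast_prec join_succ_prec

text \<open>
  Each recursive step in the computation of a product is an instance of a relation, so a map that
  sends operations to products also respects products.
\<close>

lemma join_hom:
  assumes "\<And>g x y. h (Op (False, g) x y) = join g (h x) (h y)"
  shows "h (join g x y) = join g (h x) (h y)"
proof -
  have a: "h (join_ast x y) = join_ast (h x) (h y)" for x y
    by (induction x rule: induct_ast) (auto simp: join_ast_base assms join_ast_ast)
  have s1: "h (insert_succ x y) = join_succ (h x) (h y)" for x y
    by (induction y rule: induct_ast) (auto simp: insert_succ_base assms join_succ_ast)
  have s: "h (join_succ x y) = join_succ (h x) (h y)" for x y
    by (induction x arbitrary: y rule: induct_ast) (auto simp: join_succ_base s1 assms join_ast_succ)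
  have p1: "h (insert_prec x y) = join_prec (h x) (h y)" for x y
    by (induction y arbitrary: x rule: induct_ast) (auto simp: insert_prec_base assms join_prec_prec)
  have p: "h (join_prec x y) = join_prec (h x) (h y)" for x y
    by (induction x rule: induct_ast_succ)
       (auto simp: join_prec_base p1 assms join_ast_prec join_succ_prec)
  show ?thesis by (cases g) (simp_all add: a s p)
qed

fun mark :: "marked \<Rightarrow> marked" where
  "mark (Var i) = Var i"
| "mark (Op (b, g) x y) = Op (True, g) x y"

text \<open>
  Contraction of the edges above the marks in \<open>D\<close>: these marks are removed, and every monomial that
  arises is replaced by its normal form.  A mark is named by the set of leaves below it.
\<close>

fun nrm :: "nat set set \<Rightarrow> marked \<Rightarrow> marked" where
  "nrm D (Var i) = Var i"
| "nrm D (Op (b, g) x y) =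
     (if b \<and> set (vars x) \<union> set (vars y) \<notin> D then mark else id) (join g (nrm D x) (nrm D y))"

fun marks :: "marked \<Rightarrow> nat set set" where
  "marks (Var i) = {}"
| "marks (Op (b, g) x y) =
     (if b then {set (vars x) \<union> set (vars y)} else {}) \<union> marks x \<union> marks y"

text \<open>
  Rewriting does not change the order of the leaves.
\<close>

lemma join_append_hom:
  assumes "\<And>g x y. h (Op (False, g) x y) = h x @ h y"
  shows "h (join g x y) = h x @ h y"
proof -
  have a: "h (join_ast x y) = h x @ h y" for x y
    by (induction x rule: induct_ast) (auto simp: join_ast_base assms)
  have s1: "h (insert_succ x y) = h x @ h y" for x y
    by (induction y rule: induct_ast) (auto simp: insert_succ_base assms)
  have s: "h (join_succ x y) = h x @ h y" for x y
    by (induction x arbitrary: y rule: induct_ast) (auto simp: join_succ_base s1 assms)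
  have p1: "h (insert_prec x y) = h x @ h y" for x y
    by (induction y arbitrary: x rule: induct_ast) (auto simp: insert_prec_base assms)
  have p: "h (join_prec x y) = h x @ h y" for x y
    by (induction x rule: induct_ast_succ) (auto simp: join_prec_base p1 assms)
  show ?thesis by (cases g) (simp_all add: a s p)
qed

lemma vars_join [simp]: "vars (join g x y) = vars x @ vars y"
  by (rule join_append_hom) simp

lemma marks_join [simp]: "marks (join g x y) = marks x \<union> marks y"
proof -
  have a: "marks (join_ast x y) = marks x \<union> marks y" for x y
    by (induction x rule: induct_ast) (auto simp: join_ast_base)
  have s1: "marks (insert_succ x y) = marks x \<union> marks y" for x y
    by (induction y rule: induct_ast) (auto simp: insert_succ_base)
  have s: "marks (join_succ x y) = marks x \<union> marks y" for x y
    by (induction x arbitrary: y rule: induct_ast) (auto simp: join_succ_base s1)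
  have p1: "marks (insert_prec x y) = marks x \<union> marks y" for x y
    by (induction y arbitrary: x rule: induct_ast) (auto simp: insert_prec_base)
  have p: "marks (join_prec x y) = marks x \<union> marks y" for x y
    by (induction x rule: induct_ast_succ) (auto simp: join_prec_base p1)
  show ?thesis by (cases g) (simp_all add: a s p)
qed

lemma join_is_Op: "plain_root (join g x y) \<noteq> None"
proof -
  have a: "plain_root (join_ast x y) \<noteq> None" for x y
    by (induction x rule: induct_ast) (auto simp: join_ast_base)
  have s1: "plain_root (insert_succ x y) \<noteq> None" for x y
    by (induction y rule: induct_ast) (auto simp: insert_succ_base)
  have s: "plain_root (join_succ x y) \<noteq> None" for x y
    by (induction x arbitrary: y rule: induct_ast) (auto simp: join_succ_base s1)
  have p: "plain_root (join_prec x y) \<noteq> None" for x y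
    by (induction x rule: induct_ast_succ) (auto simp: join_prec_base plain_root_insert_prec)
  show ?thesis by (cases g) (use a s p in simp_all)
qed

lemma vars_mark [simp]: "vars (mark x) = vars x"
  by (cases x rule: mark.cases) auto

lemma mark_mark [simp]: "mark (mark x) = mark x"
  by (cases x rule: mark.cases) auto

lemma marks_mark_join [simp]:
  "marks (mark (join g x y)) = insert (set (vars x) \<union> set (vars y)) (marks x \<union> marks y)"
proof -
  obtain h a b where "join g x y = Op (False, h) a b"
    using join_is_Op[of g x y] by (cases "join g x y" rule: plain_root.cases) auto
  moreover from this have "marks a \<union> marks b = marks x \<union> marks y"
    "set (vars a) \<union> set (vars b) = set (vars x) \<union> set (vars y)"
    using marks_join[of g x y] arg_cong[OF vars_join[of g x y], of set] by auto
  ultimately show ?thesis by auto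
qed

lemma nrm_join [simp]: "nrm D (join g x y) = join g (nrm D x) (nrm D y)"
  by (rule join_hom) simp

lemma vars_nrm [simp]: "vars (nrm D m) = vars m"
  by (induction D m rule: nrm.induct) auto

lemma marks_nrm [simp]: "marks (nrm D m) = marks m - D"
  by (induction D m rule: nrm.induct) auto

lemma nrm_mark:
  "nrm D (mark x) = (if set (vars x) \<in> D then nrm D x else mark (nrm D x))"
  by (cases x rule: mark.cases) auto

text \<open>
  Contractions commute because normalising in two steps or in one step gives the same result.  This
  is what makes the differential on marked trees square to zero.
\<close>

lemma nrm_nrm: "nrm D (nrm D' m) = nrm (D \<union> D') m"
  by (induction D' m rule: nrm.induct) (auto simp: nrm_mark)

lemma nrm_cong: "D \<inter> marks m = D' \<inter> marks m \<Longrightarrow> nrm D m = nrm D' m"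
proof (induction D m rule: nrm.induct)
  case (2 D b g x y)
  have "D \<inter> marks x = D' \<inter> marks x" "D \<inter> marks y = D' \<inter> marks y"
    using 2(3) by (auto split: if_splits)
  moreover have "b \<Longrightarrow> set (vars x) \<union> set (vars y) \<in> D \<longleftrightarrow> set (vars x) \<union> set (vars y) \<in> D'"
    using 2(3) by auto
  ultimately show ?case using 2(1,2) by auto
qed auto

section \<open>A weight that decreases under rewriting\<close>

text \<open>
  The pairs of adjacent operations to which no rule applies, for a left and a right child.
\<close>

fun left_ok right_ok :: "bigraft_gen \<Rightarrow> bigraft_gen option \<Rightarrow> bool" where
  "left_ok g None = True"
| "left_ok g (Some h) = (h \<noteq> Ast \<and> \<not> (g = Prec \<and> h = Succ))"
| "right_ok g None = True"
| "right_ok g (Some h) = (h = Ast \<longrightarrow> g = Ast)"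

fun normal :: "marked \<Rightarrow> bool" where
  "normal (Var i) = True"
| "normal (Op (b, g) x y) =
     (left_ok g (plain_root x) \<and> right_ok g (plain_root y) \<and> normal x \<and> normal y)"

text \<open>
  Interpretations of the generators by functions that are strictly monotone on numbers \<open>\<ge> 2\<close> and
  decrease under all six rules.  The exponentials account for \<open>(x \<ast> y) \<succ> z \<rightarrow> x \<succ> (y \<succ> z)\<close> and
  its mirror image, where the outer factor is acted on twice; the summand \<open>b + 1\<close> makes the last
  rule, \<open>(x \<succ> y) \<prec> z \<rightarrow> x \<succ> (y \<prec> z)\<close>, strict.
\<close>

fun weight_op :: "bigraft_gen \<Rightarrow> nat \<Rightarrow> nat \<Rightarrow> nat" where
  "weight_op Ast a b = 2 * a + b + 1"
| "weight_op Succ a b = 2 ^ a * (b + 1)"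
| "weight_op Prec a b = a * 2 ^ b"

fun weight :: "marked \<Rightarrow> nat" where
  "weight (Var i) = 2"
| "weight (Op (b, g) x y) = weight_op g (weight x) (weight y)"

lemma weight_op_ge_2: "2 \<le> a \<Longrightarrow> 2 \<le> b \<Longrightarrow> 2 \<le> weight_op g a b"
proof (cases g)
  case Succ
  assume "2 \<le> a" "2 \<le> b"
  then have "1 * 2 \<le> 2 ^ a * (b + 1)" by (intro mult_le_mono) auto
  then show ?thesis using Succ by simp
next
  case Prec
  assume "2 \<le> a" "2 \<le> b"
  then have "2 * 1 \<le> a * 2 ^ b" by (intro mult_le_mono) auto
  then show ?thesis using Prec by simp
qed auto

lemma weight_ge_2: "2 \<le> weight x"
  by (induction x rule: weight.induct) (auto simp: weight_op_ge_2)

lemma weight_op_mono: "a \<le> a' \<Longrightarrow> b \<le> b' \<Longrightarrow> weight_op g a b \<le> weight_op g a' b'"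
  by (cases g) (auto intro!: mult_le_mono simp del: mult_Suc_right)

lemma weight_op_strict_left:
  assumes "a < a'" shows "weight_op g a b < weight_op g a' b"
  using assms by (cases g) (auto simp del: mult_Suc_right)

lemma weight_op_strict_right:
  assumes "b < b'" "2 \<le> a" shows "weight_op g a b < weight_op g a b'"
  using assms by (cases g) (auto simp del: mult_Suc_right)

lemma rule_ast_ast: "2 \<le> a \<Longrightarrow>
    weight_op Ast a (weight_op Ast b c) < weight_op Ast (weight_op Ast a b) c"
  by simp

lemma rule_ast_succ:
  assumes "2 \<le> a" "2 \<le> b"
  shows "weight_op Succ a (weight_op Succ b c) < weight_op Succ (weight_op Ast a b) c"
proof -
  define p :: nat where "p = 2 ^ b * (c + 1)"
  have "0 < p" by (simp add: p_def)
  then have "1 \<le> p" by simp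
  then have "p + 1 \<le> 2 * p" by simp
  also have "\<dots> < 2 ^ a * (2 * p)"
    using \<open>1 \<le> p\<close> one_less_power[of "2::nat" a] assms by simp
  finally have "2 ^ a * (p + 1) < 2 ^ a * (2 ^ a * (2 * p))" by (intro mult_strict_left_mono) auto
  moreover have "2 ^ (2 * a + b + 1) * (c + 1) = 2 ^ a * (2 ^ a * (2 * p))"
    by (simp only: power_add mult_2 p_def) (simp add: algebra_simps)
  ultimately show ?thesis by (simp add: p_def)
qed

lemma rule_succ_ast:
  assumes "2 \<le> a" "2 \<le> c"
  shows "weight_op Ast (weight_op Succ a b) c < weight_op Succ a (weight_op Ast b c)"
proof -
  have "(2::nat) ^ 2 \<le> 2 ^ a" using assms by (intro power_increasing) auto
  then have "2 ^ 2 * c \<le> 2 ^ a * c" by (rule mult_le_mono1)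
  moreover have "c + 1 < 2 ^ 2 * c" using assms by simp
  ultimately have "c + 1 < 2 ^ a * c" by (rule order_less_le_trans[rotated])
  then show ?thesis by (simp add: algebra_simps)
qed

lemma rule_prec_ast:
  assumes "2 \<le> a" "2 \<le> b"
  shows "weight_op Prec (weight_op Prec a b) c < weight_op Prec a (weight_op Ast b c)"
proof -
  have "(2::nat) ^ (b + c) < 2 ^ (2 * b + c + 1)" by (intro power_strict_increasing) auto
  then have "a * 2 ^ (b + c) < a * 2 ^ (2 * b + c + 1)" using assms by simp
  then show ?thesis by (simp add: power_add mult.assoc)
qed

lemma rule_ast_prec:
  assumes "2 \<le> a" "2 \<le> c"
  shows "weight_op Ast a (weight_op Prec b c) < weight_op Prec (weight_op Ast a b) c"
proof -
  have "(2::nat) ^ 2 \<le> 2 ^ c" using assms by (intro power_increasing) auto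
  then have "(2 * a + 1) * 1 < (2 * a + 1) * 2 ^ c" by (intro mult_strict_left_mono) auto
  then show ?thesis by (simp add: algebra_simps)
qed

lemma rule_succ_prec:
  assumes "2 \<le> a" "2 \<le> c"
  shows "weight_op Succ a (weight_op Prec b c) < weight_op Prec (weight_op Succ a b) c"
proof -
  have "b * 2 ^ c + 1 < (b + 1) * 2 ^ c"
    using one_less_power[of "2::nat" c] assms by (simp add: algebra_simps)
  then have "2 ^ a * (b * 2 ^ c + 1) < 2 ^ a * ((b + 1) * 2 ^ c)"
    by (intro mult_strict_left_mono) auto
  then show ?thesis by (simp only: weight_op.simps mult.assoc)
qed

text \<open>
  Every recursive step in the computation of a product is a rewriting step and lowers the weight, so
  the weight is preserved only if the computation stops at once.
\<close>

lemma weight_join_cases: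
  "weight (join g x y) < weight_op g (weight x) (weight y) \<or>
   left_ok g (plain_root x) \<and> right_ok g (plain_root y) \<and> join g x y = Op (False, g) x y"
proof -
  note [simp del] = weight_op.simps
  note w = weight_ge_2 and left = weight_op_mono[OF _ order_refl] and right = weight_op_mono[OF order_refl]
  have a: "weight (join_ast x y) < weight_op Ast (weight x) (weight y) \<or>
      plain_root x \<noteq> Some Ast \<and> join_ast x y = Op (False, Ast) x y" for x y
  proof (induction x rule: induct_ast)
    case (Ast u v)
    have "weight (join_ast v y) \<le> weight_op Ast (weight v) (weight y)" using Ast(2) by auto
    from right[OF this, of Ast "weight u"] show ?case
      using rule_ast_ast[OF w[of u], of "weight v" "weight y"] by simp
  qed (simp add: join_ast_base)
  have s1: "weight (insert_succ x y) < weight_op Succ (weight x) (weight y) \<or>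
      plain_root y \<noteq> Some Ast \<and> insert_succ x y = Op (False, Succ) x y" for x y
  proof (induction y rule: induct_ast)
    case (Ast u v)
    have "weight (insert_succ x u) \<le> weight_op Succ (weight x) (weight u)" using Ast(1) by auto
    from left[OF this, of Ast "weight v"] show ?case
      using rule_succ_ast[OF w[of x] w[of v], of "weight u"] by simp
  qed (simp add: insert_succ_base)
  have s: "weight (join_succ x y) < weight_op Succ (weight x) (weight y) \<or>
      plain_root x \<noteq> Some Ast \<and> plain_root y \<noteq> Some Ast \<and> join_succ x y = Op (False, Succ) x y" for x y
  proof (induction x arbitrary: y rule: induct_ast)
    case (Ast u v)
    have "weight (join_succ u (join_succ v y)) \<le> weight_op Succ (weight u) (weight (join_succ v y))"
      using Ast(1)[of "join_succ v y"] by auto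
    moreover have le: "weight (join_succ v y) \<le> weight_op Succ (weight v) (weight y)" using Ast(2)[of y] by auto
    ultimately show ?case
      using right[OF le, of Succ "weight u"] rule_ast_succ[OF w[of u] w[of v], of "weight y"] by simp
  qed (use s1 in \<open>auto simp: join_succ_base\<close>)
  have p1: "weight (insert_prec x y) < weight_op Prec (weight x) (weight y) \<or>
      plain_root y \<noteq> Some Ast \<and> insert_prec x y = Op (False, Prec) x y" for x y
  proof (induction y arbitrary: x rule: induct_ast)
    case (Ast u v)
    have "weight (insert_prec (Op (False, Prec) x u) v) \<le> weight_op Prec (weight_op Prec (weight x) (weight u)) (weight v)"
      using Ast(2)[of "Op (False, Prec) x u"] by auto
    then show ?case using rule_prec_ast[OF w[of x] w[of u], of "weight v"] by simp
  qed (simp add: insert_prec_base)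
  have p: "weight (join_prec x y) < weight_op Prec (weight x) (weight y) \<or>
      plain_root x \<noteq> Some Ast \<and> plain_root x \<noteq> Some Succ \<and> plain_root y \<noteq> Some Ast \<and>
      join_prec x y = Op (False, Prec) x y" for x y
  proof (induction x rule: induct_ast_succ)
    case (Ast u v)
    have "weight (join_prec v y) \<le> weight_op Prec (weight v) (weight y)" using Ast(2) by auto
    from right[OF this, of Ast "weight u"] show ?case
      using rule_ast_prec[OF w[of u] w[of y], of "weight v"] by simp
  next
    case (Succ u v)
    have "weight (join_prec v y) \<le> weight_op Prec (weight v) (weight y)" using Succ(2) by auto
    from right[OF this, of Succ "weight u"] show ?case
      using rule_succ_prec[OF w[of u] w[of y], of "weight v"] by simp
  qed (use p1 in \<open>auto simp: join_prec_base\<close>)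
  have "left_ok Ast r" if "r \<noteq> Some Ast" for r using that by (cases r) auto
  moreover have "left_ok Succ r" "right_ok g' r" if "r \<noteq> Some Ast" for r g' using that by (cases r; auto)+
  moreover have "left_ok Prec r" if "r \<noteq> Some Ast" "r \<noteq> Some Succ" for r using that by (cases r) auto
  moreover have "right_ok Ast r" for r by (cases r) auto
  ultimately show ?thesis
    using a[of x y] s[of x y] p[of x y] by (cases g) auto
qed

lemma weight_join_le: "weight (join g x y) \<le> weight_op g (weight x) (weight y)"
  using weight_join_cases[of g x y] by auto

lemma join_normal:
  assumes "left_ok g (plain_root x)" "right_ok g (plain_root y)"
  shows "join g x y = Op (False, g) x y"
  using assms
  by (cases g; cases "plain_root x"; cases "plain_root y")
     (auto simp: join_ast_base join_succ_base insert_succ_base join_prec_base insert_prec_base)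

lemma weight_mark [simp]: "weight (mark x) = weight x"
  by (cases x rule: mark.cases) auto

lemma nrm_normal: "normal m \<Longrightarrow> nrm {} m = m"
  by (induction m rule: normal.induct) (auto simp: join_normal)

lemma weight_nrm_le: "weight (nrm D m) \<le> weight m"
proof (induction D m rule: nrm.induct)
  case (2 D b g x y)
  have "weight (join g (nrm D x) (nrm D y)) \<le> weight_op g (weight x) (weight y)"
    using 2 weight_op_mono weight_join_le order_trans by meson
  then show ?case by auto
qed auto

text \<open>
  The quadratic property of the normal forms: a tree changes under normalisation only if some
  pair of adjacent operations can be rewritten, and then its weight drops.
\<close>

lemma weight_nrm_less: "\<not> normal m \<Longrightarrow> weight (nrm {} m) < weight m"
proof (induction m rule: normal.induct)
  case (2 b g x y)
  have [simp]: "weight (nrm {} (Op (b, g) x y)) = weight (join g (nrm {} x) (nrm {} y))" by auto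
  consider "\<not> normal x" | "normal x" "\<not> normal y" | "normal x" "normal y" by blast
  then have "weight (join g (nrm {} x) (nrm {} y)) < weight_op g (weight x) (weight y)"
  proof cases
    case 1
    have "weight_op g (weight (nrm {} x)) (weight (nrm {} y)) < weight_op g (weight x) (weight y)"
      using 2(1)[OF 1] weight_nrm_le[of "{}" y] weight_op_mono weight_op_strict_left
      by (meson order_refl order_le_less_trans)
    then show ?thesis using weight_join_le order_le_less_trans by blast
  next
    case b: 2
    have "weight_op g (weight x) (weight (nrm {} y)) < weight_op g (weight x) (weight y)"
      using 2(2)[OF b(2)] weight_op_strict_right weight_ge_2 by blast
    then show ?thesis using weight_join_le order_le_less_trans b nrm_normal by metis
  next
    case 3
    then show ?thesis using 2(3) nrm_normal weight_join_cases[of g x y] by auto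
  qed
  then show ?case by simp
qed auto

lemma nrm_id_iff: "nrm {} m = m \<longleftrightarrow> normal m"
  using nrm_normal weight_nrm_less by fastforce

text \<open>
  If the leaves are distinct, an operation is determined by the set of leaves below it.
\<close>

fun nodes :: "marked \<Rightarrow> nat set set" where
  "nodes (Var i) = {}"
| "nodes (Op g x y) = insert (set (vars x) \<union> set (vars y)) (nodes x \<union> nodes y)"

text \<open>
  A marked tree amounts to its underlying binary tree and the set of its marks.
\<close>

fun mark_at :: "nat set set \<Rightarrow> marked \<Rightarrow> marked" where
  "mark_at F (Var i) = Var i"
| "mark_at F (Op (b, g) x y) =
     Op (set (vars x) \<union> set (vars y) \<in> F, g) (mark_at F x) (mark_at F y)"

fun root :: "marked \<Rightarrow> bigraft_gen option" where
  "root (Var i) = None"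
| "root (Op (b, g) x y) = Some g"

text \<open>
  The nodes that form, with their parent, a pair to which a rule applies.  They have to be marked.
\<close>

fun bad :: "marked \<Rightarrow> nat set set" where
  "bad (Var i) = {}"
| "bad (Op (b, g) x y) =
     (if left_ok g (root x) then {} else {set (vars x)}) \<union>
     (if right_ok g (root y) then {} else {set (vars y)}) \<union> bad x \<union> bad y"

lemma vars_mark_at [simp]: "vars (mark_at F m) = vars m"
  by (induction F m rule: mark_at.induct) auto

lemma nodes_mark_at [simp]: "nodes (mark_at F m) = nodes m"
  by (induction F m rule: mark_at.induct) auto

lemma root_mark_at [simp]: "root (mark_at F m) = root m"
  by (cases "(F, m)" rule: mark_at.cases) auto

lemma bad_mark_at [simp]: "bad (mark_at F m) = bad m"
  by (induction F m rule: mark_at.induct) auto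

lemma weight_mark_at [simp]: "weight (mark_at F m) = weight m"
  by (induction F m rule: mark_at.induct) auto

lemma mark_at_mark_at [simp]: "mark_at F (mark_at F' m) = mark_at F m"
  by (induction F' m rule: mark_at.induct) auto

lemma marks_mark_at [simp]: "marks (mark_at F m) = F \<inter> nodes m"
  by (induction F m rule: mark_at.induct) auto

text \<open>
  Contraction first changes only the marks and then normalises.
\<close>

lemma nrm_mark_at: "nrm D (mark_at F m) = nrm {} (mark_at (F - D) m)"
  by (induction F m rule: mark_at.induct) auto

lemma plain_root_mark_at:
  "plain_root (mark_at F m) = (if set (vars m) \<in> F then None else root m)"
  by (cases "(F, m)" rule: mark_at.cases) auto

lemma normal_mark_at: "normal (mark_at F m) \<longleftrightarrow> bad m \<subseteq> F"
  by (induction F m rule: mark_at.induct) (auto simp: plain_root_mark_at)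

lemma vars_nonempty [simp]: "vars m \<noteq> []"
  by (induction m) auto

lemma nodes_subset: "e \<in> nodes m \<Longrightarrow> e \<noteq> {} \<and> e \<subseteq> set (vars m)"
  by (induction m) auto

lemma finite_nodes [simp]: "finite (nodes m)"
  by (induction m) auto

lemma marks_subset_nodes: "marks m \<subseteq> nodes m"
  by (induction m rule: marks.induct) auto

lemma finite_marks [simp]: "finite (marks m)"
  using finite_subset[OF marks_subset_nodes] by simp

lemma nodes_split:
  assumes "distinct (vars x @ vars y)"
  shows "nodes x \<inter> nodes y = {}" "set (vars x) \<union> set (vars y) \<notin> nodes x \<union> nodes y"
proof -
  have disj: "set (vars x) \<inter> set (vars y) = {}" using assms by auto
  show "nodes x \<inter> nodes y = {}"
  proof (rule equals0I)
    fix e assume "e \<in> nodes x \<inter> nodes y"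
    then show False using disj nodes_subset[of e x] nodes_subset[of e y] by auto
  qed
  obtain i j where ij: "i \<in> set (vars x)" "j \<in> set (vars y)"
    using vars_nonempty[of x] vars_nonempty[of y] by (meson ex_in_conv set_empty)
  show "set (vars x) \<union> set (vars y) \<notin> nodes x \<union> nodes y"
  proof
    assume "set (vars x) \<union> set (vars y) \<in> nodes x \<union> nodes y"
    then have "j \<in> set (vars x) \<or> i \<in> set (vars y)"
      using ij nodes_subset[of "set (vars x) \<union> set (vars y)" x]
        nodes_subset[of "set (vars x) \<union> set (vars y)" y] by auto
    then show False using ij disj by auto
  qed
qed

lemma card_nodes: "distinct (vars m) \<Longrightarrow> Suc (card (nodes m)) = length (vars m)"
proof (induction m)
  case (Op g x y)
  then have d: "distinct (vars x @ vars y)" by simp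
  have "card (nodes (Op g x y)) = Suc (card (nodes x) + card (nodes y))"
    using nodes_split(1)[OF d] nodes_split(2)[OF d] by (simp add: card_Un_disjoint)
  then show ?case using Op.IH d by simp
qed auto

lemma mark_at_cong: "F \<inter> nodes m = F' \<inter> nodes m \<Longrightarrow> mark_at F m = mark_at F' m"
proof (induction F m rule: mark_at.induct)
  case (2 F b g x y)
  have "F \<inter> nodes x = F' \<inter> nodes x" "F \<inter> nodes y = F' \<inter> nodes y"
    "set (vars x) \<union> set (vars y) \<in> F \<longleftrightarrow> set (vars x) \<union> set (vars y) \<in> F'"
    using 2(3) by auto
  then show ?case using 2(1,2) by simp
qed auto

lemma mark_at_marks: "distinct (vars m) \<Longrightarrow> mark_at (marks m) m = m"
proof (induction m rule: marks.induct)
  case (2 b g x y)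
  let ?t = "set (vars x) \<union> set (vars y)"
  have s: "nodes x \<inter> nodes y = {}" "?t \<notin> nodes x \<union> nodes y"
    using nodes_split[of x y] 2(3) by auto
  then have "marks y \<inter> nodes x = {}" "marks x \<inter> nodes y = {}" "?t \<notin> nodes x" "?t \<notin> nodes y"
    "?t \<notin> marks x" "?t \<notin> marks y"
    using marks_subset_nodes[of x] marks_subset_nodes[of y] by blast+
  then have eq: "marks (Op (b, g) x y) \<inter> nodes x = marks x \<inter> nodes x"
    "marks (Op (b, g) x y) \<inter> nodes y = marks y \<inter> nodes y"
    "?t \<in> marks (Op (b, g) x y) \<longleftrightarrow> b"
    by (simp_all add: Int_Un_distrib2)
  have "mark_at (marks (Op (b, g) x y)) x = x" "mark_at (marks (Op (b, g) x y)) y = y"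
    using mark_at_cong[OF eq(1)] mark_at_cong[OF eq(2)] 2 by auto
  then show ?case using eq(3) by (simp del: marks.simps)
qed auto

text \<open>
  The exponent of the sign with which an edge is removed from an orientation, the internal edges being
  ordered by the numbers that encode their sets of leaves.
\<close>

definition rank :: "nat set set \<Rightarrow> nat set \<Rightarrow> nat" where
  "rank E e = card {f \<in> E. set_encode f < set_encode e}"

lemma rank_remove_greater:
  "set_encode e < set_encode f \<Longrightarrow> rank (E - {f}) e = rank E e"
  unfolding rank_def by (rule arg_cong[of _ _ card]) auto

lemma rank_remove_less:
  assumes "finite E" "e \<in> E" "set_encode e < set_encode f"
  shows "rank E f = Suc (rank (E - {e}) f)"
proof -
  have "{g \<in> E. set_encode g < set_encode f} = insert e {g \<in> E - {e}. set_encode g < set_encode f}"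
    using assms by auto
  then show ?thesis unfolding rank_def using assms(1) by simp
qed

text \<open>
  Removing \<open>e\<close> before \<open>f\<close> and \<open>f\<close> before \<open>e\<close> gives opposite signs.  The sum is split by the order of
  \<open>e\<close> and \<open>f\<close>, since in characteristic two antisymmetry alone would not be enough.
\<close>

lemma signed_sum_twice:
  fixes X :: "nat set \<Rightarrow> nat set \<Rightarrow> 'k::comm_ring_1"
  assumes fin: "finite E" and fin': "\<And>e. e \<in> E \<Longrightarrow> finite e" and sym: "\<And>e f. X e f = X f e"
  shows "(\<Sum>e\<in>E. (- 1) ^ rank E e * (\<Sum>f\<in>E - {e}. (- 1) ^ rank (E - {e}) f * X e f)) = 0"
proof -
  let ?lt = "\<lambda>e f. set_encode e < set_encode f"
  let ?T = "\<lambda>e f. (- 1) ^ rank E e * ((- 1) ^ rank (E - {e}) f * X e f)"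
  have split: "E - {e} = {f \<in> E. ?lt e f} \<union> {f \<in> E. ?lt f e}" if "e \<in> E" for e
  proof -
    have "set_encode e \<noteq> set_encode f" if "f \<in> E" "f \<noteq> e" for f
      using that \<open>e \<in> E\<close> fin' inj_on_set_encode by (auto simp: inj_on_def)
    then show ?thesis by (auto simp: neq_iff)
  qed
  have "(\<Sum>e\<in>E. (- 1) ^ rank E e * (\<Sum>f\<in>E - {e}. (- 1) ^ rank (E - {e}) f * X e f)) =
      (\<Sum>e\<in>E. \<Sum>f\<in>E - {e}. ?T e f)"
    by (simp add: sum_distrib_left)
  also have "\<dots> = (\<Sum>e\<in>E. (\<Sum>f\<in>{f \<in> E. ?lt e f}. ?T e f) + (\<Sum>f\<in>{f \<in> E. ?lt f e}. ?T e f))"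
  proof (rule sum.cong[OF refl])
    fix e assume "e \<in> E"
    then show "(\<Sum>f\<in>E - {e}. ?T e f) =
        (\<Sum>f\<in>{f \<in> E. ?lt e f}. ?T e f) + (\<Sum>f\<in>{f \<in> E. ?lt f e}. ?T e f)"
      unfolding split[OF \<open>e \<in> E\<close>] using fin by (intro sum.union_disjoint) auto
  qed
  also have "\<dots> = (\<Sum>e\<in>E. \<Sum>f\<in>{f \<in> E. ?lt e f}. ?T e f) + (\<Sum>e\<in>E. \<Sum>f\<in>{f \<in> E. ?lt f e}. ?T e f)"
    by (rule sum.distrib)
  also have "(\<Sum>e\<in>E. \<Sum>f\<in>{f \<in> E. ?lt f e}. ?T e f) = (\<Sum>f\<in>E. \<Sum>e\<in>{e \<in> E. ?lt f e}. ?T e f)"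
    using fin by (intro sum.swap_restrict) auto
  also have "(\<Sum>e\<in>E. \<Sum>f\<in>{f \<in> E. ?lt e f}. ?T e f) + (\<Sum>f\<in>E. \<Sum>e\<in>{e \<in> E. ?lt f e}. ?T e f) =
      (\<Sum>e\<in>E. \<Sum>f\<in>{f \<in> E. ?lt e f}. ?T e f + ?T f e)"
    by (simp add: sum.distrib)
  also have "\<dots> = 0"
  proof (intro sum.neutral ballI)
    fix e f assume "e \<in> E" "f \<in> {f \<in> E. ?lt e f}"
    then have "rank E f = Suc (rank (E - {e}) f)" "rank (E - {f}) e = rank E e"
      using fin rank_remove_less rank_remove_greater by auto
    then show "?T e f + ?T f e = 0" using sym[of e f] by simp
  qed
  finally show ?thesis .
qed

section \<open>Exactness of the complex of marked trees\<close>

text \<open>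
  The basis of the bar complex in arity \<open>n\<close>: trees with \<open>v\<close> normal monomials as vertices.  The mark of
  the root is not an internal edge.
\<close>

definition models :: "nat \<Rightarrow> nat \<Rightarrow> marked set" where
  "models n v = {m. distinct (vars m) \<and> set (vars m) = {..<n} \<and> normal m \<and>
     {..<n} \<in> marks m \<and> card (marks m) = v}"

definition inner_marks :: "marked \<Rightarrow> nat set set" where
  "inner_marks m = marks m - {set (vars m)}"

definition delta :: "(marked \<Rightarrow> 'k::field) \<Rightarrow> marked \<Rightarrow> 'k" where
  "delta \<psi> m = (\<Sum>e\<in>inner_marks m. (- 1) ^ rank (inner_marks m) e * \<psi> (nrm {e} m))"

lemma inner_marks_nrm: "inner_marks (nrm {e} m) = inner_marks m - {e}"
  by (auto simp: inner_marks_def)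

lemma finite_inner_marks [simp]: "finite (inner_marks m)"
  by (simp add: inner_marks_def)

lemma finite_inner_mark: "e \<in> inner_marks m \<Longrightarrow> finite e"
  using marks_subset_nodes nodes_subset finite_subset unfolding inner_marks_def
  by (metis DiffD1 List.finite_set subsetD)

lemma delta_delta: "delta (delta \<psi>) m = 0"
  unfolding delta_def inner_marks_nrm nrm_nrm
  by (rule signed_sum_twice) (auto simp: insert_commute finite_inner_mark)

lemma nrm_models:
  assumes "m \<in> models n (Suc v)" "e \<in> inner_marks m"
  shows "nrm {e} m \<in> models n v"
proof -
  have "normal (nrm {e} m)" using nrm_nrm[of "{}" "{e}" m] nrm_id_iff by simp
  then show ?thesis using assms by (auto simp: models_def inner_marks_def)
qed

text \<open>
  Any choice works that depends on the underlying binary tree only.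
\<close>

definition toggle :: "marked \<Rightarrow> nat set" where
  "toggle m = (SOME e. e \<in> nodes m \<and> e \<noteq> set (vars m) \<and> e \<notin> bad m)"

lemma toggle_mark_at [simp]: "toggle (mark_at F m) = toggle m"
  by (simp add: toggle_def)

text \<open>
  If all inner nodes were bad, then all nodes would be marked, and there are \<open>n - 1\<close> of them.
\<close>

lemma toggle:
  assumes "m \<in> models n v" "v < n - 1"
  shows "toggle m \<in> nodes m" "toggle m \<noteq> {..<n}" "toggle m \<notin> bad m"
proof -
  have "distinct (vars m)" using assms by (simp add: models_def)
  then have "bad m \<subseteq> marks m"
    using assms normal_mark_at[of "marks m" m] by (simp add: models_def mark_at_marks)
  moreover have "\<not> nodes m \<subseteq> marks m"
  proof
    assume "nodes m \<subseteq> marks m"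
    then have "card (nodes m) \<le> v" using assms card_mono[of "marks m"] by (auto simp: models_def)
    then show False
      using card_nodes[OF \<open>distinct (vars m)\<close>] assms distinct_card[OF \<open>distinct (vars m)\<close>]
      by (simp add: models_def)
  qed
  ultimately have "\<exists>e. e \<in> nodes m \<and> e \<noteq> set (vars m) \<and> e \<notin> bad m"
    using assms by (auto simp: models_def)
  from someI_ex[OF this] show "toggle m \<in> nodes m" "toggle m \<noteq> {..<n}" "toggle m \<notin> bad m"
    using assms by (auto simp: models_def toggle_def)
qed

text \<open>
  Up to terms of lower weight, contraction only removes a mark.
\<close>

lemma face_cases:
  assumes "distinct (vars m)"
  shows "nrm {e} m = mark_at (marks m - {e}) m \<or> weight (nrm {e} m) < weight m"
proof -
  let ?m = "mark_at (marks m - {e}) m"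
  have eq: "nrm {e} m = nrm {} ?m"
    using nrm_mark_at[of "{e}" "marks m" m] unfolding mark_at_marks[OF assms] .
  show ?thesis
  proof (cases "normal ?m")
    case True
    then show ?thesis unfolding eq by (simp add: nrm_normal)
  next
    case False
    then show ?thesis using weight_nrm_less[OF False] unfolding eq by simp
  qed
qed

lemma face_toggle:
  assumes "distinct (vars m)" "normal m" "toggle m \<notin> bad m"
  shows "nrm {toggle m} m = mark_at (marks m - {toggle m}) m"
proof -
  have "bad m \<subseteq> marks m"
    using assms normal_mark_at[of "marks m" m] by (simp add: mark_at_marks)
  then have "normal (mark_at (marks m - {toggle m}) m)" using assms(3) by (auto simp: normal_mark_at)
  then show ?thesis
    using nrm_mark_at[of "{toggle m}" "marks m" m] unfolding mark_at_marks[OF assms(1)]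
    by (simp add: nrm_normal)
qed

text \<open>
  The value at a tree \<open>m\<close> without the chosen mark is determined by the equation
  \<open>delta (primitive \<phi>) m' = \<phi> m'\<close> at the tree \<open>m'\<close> with the mark added: the other faces of \<open>m'\<close> have lower
  weight, or contain the chosen mark, where the primitive is set to zero.  The test on the weight
  in the sum separates these two cases.
\<close>

function primitive :: "(marked \<Rightarrow> 'k::field) \<Rightarrow> marked \<Rightarrow> 'k" where
  "primitive \<phi> m =
     (if toggle m \<in> marks m then 0 else
       let m' = mark_at (insert (toggle m) (marks m)) m; E = inner_marks m' in
       (- 1) ^ rank E (toggle m) *
         (\<phi> m' - (\<Sum>e\<in>E - {toggle m}. (- 1) ^ rank E e *
            (if weight (nrm {e} m') < weight m then primitive \<phi> (nrm {e} m') else 0))))"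
  by pat_completeness auto
termination by (relation "measure (\<lambda>(\<phi>, m). weight m)") auto

declare primitive.simps [simp del]

text \<open>
  At trees with the chosen mark the equation holds by construction.
\<close>

lemma delta_primitive_marked:
  assumes m: "m \<in> models n v" "v < n - 1" and c: "toggle m \<in> marks m"
  shows "delta (primitive \<phi>) m = \<phi> m"
proof -
  note t = toggle[OF m]
  have d: "distinct (vars m)" and nm: "normal m" and vs: "set (vars m) = {..<n}"
    using m by (auto simp: models_def)
  let ?c = "toggle m" and ?E = "inner_marks m"
  let ?m0 = "mark_at (marks m - {?c}) m"
  have cE: "?c \<in> ?E" using c t vs by (simp add: inner_marks_def)
  have restore: "mark_at (insert ?c (marks ?m0)) ?m0 = m"
  proof -
    have "insert ?c ((marks m - {?c}) \<inter> nodes m) = marks m"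
      using c marks_subset_nodes by auto
    then show ?thesis using mark_at_marks[OF d] by simp
  qed
  have tail: "(if weight (nrm {e} m) < weight m then primitive \<phi> (nrm {e} m) else 0) =
      primitive \<phi> (nrm {e} m)" if "e \<in> ?E - {?c}" for e
  proof (cases "weight (nrm {e} m) < weight m")
    case False
    then have "nrm {e} m = mark_at (marks m - {e}) m" using face_cases[OF d] by blast
    then have "toggle (nrm {e} m) \<in> marks (nrm {e} m)" using that c t(1)
      by (simp add: eq_commute[of "toggle m" e])
    then show ?thesis by (simp add: primitive.simps)
  qed simp
  have tail_sum: "(\<Sum>e\<in>?E - {?c}. (- 1) ^ rank ?E e *
        (if weight (nrm {e} m) < weight m then primitive \<phi> (nrm {e} m) else 0)) =
      (\<Sum>e\<in>?E - {?c}. (- 1) ^ rank ?E e * primitive \<phi> (nrm {e} m))"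
    by (rule sum.cong[OF refl], rule arg_cong[OF tail])
  have "primitive \<phi> ?m0 = (- 1) ^ rank ?E ?c *
      (\<phi> m - (\<Sum>e\<in>?E - {?c}. (- 1) ^ rank ?E e * primitive \<phi> (nrm {e} m)))"
    by (subst primitive.simps) (simp add: restore[simplified] Let_def tail_sum)
  moreover have "delta (primitive \<phi>) m = (- 1) ^ rank ?E ?c * primitive \<phi> (nrm {?c} m) +
      (\<Sum>e\<in>?E - {?c}. (- 1) ^ rank ?E e * primitive \<phi> (nrm {e} m))"
    unfolding delta_def by (rule sum.remove) (use cE in auto)
  ultimately show ?thesis using face_toggle[OF d nm t(3)] by simp
qed

lemma delta_diff: "delta (\<lambda>m. \<phi> m - \<psi> m) m = delta \<phi> m - delta \<psi> m"
  by (simp add: delta_def right_diff_distrib sum_subtractf)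

text \<open>
  The difference \<open>\<phi> - delta (primitive \<phi>)\<close> is closed and vanishes at trees with the chosen mark.  If the
  mark is missing, closedness at the tree with the mark added expresses the value by values at the other faces,
  which vanish for one of two reasons: the chosen mark, or the smaller weight.
\<close>

lemma delta_primitive:
  fixes \<phi> :: "marked \<Rightarrow> 'k::field"
  assumes "Suc v < n - 1" "\<And>m. m \<in> models n (Suc (Suc v)) \<Longrightarrow> delta \<phi> m = 0"
    and "m \<in> models n (Suc v)"
  shows "delta (primitive \<phi>) m = \<phi> m"
  using assms(3)
proof (induction "weight m" arbitrary: m rule: less_induct)
  case less
  show ?case
  proof (cases "toggle m \<in> marks m")
    case True
    then show ?thesis using delta_primitive_marked less.prems assms(1) by blast
  next
    case False
    note t = toggle[OF less.prems assms(1)]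
    have d: "distinct (vars m)" and nm: "normal m" and vs: "set (vars m) = {..<n}"
      and top: "{..<n} \<in> marks m" and cm: "card (marks m) = Suc v"
      using less.prems by (auto simp: models_def)
    let ?c = "toggle m"
    define m' where "m' = mark_at (insert ?c (marks m)) m"
    have marks': "marks m' = insert ?c (marks m)"
      using t marks_subset_nodes[of m] by (auto simp: m'_def)
    have tm': "toggle m' = ?c" and vm': "vars m' = vars m" and wm': "weight m' = weight m"
      by (simp_all add: m'_def)
    have "bad m \<subseteq> marks m"
      using nm normal_mark_at[of "marks m" m] by (simp add: mark_at_marks d)
    then have nm': "normal m'" unfolding m'_def normal_mark_at by auto
    have m': "m' \<in> models n (Suc (Suc v))"
      using d vs nm' top cm marks' vm' False by (simp add: models_def)
    have restore: "nrm {?c} m' = m"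
    proof -
      have "nrm {?c} m' = mark_at (marks m' - {?c}) m'"
        using face_toggle[of m'] d nm' t(3) vm' tm' by (simp add: m'_def)
      also have "\<dots> = mark_at (marks m) m" using False marks' by (simp add: m'_def)
      finally show ?thesis by (simp add: mark_at_marks d)
    qed
    let ?E = "inner_marks m'"
    \<comment> \<open>all faces of \<open>m'\<close> but \<open>m\<close> itself contribute zero to the closedness of this difference\<close>
    let ?\<chi> = "\<lambda>m. \<phi> m - delta (primitive \<phi>) m"
    have cE: "?c \<in> ?E" using marks' t vs vm' by (simp add: inner_marks_def)
    have zero: "?\<chi> (nrm {e} m') = 0" if e: "e \<in> ?E - {?c}" for e
    proof -
      have mod: "nrm {e} m' \<in> models n (Suc v)" using nrm_models[OF m'] e by simp
      have "nrm {e} m' = mark_at (marks m' - {e}) m' \<or> weight (nrm {e} m') < weight m"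
        using face_cases[of m' e] d vm' wm' by simp
      then show ?thesis
      proof
        assume "nrm {e} m' = mark_at (marks m' - {e}) m'"
        then have "toggle (nrm {e} m') \<in> marks (nrm {e} m')"
          using e marks' tm' t by (auto simp: m'_def)
        from delta_primitive_marked[OF mod assms(1) this, of \<phi>] show ?thesis by simp
      qed (use less.hyps mod in simp)
    qed
    have "0 = delta ?\<chi> m'"
      using assms(2)[OF m'] by (simp add: delta_diff delta_delta)
    also have "\<dots> = (- 1) ^ rank ?E ?c * ?\<chi> (nrm {?c} m') +
        (\<Sum>e\<in>?E - {?c}. (- 1) ^ rank ?E e * ?\<chi> (nrm {e} m'))"
      unfolding delta_def[of ?\<chi>] by (rule sum.remove) (use cE in auto)
    also have "\<dots> = (- 1) ^ rank ?E ?c * ?\<chi> m"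
      using zero restore by simp
    finally show ?thesis by simp
  qed
qed

section \<open>The free operad\<close>

abbreviation supp :: "('a \<Rightarrow>\<^sub>0 'b::zero) \<Rightarrow> 'a set" where
  "supp \<equiv> Poly_Mapping.keys"

abbreviation coeff :: "('a \<Rightarrow>\<^sub>0 'b::zero) \<Rightarrow> 'a \<Rightarrow> 'b" where
  "coeff \<equiv> Poly_Mapping.lookup"

abbreviation single :: "'a \<Rightarrow> 'b::zero \<Rightarrow> 'a \<Rightarrow>\<^sub>0 'b" where
  "single \<equiv> Poly_Mapping.single"

lemma sum_keys_superset:
  assumes "finite S" "supp p \<subseteq> S" "\<And>u. F u 0 = 0"
  shows "(\<Sum>u\<in>supp p. F u (coeff p u)) =
    (\<Sum>u\<in>S. F u (coeff p u))"
  using assms by (intro sum.mono_neutral_left) (auto simp: in_keys_iff)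

lemma sum_keys_add:
  fixes F :: "'a \<Rightarrow> 'k::comm_monoid_add \<Rightarrow> 'b::comm_monoid_add"
  assumes "\<And>u. F u 0 = 0" "\<And>u a b. F u (a + b) = F u a + F u b"
  shows "(\<Sum>u\<in>supp (p + q). F u (coeff (p + q) u)) =
    (\<Sum>u\<in>supp p. F u (coeff p u)) +
    (\<Sum>u\<in>supp q. F u (coeff q u))"
proof -
  let ?S = "supp p \<union> supp q"
  have "supp (p + q) \<subseteq> ?S" by (rule Poly_Mapping.keys_add)
  then show ?thesis
    using assms sum_keys_superset[of ?S p F] sum_keys_superset[of ?S q F]
      sum_keys_superset[of ?S "p + q" F]
    by (simp add: sum.distrib lookup_add)
qed

text \<open>
  The linear extension of a function on a basis.
\<close>

definition lin :: "('a \<Rightarrow> 'k::field) \<Rightarrow> ('a \<Rightarrow>\<^sub>0 'k) \<Rightarrow> 'k" where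
  "lin G p = (\<Sum>u\<in>supp p. coeff p u * G u)"

lemma lin_zero [simp]: "lin G 0 = 0"
  by (simp add: lin_def)

lemma lin_single [simp]: "lin G (single u c) = c * G u"
  by (cases "c = 0") (auto simp: lin_def)

lemma lin_add [simp]: "lin G (p + q) = lin G p + lin G q"
  unfolding lin_def by (rule sum_keys_add) (auto simp: distrib_right)

lemma lin_sum: "lin G (\<Sum>i\<in>S. h i) = (\<Sum>i\<in>S. lin G (h i))"
  by (induction S rule: infinite_finite_induct) auto

lemma lin_diff [simp]: "lin G (p - q) = lin G p - lin G q"
  by (metis add_diff_cancel_right' diff_add_cancel lin_add)

lemma lookup_map_times [simp]:
  "coeff (Poly_Mapping.map (\<lambda>a. c * a) p) u = c * coeff p (u :: 'a) "
  for c :: "'k::field"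
  by (simp add: Poly_Mapping.map.rep_eq when_def)

lemma lin_scl [simp]: "lin G (Poly_Mapping.map (\<lambda>a. c * a) p) = c * lin G p"
proof -
  have "supp (Poly_Mapping.map (\<lambda>a. c * a) p) \<subseteq> supp p"
    by (auto simp: in_keys_iff)
  from sum_keys_superset[OF _ this, of "\<lambda>u a. a * G u"] show ?thesis
    by (simp add: lin_def sum_distrib_left mult.assoc)
qed

lemma lin_cong: "(\<And>u. u \<in> supp p \<Longrightarrow> G u = H u) \<Longrightarrow> lin G p = lin H p"
  by (auto simp: lin_def intro: sum.cong)

lemma lin_swap: "lin (\<lambda>u. lin (\<lambda>w. H u w) q) p = lin (\<lambda>w. lin (\<lambda>u. H u w) p) q"
  unfolding lin_def sum_distrib_left
  by (subst sum.swap) (simp add: mult.left_commute)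

lemma lin_0 [simp]: "lin (\<lambda>u. 0) p = 0"
  by (simp add: lin_def)

lemma free_operad_simps [simp]:
  "p \<in> ops free_operad n \<longleftrightarrow> supp p \<subseteq> monomials n"
  "zro free_operad n = 0"
  "add free_operad n p q = p + q"
  "scl free_operad n c p = Poly_Mapping.map (\<lambda>a. c * a) p"
  by (auto simp: free_operad_def)

lemma act_free: "act free_operad n \<sigma> p = (\<Sum>t\<in>supp p.
    single (rename_monomial \<sigma> t) (coeff p t))"
  by (simp add: free_operad_def)

lemma pcomp_free: "pcomp free_operad m n i p q = (\<Sum>s\<in>supp p. \<Sum>t\<in>supp q.
    single (comp_monomial n i s t) (coeff p s * coeff q t))"
  by (simp add: free_operad_def)

lemma act_free_add: "act free_operad n \<sigma> (p + q) = act free_operad n \<sigma> p + act free_operad n \<sigma> q"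
  unfolding act_free by (rule sum_keys_add) (auto simp: single_add)

lemma pcomp_free_add_left:
  "pcomp free_operad m n i (p + p') q = pcomp free_operad m n i p q + pcomp free_operad m n i p' q"
  unfolding pcomp_free
  by (rule sum_keys_add[where F = "\<lambda>s a. \<Sum>t\<in>supp q. single (comp_monomial n i s t) (a * coeff q t)"])
     (auto simp: single_add distrib_right sum.distrib)

lemma pcomp_free_add_right:
  "pcomp free_operad m n i p (q + q') = pcomp free_operad m n i p q + pcomp free_operad m n i p q'"
  unfolding pcomp_free sum.distrib[symmetric]
  by (rule sum.cong[OF refl], rule sum_keys_add) (auto simp: single_add distrib_left)

lemma act_free_single [simp]:
  "act free_operad n \<sigma> (single u c) = single (rename_monomial \<sigma> u) c"
  by (cases "c = 0") (auto simp: act_free)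

lemma pcomp_free_single [simp]:
  "pcomp free_operad m n i (single s a) (single t b) =
     single (comp_monomial n i s t) (a * b)"
  by (cases "a = 0"; cases "b = 0") (auto simp: pcomp_free)

lemma lin_act: "lin G (act free_operad n \<sigma> p) = lin (\<lambda>u. G (rename_monomial \<sigma> u)) p"
  by (simp add: act_free lin_sum) (simp add: lin_def)

lemma lin_pcomp:
  "lin G (pcomp free_operad m n i p q) = lin (\<lambda>s. lin (\<lambda>t. G (comp_monomial n i s t)) q) p"
  by (simp add: pcomp_free lin_sum) (simp add: lin_def sum_distrib_left mult.assoc)

lemma vars_substitute: "vars (substitute f t) = concat (map (\<lambda>i. vars (f i)) (vars t))"
  by (induction t) auto

lemma vars_rename [simp]: "vars (rename_monomial \<sigma> t) = map \<sigma> (vars t)"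
  by (simp add: rename_monomial_def vars_substitute)

lemma rename_monomials:
  assumes "t \<in> monomials n" "\<sigma> permutes {..<n}"
  shows "rename_monomial \<sigma> t \<in> monomials n"
  using assms permutes_image[OF assms(2)] permutes_inj_on[OF assms(2)]
  by (auto simp: monomials_def distinct_map)

lemma distinct_concat_map:
  assumes "distinct xs" "\<And>x. x \<in> set xs \<Longrightarrow> distinct (f x)"
    and "\<And>x y. x \<in> set xs \<Longrightarrow> y \<in> set xs \<Longrightarrow> x \<noteq> y \<Longrightarrow> set (f x) \<inter> set (f y) = {}"
  shows "distinct (concat (map f xs))"
  using assms
proof (induction xs)
  case (Cons x xs)
  have "distinct (concat (map f xs))"
    using Cons.prems by (intro Cons.IH) auto
  moreover have "set (f x) \<inter> set (f y) = {}" if "y \<in> set xs" for y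
    using Cons.prems(1) Cons.prems(3)[of x y] that by auto
  ultimately show ?case using Cons.prems(2)[of x] by auto
qed auto

text \<open>
  The variables of the composite are obtained from those of \<open>s\<close> by replacing the variable \<open>i\<close> by
  a block and moving the larger ones; the blocks are disjoint and fill an interval.
\<close>

lemma comp_monomials:
  assumes s: "s \<in> monomials m" and t: "t \<in> monomials n" and i: "i < m"
  shows "comp_monomial n i s t \<in> monomials (m + n - 1)"
proof -
  define f where
    "f j = (if j < i then [j] else if j = i then map (\<lambda>l. l + i) (vars t) else [j + n - 1])" for j
  have eq: "vars (comp_monomial n i s t) = concat (map f (vars s))"
    unfolding comp_monomial_def vars_substitute
    by (intro arg_cong[of _ _ concat] map_cong) (auto simp: f_def)
  have t': "distinct (vars t)" "set (vars t) = {..<n}" and s': "distinct (vars s)" "set (vars s) = {..<m}"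
    using s t by (auto simp: monomials_def)
  have n: "0 < n"
    using t'(2) vars_nonempty[of t] by (cases n) auto
  have mem: "x \<in> set (f j) \<longleftrightarrow>
      j < i \<and> x = j \<or> j = i \<and> i \<le> x \<and> x < i + n \<or> i < j \<and> x = j + n - 1" for x j
  proof -
    have "x \<in> set (map (\<lambda>l. l + i) (vars t)) \<longleftrightarrow> i \<le> x \<and> x < i + n"
      unfolding set_map t'(2) image_iff by (auto intro: bexI[of _ "x - i"])
    then show ?thesis by (simp add: f_def)
  qed
  have "distinct (concat (map f (vars s)))"
  proof (rule distinct_concat_map)
    show "distinct (f x)" for x by (simp add: f_def t'(1) distinct_map)
    show "set (f x) \<inter> set (f y) = {}" if "x \<noteq> y" for x y
    proof (rule equals0I)
      fix z assume "z \<in> set (f x) \<inter> set (f y)"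
      then show False using that n unfolding Int_iff mem by linarith
    qed
  qed (rule s'(1))
  moreover have "set (concat (map f (vars s))) = {..<m + n - 1}"
  proof (rule set_eqI)
    fix x
    have "(\<exists>j<m. x \<in> set (f j)) \<longleftrightarrow> x < m + n - 1"
    proof
      assume "\<exists>j<m. x \<in> set (f j)"
      then show "x < m + n - 1" unfolding mem using i n by fastforce
    next
      assume x: "x < m + n - 1"
      consider "x < i" | "i \<le> x" "x < i + n" | "i + n \<le> x" by linarith
      then show "\<exists>j<m. x \<in> set (f j)" unfolding mem
      proof cases
        case 1
        then show "\<exists>j<m. j < i \<and> x = j \<or> j = i \<and> i \<le> x \<and> x < i + n \<or> i < j \<and> x = j + n - 1"
          using i by (intro exI[of _ x]) auto
      next
        case 3
        then have "i < x + 1 - n" "x + 1 - n < m" "x = x + 1 - n + n - 1" using x n by linarith+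
        then show "\<exists>j<m. j < i \<and> x = j \<or> j = i \<and> i \<le> x \<and> x < i + n \<or> i < j \<and> x = j + n - 1"
          by blast
      qed (use i in auto)
    qed
    then show "x \<in> set (concat (map f (vars s))) \<longleftrightarrow> x \<in> {..<m + n - 1}"
      by (auto simp: s'(2))
  qed
  ultimately show ?thesis by (simp only: monomials_def mem_Collect_eq eq simp_thms)
qed

lemma keys_sum_subset:
  assumes "\<And>i. i \<in> S \<Longrightarrow> supp (h i) \<subseteq> M"
  shows "supp (\<Sum>i\<in>S. h i) \<subseteq> M"
  using assms
proof (induction S rule: infinite_finite_induct)
  case (insert x F)
  then show ?case using Poly_Mapping.keys_add[of "h x" "sum h F"] by auto
qed auto

lemma keys_single_subset: "u \<in> M \<Longrightarrow> supp (single u c) \<subseteq> M"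
  by simp

lemma keys_act:
  assumes "supp p \<subseteq> monomials n" "\<sigma> permutes {..<n}"
  shows "supp (act free_operad n \<sigma> p) \<subseteq> monomials n"
  unfolding act_free using assms
  by (intro keys_sum_subset keys_single_subset rename_monomials) auto

lemma keys_pcomp:
  assumes "supp p \<subseteq> monomials m" "supp q \<subseteq> monomials n" "i < m"
  shows "supp (pcomp free_operad m n i p q) \<subseteq> monomials (m + n - 1)"
  unfolding pcomp_free using assms
  by (intro keys_sum_subset keys_single_subset comp_monomials) auto

lemma keys_add_subset:
  "supp p \<subseteq> M \<Longrightarrow> supp q \<subseteq> M \<Longrightarrow> supp (p + q) \<subseteq> M"
  using Poly_Mapping.keys_add[of p q] by auto

lemma keys_scl_subset:
  "supp p \<subseteq> M \<Longrightarrow> supp (Poly_Mapping.map (\<lambda>a. c * a) p) \<subseteq> M"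
  for c :: "'k::field"
  by (auto simp: in_keys_iff subset_iff)

section \<open>Quotients by quadratic relations\<close>

locale quadratic_data =
  fixes R :: "('g monomial \<Rightarrow>\<^sub>0 'k::field) set"
  assumes relations_ternary: "r \<in> R \<Longrightarrow> supp r \<subseteq> monomials 3"
begin

definition ideal :: "nat \<Rightarrow> ('g monomial \<Rightarrow>\<^sub>0 'k) \<Rightarrow> bool" where
  "ideal = operad_ideal free_operad (\<lambda>n. if n = 3 then R else {})"

definition cls :: "nat \<Rightarrow> ('g monomial \<Rightarrow>\<^sub>0 'k) \<Rightarrow> ('g monomial \<Rightarrow>\<^sub>0 'k) set" where
  "cls = coset free_operad ideal"

abbreviation Q :: "('k, ('g monomial \<Rightarrow>\<^sub>0 'k) set) operad" where
  "Q \<equiv> quadratic_operad R"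

lemma Q_eq: "Q = quotient_operad free_operad ideal"
  by (simp add: quadratic_operad_def ideal_def)

lemma ideal_keys: "ideal n z \<Longrightarrow> supp z \<subseteq> monomials n"
  unfolding ideal_def
proof (induction rule: operad_ideal.induct)
  case (rel r n)
  then show ?case using relations_ternary by (auto split: if_splits)
qed (simp_all add: keys_add_subset keys_scl_subset keys_act keys_pcomp del: One_nat_def)

lemma ideal_zero [simp]: "ideal n 0"
  using operad_ideal.zro[of free_operad _ n] by (simp add: ideal_def)

lemma ideal_add: "ideal n p \<Longrightarrow> ideal n q \<Longrightarrow> ideal n (p + q)"
  using operad_ideal.add[of free_operad _ n p q] by (simp add: ideal_def)

lemma ideal_scl: "ideal n p \<Longrightarrow> ideal n (Poly_Mapping.map (\<lambda>a. c * a) p)"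
  using operad_ideal.scl[of free_operad _ n p c] by (simp add: ideal_def)

lemma ideal_act: "ideal n p \<Longrightarrow> \<sigma> permutes {..<n} \<Longrightarrow> ideal n (act free_operad n \<sigma> p)"
  unfolding ideal_def by (rule operad_ideal.act)

lemma ideal_comp_left:
  "ideal m p \<Longrightarrow> supp q \<subseteq> monomials n \<Longrightarrow> i < m \<Longrightarrow>
    ideal (m + n - 1) (pcomp free_operad m n i p q)"
  unfolding ideal_def by (rule operad_ideal.comp_left) auto

lemma ideal_comp_right:
  "supp p \<subseteq> monomials m \<Longrightarrow> ideal n q \<Longrightarrow> i < m \<Longrightarrow>
    ideal (m + n - 1) (pcomp free_operad m n i p q)"
  unfolding ideal_def by (rule operad_ideal.comp_right) auto

lemma ideal_uminus: "ideal n p \<Longrightarrow> ideal n (- p)"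
proof -
  have "- p = Poly_Mapping.map (\<lambda>a. (- 1) * a) p"
    by (rule poly_mapping_eqI) (subst lookup_map_times, simp)
  then show "ideal n p \<Longrightarrow> ideal n (- p)" using ideal_scl[of n p "- 1"] by simp
qed

lemma ideal_diff: "ideal n p \<Longrightarrow> ideal n q \<Longrightarrow> ideal n (p - q)"
  using ideal_add[of n p "- q"] ideal_uminus by simp

lemma cls_alt: "cls n p = {q. ideal n (q - p)}"
  by (auto simp: cls_def coset_def intro!: exI[of _ "_ - p"])

lemma cls_self [simp]: "p \<in> cls n p"
  by (simp add: cls_alt)

lemma cls_eq_iff: "cls n p = cls n q \<longleftrightarrow> ideal n (p - q)"
proof
  assume "cls n p = cls n q"
  then show "ideal n (p - q)" using cls_self[of p n] by (simp add: cls_alt)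
next
  assume h: "ideal n (p - q)"
  have "ideal n (x - p) \<longleftrightarrow> ideal n (x - q)" for x
    using ideal_add[OF _ h, of "x - p"] ideal_diff[OF _ h, of "x - q"] by auto
  then show "cls n p = cls n q" by (simp add: cls_alt)
qed

lemma ops_Q: "A \<in> ops Q n \<longleftrightarrow> (\<exists>p. supp p \<subseteq> monomials n \<and> A = cls n p)"
  by (simp add: Q_eq quotient_operad_def cls_def image_iff Bex_def)

lemma union_cls:
  assumes "\<And>a. a \<in> A \<Longrightarrow> ideal n (h a - p)" "A \<noteq> {}"
  shows "(\<Union>a\<in>A. cls n (h a)) = cls n p"
  using assms cls_eq_iff[of n _ p] by auto

lemma add_Q: "add Q n (cls n p) (cls n q) = cls n (p + q)"
proof -
  have "(\<Union>b\<in>cls n q. cls n (a + b)) = cls n (a + q)" for a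
    by (rule union_cls) (auto simp: cls_alt[of n q] intro: exI[of _ q])
  then have "add Q n (cls n p) (cls n q) = (\<Union>a\<in>cls n p. cls n (a + q))"
    by (simp add: Q_eq quotient_operad_def cls_def)
  also have "\<dots> = cls n (p + q)"
    by (rule union_cls) (auto simp: cls_alt[of n p] intro: exI[of _ p])
  finally show ?thesis .
qed

lemma scl_Q: "scl Q n c (cls n p) = cls n (Poly_Mapping.map (\<lambda>a. c * a) p)"
proof -
  have "Poly_Mapping.map (\<lambda>a. c * a) a - Poly_Mapping.map (\<lambda>a. c * a) p =
      Poly_Mapping.map (\<lambda>a. c * a) (a - p)" for a
    by (rule poly_mapping_eqI) (simp add: lookup_minus right_diff_distrib)
  then have "(\<Union>a\<in>cls n p. cls n (Poly_Mapping.map (\<lambda>a. c * a) a)) =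
      cls n (Poly_Mapping.map (\<lambda>a. c * a) p)"
    by (intro union_cls) (auto simp: cls_alt[of n p] ideal_scl intro: exI[of _ p])
  then show ?thesis by (simp add: Q_eq quotient_operad_def cls_def)
qed

lemma act_Q:
  assumes "\<sigma> permutes {..<n}"
  shows "act Q n \<sigma> (cls n p) = cls n (act free_operad n \<sigma> p)"
proof -
  have "act free_operad n \<sigma> a - act free_operad n \<sigma> p = act free_operad n \<sigma> (a - p)" for a
    using act_free_add[of n \<sigma> "a - p" p] by simp
  then have "(\<Union>a\<in>cls n p. cls n (act free_operad n \<sigma> a)) = cls n (act free_operad n \<sigma> p)"
    using assms by (intro union_cls) (auto simp: cls_alt[of n p] ideal_act intro: exI[of _ p])
  then show ?thesis by (simp add: Q_eq quotient_operad_def cls_def)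
qed

text \<open>
  Composition is defined on all representatives, so both arguments are changed by elements of the
  ideal; that the ideal consists of operations allows the composition of two such changes.
\<close>

lemma pcomp_Q:
  assumes p: "supp p \<subseteq> monomials m" and q: "supp q \<subseteq> monomials n"
    and i: "i < m"
  shows "pcomp Q m n i (cls m p) (cls n q) = cls (m + n - 1) (pcomp free_operad m n i p q)"
proof -
  let ?c = "pcomp free_operad m n i"
  have "(\<Union>b\<in>cls n q. cls (m + n - 1) (?c a b)) = cls (m + n - 1) (?c a q)" if a: "a \<in> cls m p" for a
  proof (rule union_cls)
    fix b assume "b \<in> cls n q"
    moreover have "?c a b - ?c a q = ?c a (b - q)"
      using pcomp_free_add_right[of m n i a "b - q" q] by simp
    moreover have "supp a \<subseteq> monomials m"
      using a ideal_keys[of m "a - p"] keys_add_subset[of "a - p" _ p] p by (simp add: cls_alt)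
    ultimately show "ideal (m + n - 1) (?c a b - ?c a q)"
      using i by (simp add: cls_alt ideal_comp_right del: One_nat_def)
  qed (use cls_self in blast)
  then have "pcomp Q m n i (cls m p) (cls n q) = (\<Union>a\<in>cls m p. cls (m + n - 1) (?c a q))"
    by (simp add: Q_eq quotient_operad_def cls_def)
  also have "\<dots> = cls (m + n - 1) (?c p q)"
  proof (rule union_cls)
    fix a assume "a \<in> cls m p"
    moreover have "?c a q - ?c p q = ?c (a - p) q"
      using pcomp_free_add_left[of m n i "a - p" p q] by simp
    ultimately show "ideal (m + n - 1) (?c a q - ?c p q)"
      using i q by (simp add: cls_alt ideal_comp_left del: One_nat_def)
  qed (use cls_self in blast)
  finally show ?thesis .
qed

lemma pcomp_ops_Q:
  assumes "A \<in> ops Q m" "B \<in> ops Q n" "i < m"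
  shows "pcomp Q m n i A B \<in> ops Q (m + n - 1)"
  using assms pcomp_Q keys_pcomp unfolding ops_Q by metis

end

fun evaluate :: "('g \<Rightarrow> 'a \<Rightarrow> 'a \<Rightarrow> 'a) \<Rightarrow> (nat \<Rightarrow> 'a) \<Rightarrow> 'g monomial \<Rightarrow> 'a" where
  "evaluate op f (Var i) = f i"
| "evaluate op f (Op g s t) = op g (evaluate op f s) (evaluate op f t)"

lemma evaluate_substitute:
  "evaluate op f (substitute h s) = evaluate op (\<lambda>j. evaluate op f (h j)) s"
  by (induction s) auto

lemma evaluate_rename: "evaluate op f (rename_monomial \<sigma> s) = evaluate op (\<lambda>j. f (\<sigma> j)) s"
  by (simp add: rename_monomial_def evaluate_substitute)

lemma evaluate_comp:
  "evaluate op f (comp_monomial n i s t) =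
     evaluate op (\<lambda>j. if j < i then f j
       else if j = i then evaluate op (\<lambda>l. f (l + i)) t else f (j + n - 1)) s"
  unfolding comp_monomial_def evaluate_substitute
  by (rule arg_cong[of _ _ "\<lambda>f. evaluate op f s"]) (auto simp: evaluate_rename)

lemma evaluate_cong: "(\<And>i. i \<in> set (vars s) \<Longrightarrow> f i = f' i) \<Longrightarrow> evaluate op f s = evaluate op f' s"
  by (induction s) auto

text \<open>
  An algebra that satisfies the relations satisfies their consequences.  The function \<open>G\<close>, extended
  linearly to formal combinations of values, replaces a vector space structure on the algebra, and quantifying
  over all \<open>G\<close> and \<open>f\<close> makes the induction go through for both kinds of composition.
\<close>

lemma (in quadratic_data) lin_evaluate_ideal:
  fixes G :: "'a \<Rightarrow> 'k"
  assumes rel: "\<And>r f G. r \<in> R \<Longrightarrow> lin (\<lambda>u. G (evaluate op f u)) r = (0::'k)"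
    and "ideal n z"
  shows "lin (\<lambda>u. G (evaluate op f u)) z = 0"
  using assms(2) unfolding ideal_def
proof (induction arbitrary: f G rule: operad_ideal.induct)
  case (rel r n)
  then show ?case using assms(1) by (auto split: if_splits)
next
  case (act n p \<sigma>)
  then show ?case by (simp add: lin_act evaluate_rename)
next
  case (comp_left m p q n i)
  show ?case unfolding lin_pcomp evaluate_comp by (subst lin_swap) (simp add: comp_left.IH)
next
  case (comp_right p m n q i)
  have "lin (\<lambda>t. G (evaluate op (\<lambda>j. if j < i then f j
       else if j = i then evaluate op (\<lambda>l. f (l + i)) t else f (j + n - 1)) s)) q = 0" for s
    using comp_right.IH[of "\<lambda>y. G (evaluate op (\<lambda>j. if j < i then f j else if j = i then y else f (j + n - 1)) s)"
      "\<lambda>l. f (l + i)"] by simp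
  then show ?case unfolding lin_pcomp evaluate_comp by simp
qed auto

section \<open>Signs of reordered edges\<close>

text \<open>
  The sign of the permutation that sorts a list of edges by their codes.
\<close>

fun list_sign :: "nat set list \<Rightarrow> 'k::field" where
  "list_sign [] = 1"
| "list_sign (x # xs) =
     (- 1) ^ length (filter (\<lambda>y. set_encode y < set_encode x) xs) * list_sign xs"

definition inversions :: "nat set list \<Rightarrow> nat set list \<Rightarrow> nat" where
  "inversions xs ys = (\<Sum>x\<leftarrow>xs. length (filter (\<lambda>y. set_encode y < set_encode x) ys))"

lemma inversions_Nil [simp]: "inversions [] ys = 0" "inversions xs [] = 0"
  by (auto simp: inversions_def)

lemma inversions_append_left [simp]: "inversions (xs @ xs') ys = inversions xs ys + inversions xs' ys"
  by (simp add: inversions_def)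

lemma inversions_append_right [simp]: "inversions xs (ys @ ys') = inversions xs ys + inversions xs ys'"
  by (simp add: inversions_def sum_list_addf)

lemma list_sign_append:
  "list_sign (xs @ ys) = list_sign xs * list_sign ys * (- 1) ^ inversions xs ys"
  by (induction xs) (simp_all add: inversions_def power_add algebra_simps)

lemma list_sign_square [simp]: "list_sign xs * list_sign xs = (1 :: 'k::field)"
proof (induction xs)
  case (Cons x xs)
  let ?k = "length (filter (\<lambda>y. set_encode y < set_encode x) xs)"
  have "list_sign (x # xs) * list_sign (x # xs) =
      ((- 1 :: 'k) ^ ?k * (- 1) ^ ?k) * (list_sign xs * list_sign xs)"
    by (simp only: list_sign.simps ac_simps)
  also have "(- 1 :: 'k) ^ ?k * (- 1) ^ ?k = 1" by (cases "even ?k") auto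
  finally show ?case using Cons by simp
qed auto

lemma inversions_cong_mset:
  assumes "mset xs = mset xs'" "mset ys = mset ys'"
  shows "inversions xs ys = inversions xs' ys'"
proof -
  have "inversions xs ys = (\<Sum>x\<in>#mset xs. size (filter_mset (\<lambda>y. set_encode y < set_encode x) (mset ys)))" for xs ys
    by (simp add: inversions_def sum_mset_sum_list[symmetric] flip: mset_map mset_filter)
  then show ?thesis using assms by simp
qed

text \<open>
  The inversions between a sublist and the rest of the list depend only on the elements of the sublist.
\<close>

lemma list_sign_context:
  assumes "mset xs = mset ys"
  shows "list_sign (pre @ xs @ post) * list_sign ys = (list_sign (pre @ ys @ post) * list_sign xs :: 'k::field)"
  using inversions_cong_mset[OF assms refl, of post] inversions_cong_mset[OF refl assms, of pre]
  by (simp add: list_sign_append power_add algebra_simps)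

lemma inversions_swap:
  assumes "set xs \<inter> set ys = {}" "\<And>x. x \<in> set xs \<union> set ys \<Longrightarrow> finite x"
  shows "inversions xs ys + inversions ys xs = length xs * length ys"
  using assms
proof (induction xs)
  case (Cons x xs)
  have "inversions ys (x # xs) = length (filter (\<lambda>y. set_encode x < set_encode y) ys) + inversions ys xs"
    by (induction ys) (auto simp: inversions_def)
  moreover have "length (filter (\<lambda>y. set_encode y < set_encode x) ys) +
      length (filter (\<lambda>y. set_encode x < set_encode y) ys) = length ys"
  proof -
    have ne: "set_encode x \<noteq> set_encode y" if "y \<in> set ys" for y
    proof -
      have "x \<noteq> y" "finite x" "finite y" using Cons.prems that by auto
      then show ?thesis by (simp add: set_encode_eq)
    qed
    have "filter (\<lambda>y. set_encode x < set_encode y) ys = filter (\<lambda>y. \<not> set_encode y < set_encode x) ys"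
    proof (rule filter_cong[OF refl])
      fix y assume "y \<in> set ys"
      then show "set_encode x < set_encode y \<longleftrightarrow> \<not> set_encode y < set_encode x"
        using ne[of y] by linarith
    qed
    then show ?thesis by (simp add: sum_length_filter_compl)
  qed
  moreover have "inversions (x # xs) ys = length (filter (\<lambda>y. set_encode y < set_encode x) ys) + inversions xs ys"
    by (simp add: inversions_def)
  ultimately show ?case using Cons by simp
qed auto

definition index_pairs :: "nat \<Rightarrow> (nat \<times> nat) set" where
  "index_pairs k = {(i, j). i < j \<and> j < k}"

lemma finite_index_pairs [simp]: "finite (index_pairs k)"
  by (rule finite_subset[of _ "{..<k} \<times> {..<k}"]) (auto simp: index_pairs_def)

lemma inversions_concat: "inversions (concat bs) b = (\<Sum>i<length bs. inversions (bs ! i) b)"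
  by (induction bs rule: rev_induct) (auto simp: nth_append)

lemma list_sign_concat:
  "list_sign (concat bs) = (\<Prod>i<length bs. list_sign (bs ! i)) *
     (\<Prod>(i, j)\<in>index_pairs (length bs). (- 1) ^ inversions (bs ! i) (bs ! j) :: 'k::field)"
proof (induction bs rule: rev_induct)
  case (snoc b bs)
  let ?k = "length bs"
  let ?X = "\<lambda>(i, j). (- 1 :: 'k) ^ inversions ((bs @ [b]) ! i) ((bs @ [b]) ! j)"
  have split: "index_pairs (Suc ?k) = index_pairs ?k \<union> (\<lambda>i. (i, ?k)) ` {..<?k}"
    by (auto simp: index_pairs_def less_Suc_eq)
  have "prod ?X (index_pairs (Suc ?k)) = prod ?X (index_pairs ?k) * prod ?X ((\<lambda>i. (i, ?k)) ` {..<?k})"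
    unfolding split by (rule prod.union_disjoint) (simp, simp, auto simp: index_pairs_def)
  also have "prod ?X ((\<lambda>i. (i, ?k)) ` {..<?k}) = (\<Prod>i<?k. (- 1) ^ inversions (bs ! i) b)"
    by (subst prod.reindex) (auto simp: inj_on_def nth_append)
  also have "\<dots> = (- 1) ^ inversions (concat bs) b"
    by (simp add: inversions_concat power_sum)
  also have "prod ?X (index_pairs ?k) = (\<Prod>(i, j)\<in>index_pairs ?k. (- 1) ^ inversions (bs ! i) (bs ! j))"
    by (rule prod.cong) (auto simp: index_pairs_def nth_append)
  finally show ?case
    using snoc by (simp add: list_sign_append nth_append)
qed (simp add: index_pairs_def)

lemma distinct_concat_nth_disjoint:
  assumes "distinct (concat bs)" "i < j" "j < length bs"
  shows "set (bs ! i) \<inter> set (bs ! j) = {}"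
proof -
  have "bs = take j bs @ bs ! j # drop (Suc j) bs" using assms id_take_nth_drop by blast
  then have "concat bs = concat (take j bs) @ bs ! j @ concat (drop (Suc j) bs)"
    by (metis concat.simps(2) concat_append)
  then have "set (concat (take j bs)) \<inter> set (bs ! j) = {}" using assms(1) by auto
  moreover have "bs ! i \<in> set (take j bs)" using assms by (auto simp: in_set_conv_nth)
  ultimately show ?thesis by auto
qed

text \<open>
  The signs inside the blocks agree.  A pair of blocks contributes the same sign on both sides unless
  the permutation reverses it; reversing exchanges the inversions and the non-inversions between the
  two blocks, and the product of their sizes counts both.
\<close>

lemma list_sign_permute_blocks:
  assumes d: "distinct (concat bs)" and fin: "\<And>e. e \<in> set (concat bs) \<Longrightarrow> finite e"
    and \<sigma>: "\<sigma> permutes {..<length bs}"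
  shows "koszul_sign \<sigma> (map length bs) * list_sign (concat (map (\<lambda>i. bs ! \<sigma> i) [0..<length bs])) =
    (list_sign (concat bs) :: 'k::field)"
proof -
  let ?k = "length bs"
  let ?P = "index_pairs ?k"
  let ?X = "\<lambda>i j. (- 1 :: 'k) ^ inversions (bs ! i) (bs ! j)"
  let ?h = "\<lambda>(i, j). (min (\<sigma> i) (\<sigma> j), max (\<sigma> i) (\<sigma> j))"
  have range: "\<sigma> i < ?k \<longleftrightarrow> i < ?k" for i
    using permutes_in_image[OF \<sigma>, of i] by simp
  have inj: "\<sigma> i = \<sigma> j \<longleftrightarrow> i = j" for i j
    using permutes_inj[OF \<sigma>] by (auto dest: injD)
  have swap: "(- 1) ^ (length (bs ! i) * length (bs ! j)) * ?X i j = ?X j i"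
    if "i < ?k" "j < ?k" "i \<noteq> j" for i j
  proof -
    have disj: "set (bs ! i) \<inter> set (bs ! j) = {}"
      using that distinct_concat_nth_disjoint[OF d, of i j] distinct_concat_nth_disjoint[OF d, of j i]
      by (cases "i < j") auto
    have fin': "finite x" if "x \<in> set (bs ! i) \<union> set (bs ! j)" for x
    proof (rule fin)
      have "bs ! i \<in> set bs" "bs ! j \<in> set bs" using \<open>i < ?k\<close> \<open>j < ?k\<close> by simp_all
      then show "x \<in> set (concat bs)" using that unfolding set_concat by blast
    qed
    show ?thesis
      by (subst inversions_swap[OF disj fin', symmetric])
        (auto simp: power_add minus_one_power_iff)
  qed
  have koszul: "koszul_sign \<sigma> (map length bs) =
      (\<Prod>(i, j)\<in>?P. if \<sigma> j < \<sigma> i then (- 1 :: 'k) ^ (length (bs ! \<sigma> i) * length (bs ! \<sigma> j)) else 1)"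
  proof -
    have "koszul_sign \<sigma> (map length bs) =
        (\<Prod>(i, j)\<in>{x \<in> ?P. \<sigma> (snd x) < \<sigma> (fst x)}. (- 1 :: 'k) ^ (length (bs ! \<sigma> i) * length (bs ! \<sigma> j)))"
      unfolding koszul_sign_def by (rule prod.cong) (auto simp: index_pairs_def range)
    also have "\<dots> = (\<Prod>x\<in>?P. if \<sigma> (snd x) < \<sigma> (fst x)
        then (case x of (i, j) \<Rightarrow> (- 1 :: 'k) ^ (length (bs ! \<sigma> i) * length (bs ! \<sigma> j))) else 1)"
      by (rule prod.inter_filter) simp
    also have "\<dots> = (\<Prod>(i, j)\<in>?P. if \<sigma> j < \<sigma> i
        then (- 1 :: 'k) ^ (length (bs ! \<sigma> i) * length (bs ! \<sigma> j)) else 1)"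
      by (rule prod.cong) auto
    finally show ?thesis .
  qed
  have "koszul_sign \<sigma> (map length bs) * (\<Prod>(i, j)\<in>?P. ?X (\<sigma> i) (\<sigma> j)) =
      (\<Prod>(i, j)\<in>?P. case ?h (i, j) of (a, b) \<Rightarrow> ?X a b)"
    unfolding koszul prod.distrib[symmetric]
  proof (rule prod.cong[OF refl])
    fix x assume "x \<in> ?P"
    then obtain i j where x: "x = (i, j)" "i < j" "j < ?k" by (auto simp: index_pairs_def)
    then have "\<sigma> i < ?k" "\<sigma> j < ?k" "\<sigma> i \<noteq> \<sigma> j" by (auto simp: range inj)
    then show "(case x of (i, j) \<Rightarrow> if \<sigma> j < \<sigma> i then (- 1 :: 'k) ^ (length (bs ! \<sigma> i) * length (bs ! \<sigma> j)) else 1) *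
        (case x of (i, j) \<Rightarrow> ?X (\<sigma> i) (\<sigma> j)) = (case x of (i, j) \<Rightarrow> case ?h (i, j) of (a, b) \<Rightarrow> ?X a b)"
      using swap[of "\<sigma> i" "\<sigma> j"] by (auto simp: x(1) min_def max_def)
  qed
  also have "\<dots> = (\<Prod>x\<in>?P. case ?h x of (a, b) \<Rightarrow> ?X a b)"
    by (rule prod.cong) auto
  also have "\<dots> = (\<Prod>(a, b)\<in>?P. ?X a b)"
  proof (rule prod.reindex_bij_betw)
    have "inj_on ?h ?P"
      by (auto simp: inj_on_def index_pairs_def min_def max_def inj split: if_splits)
    moreover have "?h ` ?P \<subseteq> ?P"
    proof clarify
      fix i j assume "(i, j) \<in> ?P"
      then have "\<sigma> i < ?k" "\<sigma> j < ?k" "\<sigma> i \<noteq> \<sigma> j" by (auto simp: index_pairs_def range inj)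
      then show "(min (\<sigma> i) (\<sigma> j), max (\<sigma> i) (\<sigma> j)) \<in> ?P"
        by (auto simp: index_pairs_def min_def max_def)
    qed
    ultimately show "bij_betw ?h ?P ?P"
      unfolding bij_betw_def using endo_inj_surj[OF finite_index_pairs] by blast
  qed
  finally have pairs: "koszul_sign \<sigma> (map length bs) * (\<Prod>(i, j)\<in>?P. ?X (\<sigma> i) (\<sigma> j)) =
      (\<Prod>(a, b)\<in>?P. ?X a b)" .
  have "(\<Prod>i<?k. list_sign (bs ! \<sigma> i)) = (\<Prod>i<?k. list_sign (bs ! i) :: 'k)"
    by (rule prod.reindex_bij_betw[OF permutes_imp_bij[OF \<sigma>], of "\<lambda>i. list_sign (bs ! i)"])
  moreover have "(\<Prod>(i, j)\<in>?P. (- 1 :: 'k) ^ inversions (map (\<lambda>i. bs ! \<sigma> i) [0..<?k] ! i)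
      (map (\<lambda>i. bs ! \<sigma> i) [0..<?k] ! j)) = (\<Prod>(i, j)\<in>?P. ?X (\<sigma> i) (\<sigma> j))"
    by (rule prod.cong) (auto simp: index_pairs_def)
  ultimately show ?thesis
    unfolding list_sign_concat[of bs] list_sign_concat[of "map _ _"]
    using pairs by (simp add: mult.left_commute)
qed

text \<open>
  The counterpart of the list of contractions, in which the edges disappear one at a time in preorder.
\<close>

fun deletions :: "'a list \<Rightarrow> 'a list list" where
  "deletions [] = []"
| "deletions (x # xs) = xs # map ((#) x) (deletions xs)"

lemma length_deletions [simp]: "length (deletions xs) = length xs"
  by (induction xs) auto

lemma length_in_deletions: "ys \<in> set (deletions xs) \<Longrightarrow> Suc (length ys) = length xs"
  by (induction xs arbitrary: ys) auto

text \<open>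
  Removing the element at position \<open>j\<close> of the list and the element of rank \<open>r\<close> of the sorted list changes
  the sign of the sorting permutation by \<open>(- 1) ^ (j + r)\<close>.  It replaces the sign of the
  codifferential, which depends on the planar structure, by one that does not.
\<close>

lemma list_sign_deletions:
  assumes "distinct xs" "\<And>e. e \<in> set xs \<Longrightarrow> finite e" "j < length xs"
  shows "list_sign xs * (- 1) ^ j =
    ((- 1) ^ rank (set xs) (xs ! j) * list_sign (deletions xs ! j) :: 'k::field)"
  using assms
proof (induction xs arbitrary: j)
  case (Cons x xs)
  let ?n = "\<lambda>ys. length (filter (\<lambda>y. set_encode y < set_encode x) ys)"
  have rank_eq: "rank (set ys) e = length (filter (\<lambda>y. set_encode y < set_encode e) ys)" if "distinct ys" for ys e
  proof -
    have "{f \<in> set ys. set_encode f < set_encode e} = set (filter (\<lambda>y. set_encode y < set_encode e) ys)" by auto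
    then show ?thesis unfolding rank_def using that by (metis distinct_card distinct_filter)
  qed
  show ?case
  proof (cases j)
    case 0
    have "rank (set (x # xs)) x = ?n xs" using rank_eq[OF Cons.prems(1), of x] by simp
    then show ?thesis using 0 by simp
  next
    case (Suc k)
    let ?y = "xs ! k"
    have k: "k < length xs" using Cons.prems Suc by simp
    have IH: "list_sign xs * (- 1) ^ k = (- 1) ^ rank (set xs) ?y * (list_sign (deletions xs ! k) :: 'k)"
      using Cons k by simp
    have "mset xs = add_mset ?y (mset (deletions xs ! k))"
      using k
    proof (induction xs arbitrary: k)
      case (Cons a xs)
      then show ?case by (cases k) auto
    qed auto
    then have "size (filter_mset (\<lambda>y. set_encode y < set_encode x) (mset xs)) =
        size (filter_mset (\<lambda>y. set_encode y < set_encode x) (add_mset ?y (mset (deletions xs ! k))))"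
      by simp
    then have n: "?n xs = ?n (deletions xs ! k) + (if set_encode ?y < set_encode x then 1 else 0)"
      by (auto simp flip: mset_filter)
    have "x \<noteq> ?y" using Cons.prems k nth_mem by auto
    then have "set_encode x \<noteq> set_encode ?y"
      using Cons.prems(2)[of x] Cons.prems(2)[of ?y] k by (simp add: set_encode_eq)
    moreover have "rank (set (x # xs)) ?y = (if set_encode x < set_encode ?y then 1 else 0) + rank (set xs) ?y"
      using rank_eq[OF Cons.prems(1), of ?y] rank_eq[of xs ?y] Cons.prems(1) by auto
    ultimately have sign: "(- 1 :: 'k) ^ ?n xs * (- 1) ^ Suc 0 * (- 1) ^ rank (set xs) ?y =
        (- 1) ^ rank (set (x # xs)) ?y * (- 1) ^ ?n (deletions xs ! k)"
      using n by (cases "set_encode x < set_encode ?y") (auto simp: power_add)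
    have "list_sign (x # xs) * (- 1) ^ Suc k =
        (- 1) ^ ?n xs * (- 1) ^ Suc 0 * (list_sign xs * (- 1 :: 'k) ^ k)" by simp
    also have "\<dots> = ((- 1) ^ ?n xs * (- 1) ^ Suc 0 * (- 1) ^ rank (set xs) ?y) *
        list_sign (deletions xs ! k)"
      unfolding IH by (simp only: mult.assoc)
    also have "\<dots> = (- 1) ^ rank (set (x # xs)) ?y *
        ((- 1) ^ ?n (deletions xs ! k) * list_sign (deletions xs ! k))"
      unfolding sign by (simp only: mult.assoc)
    finally show ?thesis using Suc k by simp
  qed
qed auto

lemma deletions_append:
  "deletions (xs @ ys) = map (\<lambda>z. z @ ys) (deletions xs) @ map ((@) xs) (deletions ys)"
  by (induction xs) (auto simp: comp_def)

lemma deletions_concat: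
  "deletions (concat bs) = concat (map (\<lambda>i. map (\<lambda>z. concat (take i bs) @ z @ concat (drop (Suc i) bs))
     (deletions (bs ! i))) [0..<length bs])"
proof (induction bs)
  case (Cons b bs)
  have "[0..<length (b # bs)] = 0 # map Suc [0..<length bs]"
    by (simp add: map_Suc_upt upt_conv_Cons del: upt_Suc)
  then show ?case by (simp add: deletions_append Cons map_concat comp_def del: upt_Suc)
qed auto

section \<open>Internal edges of decorated trees\<close>

text \<open>
  The vertices in preorder, each represented by its set of leaves; all but the root are also
  the internal edges.
\<close>

fun blocks :: "'a dtree \<Rightarrow> nat set list" where
  "blocks (Leaf i) = []"
| "blocks (Node p ts) = set (concat (map leaves ts)) # concat (map blocks ts)"

definition edges :: "'a dtree \<Rightarrow> nat set list" where
  "edges t = tl (blocks t)"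

lemma edges_Node [simp]: "edges (Node p ts) = concat (map blocks ts)"
  by (simp add: edges_def)

lemma length_blocks [simp]: "length (blocks t) = vertices t"
proof (induction t)
  case (Node p ts)
  then show ?case by (simp add: length_concat comp_def cong: map_cong)
qed auto

lemma finite_blocks: "e \<in> set (blocks t) \<Longrightarrow> finite e"
  by (induction t) auto

lemma finite_edges: "e \<in> set (edges t) \<Longrightarrow> finite e"
  unfolding edges_def using finite_blocks list.set_sel(2) by (metis list.sel(2))

lemma leaves_nonempty: "decorated P t \<Longrightarrow> leaves t \<noteq> []"
proof (induction t)
  case (Node p ts)
  then have "ts \<noteq> []" by auto
  then have "hd ts \<in> set ts" by simp
  then show ?case using Node by force
qed auto

lemma blocks_subset:
  assumes "decorated P t" "e \<in> set (blocks t)"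
  shows "e \<noteq> {} \<and> e \<subseteq> set (leaves t)"
  using assms
proof (induction t)
  case (Node p ts)
  show ?case
  proof (cases "e = set (concat (map leaves ts))")
    case True
    then show ?thesis using leaves_nonempty[OF Node.prems(1)] by auto
  next
    case False
    then obtain t where t: "t \<in> set ts" "e \<in> set (blocks t)" using Node.prems(2) by auto
    then have "e \<noteq> {} \<and> e \<subseteq> set (leaves t)" using Node.IH[OF t(1) _ t(2)] Node.prems(1) by auto
    then show ?thesis using t(1) by auto
  qed
qed auto

lemma distinct_concat_blocks:
  assumes "\<And>t. t \<in> set ts \<Longrightarrow> decorated P t \<and> distinct (blocks t)"
    and "distinct (concat (map leaves ts))"
  shows "distinct (concat (map blocks ts))"
  using assms
proof (induction ts)
  case (Cons t ts)
  have "set (blocks t) \<inter> set (concat (map blocks ts)) = {}"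
  proof (rule equals0I)
    fix e assume "e \<in> set (blocks t) \<inter> set (concat (map blocks ts))"
    then obtain u where u: "e \<in> set (blocks t)" "u \<in> set ts" "e \<in> set (blocks u)" by auto
    have "e \<noteq> {}" "e \<subseteq> set (leaves t)" "e \<subseteq> set (leaves u)"
      using blocks_subset[of P t e] blocks_subset[of P u e] u Cons.prems(1) by auto
    moreover have "set (leaves t) \<inter> set (leaves u) = {}" using Cons.prems(2) u(2) by auto
    ultimately show False by blast
  qed
  moreover have "distinct (concat (map blocks ts))"
    using Cons.prems by (intro Cons.IH) auto
  ultimately show ?case using Cons.prems(1)[of t] by simp
qed auto

text \<open>
  Every vertex has at least two children, and subtrees have leaves, so the sets of leaves strictly
  decrease along the tree.
\<close>

lemma distinct_blocks: "decorated P t \<Longrightarrow> distinct (leaves t) \<Longrightarrow> distinct (blocks t)"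
proof (induction t)
  case (Node p ts)
  have sub: "decorated P t \<and> distinct (leaves t)" if "t \<in> set ts" for t
    using that Node.prems by (auto dest: split_list)
  have "distinct (concat (map blocks ts))"
    using sub Node.IH Node.prems by (intro distinct_concat_blocks) auto
  moreover have "set (concat (map leaves ts)) \<notin> set (concat (map blocks ts))"
  proof
    assume "set (concat (map leaves ts)) \<in> set (concat (map blocks ts))"
    then obtain t where t: "t \<in> set ts" "set (concat (map leaves ts)) \<in> set (blocks t)" by auto
    then have le: "set (concat (map leaves ts)) \<subseteq> set (leaves t)"
      using blocks_subset[of P t] sub by blast
    obtain as bs where ts: "ts = as @ t # bs" using t(1) by (meson split_list)
    then have "as @ bs \<noteq> []" using Node.prems(1) by (cases as) auto
    then obtain u where u: "u \<in> set (as @ bs)" using list.set_intros(1) by (metis list.exhaust)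
    have "set (leaves u) \<inter> set (leaves t) = {}"
      using Node.prems(2) u unfolding ts by auto
    moreover have "leaves u \<noteq> []" "set (leaves u) \<subseteq> set (leaves t)"
      using u sub leaves_nonempty[of P u] le unfolding ts by auto
    ultimately show False by (cases "leaves u") auto
  qed
  ultimately show ?case by simp
qed auto

lemma set_leaves_plug:
  "set (leaves t) = set (leaves u) \<Longrightarrow> set (leaves (plug C t)) = set (leaves (plug C u))"
  by (induction C) auto

text \<open>
  The surrounding tree sees of a subtree only its set of leaves.
\<close>

lemma blocks_plug:
  assumes "set (concat (map leaves ts)) = set (concat (map leaves us))"
  shows "\<exists>pre post. pre \<noteq> [] \<and> blocks (plug C (Node p ts)) = pre @ concat (map blocks ts) @ post \<and>
    blocks (plug C (Node q us)) = pre @ concat (map blocks us) @ post"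
proof (induction C)
  case Hole
  show ?case using assms by (intro exI[of _ "[set (concat (map leaves ts))]"] exI[of _ "[]"]) simp
next
  case (In r ls C rs)
  then obtain pre post where IH: "blocks (plug C (Node p ts)) = pre @ concat (map blocks ts) @ post"
    "blocks (plug C (Node q us)) = pre @ concat (map blocks us) @ post" by blast
  let ?L = "set (concat (map leaves (ls @ plug C (Node p ts) # rs)))"
  have "set (leaves (plug C (Node p ts))) = set (leaves (plug C (Node q us)))"
    using assms by (intro set_leaves_plug) simp
  then have "?L = set (concat (map leaves (ls @ plug C (Node q us) # rs)))" by simp
  then show ?case using IH
    by (intro exI[of _ "?L # concat (map blocks ls) @ pre"] exI[of _ "post @ concat (map blocks rs)"])
       simp
qed

lemma edges_plug:
  assumes "set (concat (map leaves ts)) = set (concat (map leaves us))"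
  shows "\<exists>pre post. edges (plug C (Node p ts)) = pre @ concat (map blocks ts) @ post \<and>
    edges (plug C (Node q us)) = pre @ concat (map blocks us) @ post"
proof -
  obtain pre post where "pre \<noteq> []" "blocks (plug C (Node p ts)) = pre @ concat (map blocks ts) @ post"
    "blocks (plug C (Node q us)) = pre @ concat (map blocks us) @ post"
    using blocks_plug[OF assms] by blast
  then show ?thesis unfolding edges_def by (intro exI[of _ "tl pre"] exI[of _ post]) simp
qed

lemma edges_plug_decoration: "edges (plug C (Node p ts)) = edges (plug C (Node q ts))"
  using edges_plug[of ts ts C p q] by auto

lemma decorated_plugD: "decorated P (plug C t) \<Longrightarrow> decorated P t"
  by (induction C) auto

lemma distinct_leaves_plugD: "distinct (leaves (plug C t)) \<Longrightarrow> distinct (leaves t)"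
  by (induction C) auto

abbreviation permute :: "(nat \<Rightarrow> nat) \<Rightarrow> 'a list \<Rightarrow> 'a list" where
  "permute \<sigma> ts \<equiv> map (\<lambda>i. ts ! \<sigma> i) [0..<length ts]"

lemma mset_permute:
  assumes "\<sigma> permutes {..<length ts}"
  shows "mset (permute \<sigma> ts) = mset ts"
  using permute_list_def[of \<sigma> ts] mset_permute_list[OF assms] by simp

lemma mset_concat_map: "mset (concat (map f xs)) = \<Sum>\<^sub># (image_mset (\<lambda>x. mset (f x)) (mset xs))"
  by (induction xs) auto

lemma mset_concat_permute:
  assumes "\<sigma> permutes {..<length ts}"
  shows "mset (concat (map f (permute \<sigma> ts))) = mset (concat (map f ts))"
  unfolding mset_concat_map mset_permute[OF assms] ..

text \<open>
  The Koszul sign in the definition of a cochain is the quotient of the signs that compare the two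
  preorders with the order by codes.
\<close>

lemma list_sign_permute:
  assumes t: "plug C (Node p ts) \<in> dtrees P n v" and \<sigma>: "\<sigma> permutes {..<length ts}"
  shows "koszul_sign \<sigma> (map vertices ts) * list_sign (edges (plug C (Node p (permute \<sigma> ts)))) =
    (list_sign (edges (plug C (Node q ts))) :: 'k::field)"
proof -
  let ?us = "permute \<sigma> ts"
  have "set (concat (map leaves ts)) = set (concat (map leaves ?us))"
    using mset_concat_permute[OF \<sigma>, of leaves] by (rule mset_eq_setD[symmetric])
  from edges_plug[OF this] obtain pre post where
    e: "edges (plug C (Node q ts)) = pre @ concat (map blocks ts) @ post"
      "edges (plug C (Node p ?us)) = pre @ concat (map blocks ?us) @ post" by blast
  have d: "decorated P (Node p ts)" "distinct (leaves (Node p ts))"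
    using t decorated_plugD distinct_leaves_plugD unfolding dtrees_def by blast+
  have "distinct (concat (map blocks ts))" using distinct_blocks[OF d] by simp
  moreover have "finite e" if "e \<in> set (concat (map blocks ts))" for e
    using that finite_blocks by auto
  ultimately have "koszul_sign \<sigma> (map length (map blocks ts)) *
      list_sign (concat (map (\<lambda>i. map blocks ts ! \<sigma> i) [0..<length (map blocks ts)])) =
      (list_sign (concat (map blocks ts)) :: 'k)"
    using \<sigma> by (intro list_sign_permute_blocks) auto
  moreover have "map (\<lambda>i. map blocks ts ! \<sigma> i) [0..<length (map blocks ts)] = map blocks ?us"
    using permutes_in_image[OF \<sigma>] by simp
  moreover have "map length (map blocks ts) = map vertices ts" by simp
  ultimately have k: "koszul_sign \<sigma> (map vertices ts) * list_sign (concat (map blocks ?us)) =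
      (list_sign (concat (map blocks ts)) :: 'k)" by metis
  let ?x = "list_sign (concat (map blocks ts)) :: 'k" and ?y = "list_sign (concat (map blocks ?us)) :: 'k"
  let ?X = "list_sign (pre @ concat (map blocks ts) @ post) :: 'k"
  let ?Y = "list_sign (pre @ concat (map blocks ?us) @ post) :: 'k"
  let ?k = "koszul_sign \<sigma> (map vertices ts) :: 'k"
  have swap: "?X * ?y = ?Y * ?x"
    by (rule list_sign_context) (use mset_concat_permute[OF \<sigma>, of blocks] in simp)
  have "?X = ?X * ?y * ?y" by (simp add: mult.assoc)
  also have "\<dots> = ?Y * (?k * ?y) * ?y" unfolding swap k ..
  also have "\<dots> = ?k * ?Y" by (simp add: mult.assoc mult.left_commute[of ?Y])
  finally show ?thesis unfolding e by simp
qed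

section \<open>Cochains without signs\<close>

definition signed :: "('a dtree \<Rightarrow> 'k::field) \<Rightarrow> 'a dtree \<Rightarrow> 'k" where
  "signed \<phi> t = list_sign (edges t) * \<phi> t"

lemma signed_signed [simp]: "signed (signed \<phi>) = \<phi>"
  by (simp add: signed_def fun_eq_iff flip: mult.assoc)

definition invariant_form ::
    "('k::field, 'a) operad \<Rightarrow> nat \<Rightarrow> nat \<Rightarrow> ('a dtree \<Rightarrow> 'k) \<Rightarrow> bool" where
  "invariant_form P n v f \<longleftrightarrow>
     (\<forall>C p q ts. plug C (Node p ts) \<in> dtrees P n v \<and> plug C (Node q ts) \<in> dtrees P n v \<longrightarrow>
        f (plug C (Node (add P (length ts) p q) ts)) =
        f (plug C (Node p ts)) + f (plug C (Node q ts))) \<and>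
     (\<forall>C c p ts. plug C (Node p ts) \<in> dtrees P n v \<longrightarrow>
        f (plug C (Node (scl P (length ts) c p) ts)) = c * f (plug C (Node p ts))) \<and>
     (\<forall>C \<sigma> p ts. plug C (Node p ts) \<in> dtrees P n v \<and> \<sigma> permutes {..<length ts} \<longrightarrow>
        f (plug C (Node (act P (length ts) \<sigma> p) ts)) = f (plug C (Node p (permute \<sigma> ts))))"

lemma list_sign_nonzero [simp]: "list_sign xs \<noteq> (0 :: 'k::field)"
  using list_sign_square[of xs] by (metis mult_zero_left zero_neq_one)

lemma cochain_iff_invariant_form:
  fixes P :: "('k::field, 'a) operad"
  shows "cochain P n v \<phi> \<longleftrightarrow> invariant_form P n v (signed \<phi>)"
proof -
  have add: "signed \<phi> (plug C (Node (add P (length ts) p q) ts)) =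
        signed \<phi> (plug C (Node p ts)) + signed \<phi> (plug C (Node q ts)) \<longleftrightarrow>
      \<phi> (plug C (Node (add P (length ts) p q) ts)) =
        \<phi> (plug C (Node p ts)) + \<phi> (plug C (Node q ts))" for C p q ts
    unfolding signed_def edges_plug_decoration[of C "add P (length ts) p q" ts p]
      edges_plug_decoration[of C q ts p] distrib_left[symmetric] by simp
  have scl: "signed \<phi> (plug C (Node (scl P (length ts) c p) ts)) = c * signed \<phi> (plug C (Node p ts)) \<longleftrightarrow>
      \<phi> (plug C (Node (scl P (length ts) c p) ts)) = c * \<phi> (plug C (Node p ts))" for C c p ts
    unfolding signed_def edges_plug_decoration[of C "scl P (length ts) c p" ts p]
      mult.left_commute[of c] by simp
  have sym: "signed \<phi> (plug C (Node (act P (length ts) \<sigma> p) ts)) =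
        signed \<phi> (plug C (Node p (permute \<sigma> ts))) \<longleftrightarrow>
      \<phi> (plug C (Node (act P (length ts) \<sigma> p) ts)) =
        koszul_sign \<sigma> (map vertices ts) * \<phi> (plug C (Node p (permute \<sigma> ts)))"
    if "plug C (Node p ts) \<in> dtrees P n v" "\<sigma> permutes {..<length ts}" for C \<sigma> p ts
  proof -
    let ?k = "koszul_sign \<sigma> (map vertices ts) :: 'k"
    let ?y = "list_sign (edges (plug C (Node p (permute \<sigma> ts)))) :: 'k"
    have k: "?k * ?k = 1"
      unfolding koszul_sign_def prod.distrib[symmetric]
      by (rule prod.neutral) (auto simp: minus_one_power_iff)
    have s: "list_sign (edges (plug C (Node (act P (length ts) \<sigma> p) ts))) = ?k * ?y"
      by (rule list_sign_permute[OF that, symmetric])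
    have "x * y * a = y * b \<longleftrightarrow> a = x * b" if "x * x = 1" "y \<noteq> 0" for x y a b :: 'k
    proof -
      have "x * (x * c) = c" for c using that(1) by (simp flip: mult.assoc)
      then have "x * a = b \<longleftrightarrow> a = x * b" by auto
      moreover have "x * y * a = y * b \<longleftrightarrow> x * a = b"
        using that(2) by (simp add: mult.assoc mult.left_commute[of x y])
      ultimately show ?thesis by simp
    qed
    from this[OF k list_sign_nonzero] show ?thesis unfolding signed_def s .
  qed
  show ?thesis
    unfolding cochain_def invariant_form_def
    using add scl sym by (simp cong: conj_cong imp_cong)
qed

section \<open>Contracting internal edges\<close>

lemma contractions_Node_cases:
  assumes "t' \<in> set (contractions P (Node p ts))"
  obtains i q ss where "i < length ts" "ts ! i = Node q ss"
      "t' = Node (pcomp P (length ts) (length ss) i p q) (take i ts @ ss @ drop (Suc i) ts)"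
    | i u where "i < length ts" "u \<in> set (contractions P (ts ! i))" "t' = Node p (ts[i := u])"
proof -
  obtain i where i: "i < length ts" and
    "t' \<in> set (contract_edge P p (take i ts) (ts ! i) (drop (Suc i) ts)) \<or>
     t' \<in> set (map (\<lambda>t. Node p (ts[i := t])) (contractions P (ts ! i)))"
    using assms by auto
  then consider "t' \<in> set (contract_edge P p (take i ts) (ts ! i) (drop (Suc i) ts))"
    | u where "u \<in> set (contractions P (ts ! i))" "t' = Node p (ts[i := u])" by auto
  then show thesis
  proof cases
    case 1
    then obtain q ss where "ts ! i = Node q ss" by (cases "ts ! i") auto
    moreover have "Suc (length ts - Suc 0) = length ts" using i by simp
    ultimately show thesis using 1 i by (intro that(1)[of i q ss]) auto
  next
    case 2
    then show thesis using that(2) i by blast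
  qed
qed

lemma split_at: "i < length ts \<Longrightarrow> ts = take i ts @ ts ! i # drop (Suc i) ts"
  by (rule id_take_nth_drop)

lemma leaves_contractions: "t' \<in> set (contractions P t) \<Longrightarrow> leaves t' = leaves t"
proof (induction t arbitrary: t')
  case (Node p ts)
  from Node.prems show ?case
  proof (cases rule: contractions_Node_cases)
    case (1 i q ss)
    have "concat (map leaves ts) = concat (map leaves (take i ts @ Node q ss # drop (Suc i) ts))"
      using split_at[OF 1(1)] 1(2) by simp
    then show ?thesis using 1(3) by simp
  next
    case (2 i u)
    have "leaves u = leaves (ts ! i)" using Node.IH[OF nth_mem[OF 2(1)] 2(2)] .
    then have "map leaves (ts[i := u]) = map leaves ts"
      by (metis list_update_id map_update)
    then show ?thesis using 2(3) by (simp only: leaves.simps)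
  qed
qed auto

lemma contraction_is_Node: "t' \<in> set (contractions P t) \<Longrightarrow> blocks t' = set (leaves t) # edges t'"
proof (cases t)
  case (Node p ts)
  assume h: "t' \<in> set (contractions P t)"
  then have "leaves t' = leaves t" by (rule leaves_contractions)
  moreover obtain q us where "t' = Node q us"
    using h unfolding Node by (cases rule: contractions_Node_cases) auto
  ultimately show ?thesis by auto
qed auto

text \<open>
  Contraction of the \<open>j\<close>-th internal edge in preorder removes the \<open>j\<close>-th set of leaves and keeps the
  order of the others.
\<close>

lemma edges_contractions: "map edges (contractions P t) = deletions (edges t)"
proof (induction t)
  case (Node p ts)
  have step: "map edges (contract_edge P p (take i ts) (ts ! i) (drop (Suc i) ts) @
        map (\<lambda>t. Node p (ts[i := t])) (contractions P (ts ! i))) =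
      map (\<lambda>z. concat (take i (map blocks ts)) @ z @ concat (drop (Suc i) (map blocks ts)))
        (deletions (map blocks ts ! i))" if i: "i < length ts" for i
  proof (cases "ts ! i")
    case (Leaf l)
    then show ?thesis using i by simp
  next
    case (Node q ss)
    let ?top = "set (leaves (Node q ss))"
    have "deletions (map blocks ts ! i) = edges (ts ! i) # map ((#) ?top) (map edges (contractions P (ts ! i)))"
      using i Node \<open>\<And>t. t \<in> set ts \<Longrightarrow> map edges (contractions P t) = deletions (edges t)\<close>[OF nth_mem[OF i]]
      by simp
    also have "map ((#) ?top) (map edges (contractions P (ts ! i))) = map blocks (contractions P (ts ! i))"
      using contraction_is_Node[of _ P "ts ! i"] Node by simp
    finally show ?thesis
      using i Node by (simp add: upd_conv_take_nth_drop take_map drop_map)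
  qed
  have "map edges (contractions P (Node p ts)) =
      concat (map (\<lambda>i. map edges (contract_edge P p (take i ts) (ts ! i) (drop (Suc i) ts) @
        map (\<lambda>t. Node p (ts[i := t])) (contractions P (ts ! i)))) [0..<length ts])"
    by (simp only: contractions.simps map_concat map_map comp_def)
  also have "\<dots> = concat (map (\<lambda>i. map (\<lambda>z. concat (take i (map blocks ts)) @ z @
      concat (drop (Suc i) (map blocks ts))) (deletions (map blocks ts ! i))) [0..<length ts])"
    by (intro arg_cong[of _ _ concat] map_cong refl step) simp
  also have "\<dots> = deletions (edges (Node p ts))"
    by (simp only: deletions_concat length_map edges_Node)
  finally show ?case .
qed (simp add: edges_def)

lemma contractions_dtrees:
  assumes closed: "\<And>m n i p q. p \<in> ops P m \<Longrightarrow> q \<in> ops P n \<Longrightarrow> i < m \<Longrightarrow> pcomp P m n i p q \<in> ops P (m + n - 1)"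
    and t: "t \<in> dtrees P n (Suc v)" and t': "t' \<in> set (contractions P t)"
  shows "t' \<in> dtrees P n v"
proof -
  have dec: "decorated P t'" if "decorated P t" "t' \<in> set (contractions P t)" for t t'
    using that
  proof (induction t arbitrary: t')
    case (Node p ts)
    have p: "2 \<le> length ts" "p \<in> ops P (length ts)" "\<forall>t\<in>set ts. decorated P t"
      using Node.prems(1) by simp_all
    from Node.prems(2) show ?case
    proof (cases rule: contractions_Node_cases)
      case (1 i q ss)
      have "Node q ss \<in> set ts" using 1 nth_mem by metis
      then have dq: "decorated P (Node q ss)" using p by blast
      then have "pcomp P (length ts) (length ss) i p q \<in> ops P (length ts + length ss - 1)"
        using p 1(1) by (intro closed) auto
      moreover have "length (take i ts @ ss @ drop (Suc i) ts) = length ts + length ss - 1"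
        using 1(1) by simp
      moreover have "\<forall>t\<in>set (take i ts @ ss @ drop (Suc i) ts). decorated P t"
        using p dq by (auto dest: in_set_takeD in_set_dropD)
      moreover have "2 \<le> length ts + length ss - 1" using p(1) by (cases ss) (use dq in auto)
      ultimately show ?thesis unfolding 1(3) decorated.simps by metis
    next
      case (2 i u)
      have "decorated P (ts ! i)" using p nth_mem[OF 2(1)] by blast
      then have "decorated P u" using Node.IH[OF nth_mem[OF 2(1)] _ 2(2)] by blast
      moreover have "set (ts[i := u]) \<subseteq> insert u (set ts)" by (rule set_update_subset_insert)
      ultimately have "\<forall>t\<in>set (ts[i := u]). decorated P t"
        using p by blast
      then show ?thesis using Node.prems(1) unfolding 2(3) by simp
    qed
  qed auto
  have "vertices t' = v"
  proof -
    have "edges t' \<in> set (map edges (contractions P t))" using t' by simp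
    then have "Suc (length (edges t')) = length (edges t)"
      unfolding edges_contractions by (rule length_in_deletions)
    moreover have "length (blocks t) = Suc v" using t by (simp add: dtrees_def)
    moreover have "length (blocks t') = Suc (length (edges t'))" using contraction_is_Node[OF t'] by simp
    ultimately show ?thesis by (simp add: edges_def)
  qed
  then show ?thesis using t dec[OF _ t'] leaves_contractions[OF t'] by (simp add: dtrees_def)
qed

lemma signed_codiff:
  assumes "decorated P t" "distinct (leaves t)"
  shows "list_sign (edges t) * codiff P \<phi> t =
    (\<Sum>j<length (edges t). (- 1) ^ rank (set (edges t)) (edges t ! j) *
      signed \<phi> (contractions P t ! j) :: 'k::field)"
proof -
  have len: "length (contractions P t) = length (edges t)"
    using arg_cong[OF edges_contractions[of P t], of length] by simp
  have d: "distinct (edges t)" using distinct_blocks[OF assms] by (simp add: edges_def distinct_tl)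
  have "list_sign (edges t) * ((- 1) ^ j * \<phi> (contractions P t ! j)) =
      (- 1) ^ rank (set (edges t)) (edges t ! j) * signed \<phi> (contractions P t ! j)"
    if j: "j < length (edges t)" for j
  proof -
    have "edges (contractions P t ! j) = deletions (edges t) ! j"
      using j len arg_cong[OF edges_contractions[of P t], of "\<lambda>xs. xs ! j"] by simp
    then have "list_sign (edges t) * (- 1 :: 'k) ^ j =
        (- 1) ^ rank (set (edges t)) (edges t ! j) * list_sign (edges (contractions P t ! j))"
      using list_sign_deletions[OF d finite_edges j] by simp
    then show ?thesis by (simp add: signed_def flip: mult.assoc)
  qed
  then show ?thesis by (simp add: codiff_def len sum_distrib_left)
qed

section \<open>Finite linear combinations of evaluations\<close>

text \<open>
  The linear forms on functions that are finite combinations of evaluations at points of \<open>X\<close>, i.e.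
  formal linear combinations of elements of \<open>X\<close> in continuation-passing style: applying one to
  the function \<open>\<lambda>m. k m G\<close> substitutes combinations for points.
\<close>

inductive combination :: "'a set \<Rightarrow> (('a \<Rightarrow> 'k::field) \<Rightarrow> 'k) \<Rightarrow> bool" for X where
  zero: "combination X (\<lambda>G. 0)"
| add: "m \<in> X \<Longrightarrow> combination X e \<Longrightarrow> combination X (\<lambda>G. c * G m + e G)"

lemma combination_cong: "combination X e \<Longrightarrow> (\<And>m. m \<in> X \<Longrightarrow> G m = H m) \<Longrightarrow> e G = e H"
  by (induction rule: combination.induct) auto

lemma combination_zero: "combination X e \<Longrightarrow> e (\<lambda>m. 0) = 0"
  by (induction rule: combination.induct) auto

lemma combination_plus_fun: "combination X e \<Longrightarrow> e (\<lambda>m. G m + H m) = e G + e H"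
  by (induction rule: combination.induct) (auto simp: algebra_simps)

lemma combination_scale_fun: "combination X e \<Longrightarrow> e (\<lambda>m. c * G m) = c * e G"
  by (induction rule: combination.induct) (auto simp: algebra_simps)

lemma combination_sum_fun:
  assumes "combination X e"
  shows "e (\<lambda>m. \<Sum>i\<in>I. G i m) = (\<Sum>i\<in>I. e (G i))"
  by (induction I rule: infinite_finite_induct)
     (simp_all add: combination_zero[OF assms] combination_plus_fun[OF assms])

lemma combination_lin_fun:
  assumes "combination X e"
  shows "e (\<lambda>m. lin (\<lambda>u. G u m) p) = lin (\<lambda>u. e (G u)) p"
  unfolding lin_def combination_sum_fun[OF assms] combination_scale_fun[OF assms] ..

lemma combination_plus:
  assumes "combination X e" "combination X e'"
  shows "combination X (\<lambda>G. e G + e' G)"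
  using assms(1) by induction (auto simp: add.assoc assms(2) intro: combination.add)

lemma combination_scale:
  assumes "combination X e"
  shows "combination X (\<lambda>G. c * e G)"
  using assms
proof induction
  case (add m e c')
  then show ?case using combination.add[of m X "\<lambda>G. c * e G" "c * c'"] by (simp add: algebra_simps)
qed (simp add: combination.zero)

lemma combination_sum:
  assumes "\<And>i. i \<in> I \<Longrightarrow> combination X (e i)"
  shows "combination X (\<lambda>G. \<Sum>i\<in>I. e i G)"
  using assms
  by (induction I rule: infinite_finite_induct) (auto intro: combination.zero combination_plus)

lemma combination_lin:
  assumes "\<And>u. u \<in> supp p \<Longrightarrow> combination X (e u)"
  shows "combination X (\<lambda>G. lin (\<lambda>u. e u G) p)"
  unfolding lin_def using assms by (intro combination_sum combination_scale)

lemma combination_point: "m \<in> X \<Longrightarrow> combination X (\<lambda>G. G m)"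
  using combination.add[OF _ combination.zero, of m X 1] by simp

lemma combination_bind:
  assumes "combination X e" "\<And>m. m \<in> X \<Longrightarrow> combination Y (k m)"
  shows "combination Y (\<lambda>G. e (\<lambda>m. k m G))"
  using assms(1)
proof induction
  case (add m e c)
  then show ?case
    using combination_plus[OF combination_scale[OF assms(2)[OF add.hyps(1)], of c] add.IH] by simp
qed (simp add: combination.zero)

lemma combination_map:
  assumes "combination X e" "\<And>m. m \<in> X \<Longrightarrow> h m \<in> Y"
  shows "combination Y (\<lambda>G. e (\<lambda>m. G (h m)))"
  by (rule combination_bind[OF assms(1), of Y "\<lambda>m G. G (h m)"])
    (rule combination_point, rule assms(2))

text \<open>
  Fubini's theorem for finite sums.
\<close>

lemma combination_swap:
  assumes "combination X e" "combination Y e'"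
  shows "e (\<lambda>m. e' (\<lambda>m'. G m m')) = e' (\<lambda>m'. e (\<lambda>m. G m m'))"
  using assms(1)
  by induction (simp_all add: combination_zero[OF assms(2)] combination_plus_fun[OF assms(2)]
      combination_scale_fun[OF assms(2)])

text \<open>
  The tensor product of combinations, as a combination of lists.
\<close>

fun product :: "(('a \<Rightarrow> 'k::field) \<Rightarrow> 'k) list \<Rightarrow> ('a list \<Rightarrow> 'k) \<Rightarrow> 'k" where
  "product [] H = H []"
| "product (e # es) H = e (\<lambda>m. product es (\<lambda>ms. H (m # ms)))"

lemma product_append:
  "product (es @ es') H = product es (\<lambda>ms. product es' (\<lambda>ms'. H (ms @ ms')))"
  by (induction es arbitrary: H) auto

lemma combination_product:
  assumes "\<And>t. t \<in> set ts \<Longrightarrow> combination (X t) (e t)"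
  shows "combination {ms. list_all2 (\<lambda>m t. m \<in> X t) ms ts} (product (map e ts))"
  using assms
proof (induction ts)
  case Nil
  then show ?case by (simp add: combination_point)
next
  case (Cons t ts)
  have "combination {ms. list_all2 (\<lambda>m t. m \<in> X t) ms (t # ts)}
      (\<lambda>H. product (map e ts) (\<lambda>ms. H (m # ms)))" if "m \<in> X t" for m
    by (rule combination_map[of "{ms. list_all2 (\<lambda>m t. m \<in> X t) ms ts}"])
       (use Cons that in auto)
  from combination_bind[of "X t" "e t", OF _ this] Cons.prems show ?case by simp
qed

lemma product_update:
  assumes "i < length es" "\<And>G. e' G = (es ! i) (\<lambda>m. G (h m))"
  shows "product (es[i := e']) H = product es (\<lambda>ms. H (ms[i := h (ms ! i)]))"
  using assms
proof (induction es arbitrary: i H)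
  case (Cons e es)
  show ?case
  proof (cases i)
    case 0
    then show ?thesis using Cons.prems(2)[of "\<lambda>m. product es (\<lambda>ms. H (m # ms))"] by simp
  next
    case (Suc j)
    then show ?thesis using Cons.IH[of j] Cons.prems by simp
  qed
qed auto

text \<open>
  The product of a family of combinations, with the chosen points recorded as values of a
  function rather than in a list, so that the order of the factors can be changed.
\<close>

fun assign ::
    "(nat \<Rightarrow> ('a \<Rightarrow> 'k::field) \<Rightarrow> 'k) \<Rightarrow> nat list \<Rightarrow> ((nat \<Rightarrow> 'a) \<Rightarrow> 'k) \<Rightarrow> (nat \<Rightarrow> 'a) \<Rightarrow> 'k" where
  "assign e [] H f = H f"
| "assign e (x # xs) H f = e x (\<lambda>m. assign e xs H (f(x := m)))"

lemma assign_cong: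
  "(\<And>g. (\<And>y. y \<notin> set xs \<Longrightarrow> g y = f y) \<Longrightarrow> H g = H' g) \<Longrightarrow> assign e xs H f = assign e xs H' f"
proof (induction xs arbitrary: f)
  case Nil
  then show ?case by simp
next
  case (Cons x xs)
  have "assign e xs H (f(x := m)) = assign e xs H' (f(x := m))" for m
  proof (rule Cons.IH)
    fix g assume "\<And>y. y \<notin> set xs \<Longrightarrow> g y = (f(x := m)) y"
    then show "H g = H' g" by (intro Cons.prems) auto
  qed
  then show ?case by simp
qed

lemma product_eq_assign:
  "distinct xs \<Longrightarrow> product (map e xs) H = assign e xs (\<lambda>f. H (map f xs)) f0"
proof (induction xs arbitrary: H f0)
  case (Cons x xs)
  have "product (map e xs) (\<lambda>ms. H (m # ms)) =
      assign e xs (\<lambda>f. H (map f (x # xs))) (f0(x := m))" for m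
  proof -
    have "product (map e xs) (\<lambda>ms. H (m # ms)) = assign e xs (\<lambda>f. H (m # map f xs)) (f0(x := m))"
      using Cons by simp
    also have "\<dots> = assign e xs (\<lambda>f. H (map f (x # xs))) (f0(x := m))"
    proof (rule assign_cong)
      fix g assume g: "\<And>y. y \<notin> set xs \<Longrightarrow> g y = (f0(x := m)) y"
      have "g x = m" using g[of x] Cons.prems by simp
      then show "H (m # map g xs) = H (map g (x # xs))" by simp
    qed
    finally show ?thesis .
  qed
  then show ?case by simp
qed auto

lemma assign_move:
  assumes "\<And>x. combination (X x) (e x)" "x \<notin> set ys"
  shows "assign e (ys @ x # zs) H f = assign e (x # ys @ zs) H f"
  using assms(2)
proof (induction ys arbitrary: f)
  case (Cons y ys)
  have "assign e ((y # ys) @ x # zs) H f = e y (\<lambda>m. assign e (x # ys @ zs) H (f(y := m)))"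
    using Cons by simp
  also have "\<dots> = e x (\<lambda>m'. e y (\<lambda>m. assign e (ys @ zs) H (f(y := m, x := m'))))"
    by (simp add: combination_swap[OF assms(1)[of y] assms(1)[of x]])
  also have "\<dots> = assign e (x # (y # ys) @ zs) H f"
    using Cons.prems by (simp add: fun_upd_twist)
  finally show ?case .
qed auto

lemma assign_permute:
  assumes "\<And>x. combination (X x) (e x)" "distinct xs" "mset xs = mset ys"
  shows "assign e xs H f = assign e ys H f"
  using assms(2,3)
proof (induction xs arbitrary: ys f)
  case (Cons x xs)
  have "x \<in> set ys" using Cons.prems(2) by (metis list.set_intros(1) mset_eq_setD)
  then obtain as bs where ys: "ys = as @ x # bs" by (meson split_list)
  have d: "distinct ys" using Cons.prems mset_eq_imp_distinct_iff by blast
  have "mset xs = mset (as @ bs)" using Cons.prems(2) by (simp add: ys)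
  then have "assign e xs H f = assign e (as @ bs) H f" for f
    using Cons by simp
  moreover have "x \<notin> set as" using d by (simp add: ys)
  ultimately show ?case
    using assign_move[OF assms(1), where x = x and ys = as and zs = bs] by (simp add: ys)
qed auto

lemma product_permute:
  assumes "\<And>t. t \<in> set ts \<Longrightarrow> combination (X t) (e t)" and \<sigma>: "\<sigma> permutes {..<length ts}"
  shows "product (map e (permute \<sigma> ts)) H = product (map e ts) (\<lambda>ms. H (permute \<sigma> ms))"
proof -
  let ?k = "length ts"
  \<comment> \<open>combinations for all indices, as \<open>assign_permute\<close> requires\<close>
  define F where "F i = (if i < ?k then e (ts ! i) else (\<lambda>G. 0))" for i
  have F: "combination (X (ts ! i)) (F i)" for i
    using assms(1)[of "ts ! i"] by (auto simp: F_def combination.zero)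
  have range: "\<sigma> i < ?k \<longleftrightarrow> i < ?k" for i
    using permutes_in_image[OF \<sigma>, of i] by simp
  have ts: "map e ts = map F [0..<?k]"
    by (rule nth_equalityI) (auto simp: F_def)
  have "product (map e (permute \<sigma> ts)) H = product (map F (map \<sigma> [0..<?k])) H"
    by (rule arg_cong[of _ _ "\<lambda>es. product es H"]) (auto simp: F_def range)
  also have "\<dots> = assign F (map \<sigma> [0..<?k]) (\<lambda>f. H (map f (map \<sigma> [0..<?k]))) undefined"
    using permutes_inj_on[OF \<sigma>] by (intro product_eq_assign) (simp add: distinct_map)
  also have "\<dots> = assign F [0..<?k] (\<lambda>f. H (map f (map \<sigma> [0..<?k]))) undefined"
  proof (rule assign_permute[OF F])
    show "distinct (map \<sigma> [0..<?k])" using permutes_inj_on[OF \<sigma>] by (simp add: distinct_map)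
    then show "mset (map \<sigma> [0..<?k]) = mset [0..<?k]"
      using permutes_image[OF \<sigma>]
      by (subst set_eq_iff_mset_eq_distinct[symmetric]) (auto simp: atLeast0LessThan)
  qed
  also have "(\<lambda>f. H (map f (map \<sigma> [0..<?k]))) = (\<lambda>f. H (permute \<sigma> (map f [0..<?k])))"
    by (intro ext arg_cong[of _ _ H]) (auto simp: range)
  also have "assign F [0..<?k] \<dots> undefined = product (map F [0..<?k]) (\<lambda>ms. H (permute \<sigma> ms))"
    by (rule product_eq_assign[symmetric]) simp
  finally show ?thesis unfolding ts .
qed

section \<open>Expanding decorated trees into marked trees\<close>

definition bigraft_relations :: "(bigraft_gen monomial \<Rightarrow>\<^sub>0 'k::field) set" where
  "bigraft_relations =
     {bigraft_rel Ast Ast Ast Ast, bigraft_rel Ast Succ Succ Succ, bigraft_rel Succ Ast Succ Ast,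
      bigraft_rel Prec Prec Prec Ast, bigraft_rel Ast Prec Ast Prec, bigraft_rel Succ Prec Succ Prec}"

type_synonym 'k class_tree = "(bigraft_gen monomial \<Rightarrow>\<^sub>0 'k) set dtree"

abbreviation BG :: "('k::field, (bigraft_gen monomial \<Rightarrow>\<^sub>0 'k) set) operad" where
  "BG \<equiv> quadratic_operad bigraft_relations"

lemma keys_bigraft_rel:
  "supp (bigraft_rel a b c d :: bigraft_gen monomial \<Rightarrow>\<^sub>0 'k::field) \<subseteq> monomials 3"
proof -
  have "supp (x - y) \<subseteq> supp x \<union> supp y"
    for x y :: "bigraft_gen monomial \<Rightarrow>\<^sub>0 'k"
    by (auto simp: in_keys_iff lookup_minus)
  moreover have "Op b (Op a (Var 0) (Var 1)) (Var 2) \<in> monomials 3"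
    "Op c (Var 0) (Op d (Var 1) (Var 2)) \<in> monomials 3"
    by (auto simp: monomials_def)
  ultimately show ?thesis unfolding bigraft_rel_def by fastforce
qed

interpretation bg: quadratic_data "bigraft_relations :: (bigraft_gen monomial \<Rightarrow>\<^sub>0 'k::field) set"
  by unfold_locales (auto simp: bigraft_relations_def dest: keys_bigraft_rel[THEN subsetD])

lemma bigraft_eq: "bigraft = BG"
  by (simp add: bigraft_def bigraft_relations_def)

lemma lin_evaluate_relation:
  "r \<in> bigraft_relations \<Longrightarrow> lin (\<lambda>u. G (evaluate join f u)) r = 0"
  by (auto simp: bigraft_relations_def bigraft_rel_def join_relations)

lemma lin_evaluate_ideal:
  "bg.ideal n z \<Longrightarrow> lin (\<lambda>u. G (evaluate join f u)) z = (0 :: 'k::field)"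
  by (rule bg.lin_evaluate_ideal) (rule lin_evaluate_relation)

lemma nrm_evaluate: "nrm D (evaluate join f u) = evaluate join (\<lambda>i. nrm D (f i)) u"
  by (induction u) auto

lemma vars_evaluate: "vars (evaluate join f u) = concat (map (\<lambda>i. vars (f i)) (vars u))"
  by (induction u) auto

lemma marks_evaluate: "marks (evaluate join f u) = (\<Union>i\<in>set (vars u). marks (f i))"
  by (induction u) auto

text \<open>
  The monomial \<open>u\<close> with the marked trees \<open>ms\<close> grafted on its leaves, normalised below the new root.
\<close>

definition graft :: "marked list \<Rightarrow> bigraft_gen monomial \<Rightarrow> marked" where
  "graft ms u = mark (evaluate join ((!) ms) u)"

definition representative :: "nat \<Rightarrow> (bigraft_gen monomial \<Rightarrow>\<^sub>0 'k::field) set \<Rightarrow> bigraft_gen monomial \<Rightarrow>\<^sub>0 'k" where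
  "representative n A = (SOME p. supp p \<subseteq> monomials n \<and> A = bg.cls n p)"

text \<open>
  The decorations are written in the basis of normal monomials and the tree becomes a combination of
  marked trees.  The labels of the leaves remember the permutations in the decorations.
\<close>

primrec expand :: "('k::field) class_tree \<Rightarrow> (marked \<Rightarrow> 'k) \<Rightarrow> 'k" where
  "expand (Leaf i) = (\<lambda>G. G (Var i))"
| "expand (Node A ts) = (\<lambda>G. lin (\<lambda>u. product (map expand ts) (\<lambda>ms. G (graft ms u)))
     (representative (length ts) A))"

text \<open>
  The marked trees that can occur in the expansion of \<open>t\<close>: their marks are the vertices of \<open>t\<close>.
\<close>

definition support :: "'a dtree \<Rightarrow> marked set" where
  "support t = {m. mset (vars m) = mset (leaves t) \<and> nrm {} m = m \<and>
     marks m = set (blocks t) \<and> mark m = m}"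

abbreviation supports :: "'a dtree list \<Rightarrow> marked list set" where
  "supports ts \<equiv> {ms. list_all2 (\<lambda>m t. m \<in> support t) ms ts}"

lemma representative:
  assumes "A \<in> ops BG n"
  shows "supp (representative n A) \<subseteq> monomials n" "A = bg.cls n (representative n A)"
  using someI_ex[OF assms[unfolded bg.ops_Q]] unfolding representative_def by blast+

lemma mset_vars_monomial: "u \<in> monomials n \<Longrightarrow> mset (vars u) = mset [0..<n]"
  unfolding monomials_def by (subst set_eq_iff_mset_eq_distinct[symmetric]) (auto simp: atLeast0LessThan)

lemma mset_vars_evaluate:
  assumes "u \<in> monomials (length ms)"
  shows "mset (vars (evaluate join ((!) ms) u)) = mset (concat (map vars ms))"
proof -
  have "mset (vars (evaluate join ((!) ms) u)) = mset (concat (map (\<lambda>i. vars (ms ! i)) [0..<length ms]))"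
    unfolding vars_evaluate mset_concat_map mset_vars_monomial[OF assms] ..
  also have "map (\<lambda>i. vars (ms ! i)) [0..<length ms] = map vars ms"
    by (rule nth_equalityI) auto
  finally show ?thesis .
qed

lemma supports_nth: "ms \<in> supports ts \<Longrightarrow> i < length ts \<Longrightarrow> ms ! i \<in> support (ts ! i)"
  by (simp add: list_all2_conv_all_nth)

lemma supports_length: "ms \<in> supports ts \<Longrightarrow> length ms = length ts"
  by (auto dest: list_all2_lengthD)

lemma supports_leaves: "ms \<in> supports ts \<Longrightarrow> mset (concat (map vars ms)) = mset (concat (map leaves ts))"
proof (induction ms arbitrary: ts)
  case (Cons m ms)
  then show ?case by (cases ts) (auto simp: support_def)
qed auto

lemma monomial_is_Op:
  assumes "u \<in> monomials k" "2 \<le> k"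
  obtains g s t where "u = Op g s t"
proof (cases u)
  case (Var i)
  then have "card {..<k} = 1" using assms(1) by (simp add: monomials_def flip: card_1_singleton_iff) (metis card.empty card_insert_if empty_iff finite.emptyI One_nat_def card_lessThan)
  then show ?thesis using assms(2) by simp
qed (use that in blast)

lemma graft_support:
  assumes ms: "ms \<in> supports ts" and u: "u \<in> monomials (length ts)" and k: "2 \<le> length ts"
  shows "graft ms u \<in> support (Node A ts)"
proof -
  let ?x = "evaluate join ((!) ms) u"
  have len: "length ms = length ts" and vu: "set (vars u) = {..<length ts}"
    using ms u by (auto simp: monomials_def dest: list_all2_lengthD)
  have nth: "ms ! i \<in> support (ts ! i)" if "i < length ts" for i
    using ms that by (rule supports_nth)
  have vars: "mset (vars ?x) = mset (leaves (Node A ts))"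
    using mset_vars_evaluate[of u ms] u len supports_leaves[OF ms] by simp
  moreover have "nrm {} (graft ms u) = graft ms u"
  proof -
    have "evaluate join (\<lambda>i. nrm {} (ms ! i)) u = ?x"
      by (rule evaluate_cong) (use nth vu in \<open>auto simp: support_def\<close>)
    then show ?thesis by (simp add: graft_def nrm_mark nrm_evaluate)
  qed
  moreover have "marks (graft ms u) = set (blocks (Node A ts))"
  proof -
    obtain g s t where u': "u = Op g s t" using monomial_is_Op[OF u k] .
    have "marks (graft ms u) = insert (set (vars ?x)) (marks ?x)"
      by (simp add: graft_def u')
    moreover have "set (vars ?x) = set (leaves (Node A ts))" using vars by (rule mset_eq_setD)
    moreover have "marks ?x = (\<Union>i<length ts. set (blocks (ts ! i)))"
      unfolding marks_evaluate vu by (rule SUP_cong[OF refl]) (use nth in \<open>auto simp: support_def\<close>)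
    moreover have "(\<Union>i<length ts. set (blocks (ts ! i))) = set (concat (map blocks ts))"
    proof -
      have "set ts = (\<lambda>i. ts ! i) ` {..<length ts}"
        by (metis atLeast0LessThan list.set_map map_nth set_upt)
      then show ?thesis by simp
    qed
    ultimately show ?thesis by simp
  qed
  ultimately show ?thesis by (simp add: support_def graft_def)
qed

abbreviation bigraft_decorated :: "('k::field) class_tree \<Rightarrow> bool" where
  "bigraft_decorated \<equiv> decorated BG"

lemma expand_combination:
  fixes t :: "('k::field) class_tree"
  shows "bigraft_decorated t \<Longrightarrow> combination (support t) (expand t)"
proof (induction t)
  case (Leaf i)
  then show ?case by (auto simp: support_def intro: combination_point)
next
  case (Node A ts)
  have prod: "combination (supports ts) (product (map expand ts))"
    using Node by (intro combination_product) auto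
  have A: "A \<in> ops BG (length ts)" and k: "2 \<le> length ts"
    using Node.prems by auto
  have "combination (support (Node A ts)) (\<lambda>G. product (map expand ts) (\<lambda>ms. G (graft ms u)))"
    if "u \<in> supp (representative (length ts) A)" for u
    by (rule combination_map[OF prod]) (use representative(1)[OF A] that k in \<open>auto intro: graft_support\<close>)
  then show ?case by (simp add: combination_lin)
qed

lemma product_expand_combination:
  assumes "\<And>t. t \<in> set ts \<Longrightarrow> bigraft_decorated t"
  shows "combination (supports ts) (product (map expand ts))"
  using assms by (intro combination_product expand_combination)

text \<open>
  The expansion does not depend on the representative because evaluation by \<open>join\<close> vanishes on the ideal.
\<close>

lemma expand_Node:
  fixes p :: "bigraft_gen monomial \<Rightarrow>\<^sub>0 'k::field"
  assumes "\<And>t. t \<in> set ts \<Longrightarrow> bigraft_decorated t" and p: "supp p \<subseteq> monomials (length ts)"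
  shows "expand (Node (bg.cls (length ts) p) ts) G =
    lin (\<lambda>u. product (map expand ts) (\<lambda>ms. G (graft ms u))) p"
proof -
  let ?n = "length ts" and ?K = "\<lambda>u. product (map expand ts) (\<lambda>ms. G (graft ms u))"
  let ?q = "representative ?n (bg.cls ?n p)"
  have prod: "combination (supports ts) (product (map expand ts))"
    using assms(1) by (rule product_expand_combination)
  have "bg.cls ?n p \<in> ops BG ?n"
    using p bg.ops_Q by blast
  then have "bg.cls ?n p = bg.cls ?n ?q" by (rule representative(2))
  then have "bg.ideal ?n (p - ?q)" by (rule bg.cls_eq_iff[THEN iffD1])
  then have "lin (\<lambda>u. G (graft ms u)) (p - ?q) = 0" for ms
    unfolding graft_def by (rule lin_evaluate_ideal)
  then have "lin ?K (p - ?q) = 0"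
    using combination_lin_fun[OF prod, of "\<lambda>u ms. G (graft ms u)" "p - ?q"] combination_zero[OF prod] by simp
  then show ?thesis by simp
qed

section \<open>The expansion commutes with contractions\<close>

lemma list_all2_concat:
  "list_all2 (list_all2 P) xss yss \<Longrightarrow> list_all2 P (concat xss) (concat yss)"
  by (induction rule: list_all2_induct) (auto intro: list_all2_appendI)

lemma evaluate_comp_append:
  assumes s: "s \<in> monomials (Suc (length as + length cs))" and w: "w \<in> monomials (length ds)"
  shows "evaluate op (\<lambda>j. (as @ ds @ cs) ! j) (comp_monomial (length ds) (length as) s w) =
    evaluate op (\<lambda>j. (as @ evaluate op ((!) ds) w # cs) ! j) s"
proof -
  have inner: "evaluate op (\<lambda>l. (as @ ds @ cs) ! (l + length as)) w = evaluate op ((!) ds) w"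
    by (rule evaluate_cong) (use w in \<open>auto simp: monomials_def nth_append\<close>)
  have pos: "0 < length ds" using w vars_nonempty[of w] by (cases ds) (auto simp: monomials_def)
  show ?thesis unfolding evaluate_comp inner
  proof (rule evaluate_cong)
    fix j assume "j \<in> set (vars s)"
    consider "j < length as" | "j = length as" | "length as < j" by linarith
    then show "(if j < length as then (as @ ds @ cs) ! j
        else if j = length as then evaluate op ((!) ds) w
        else (as @ ds @ cs) ! (j + length ds - 1)) =
        (as @ evaluate op ((!) ds) w # cs) ! j"
    proof cases
      case 3
      then have "j + length ds - 1 - length as - length ds = j - Suc (length as)"
        "\<not> j + length ds - 1 < length as" "\<not> j + length ds - 1 - length as < length ds"
        "j - length as = Suc (j - Suc (length as))"
        using pos by linarith+
      then show ?thesis using 3 by (simp add: nth_append)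
    qed (simp_all add: nth_append)
  qed
qed

lemma nrm_unmarked:
  assumes "m \<in> support t" "e \<notin> set (blocks t)"
  shows "nrm {e} m = m"
  using nrm_cong[of "{e}" m "{}"] assms by (simp add: support_def)

text \<open>
  Contracting an edge inside a child: the monomial at the root is the same, and the contraction acts
  on the grafted tree in one place, since the other children do not contain the edge.
\<close>

lemma expand_contract_below:
  fixes ts :: "('k::field) class_tree list"
  assumes dec: "bigraft_decorated (Node A ts)" and dist: "distinct (leaves (Node A ts))"
    and i: "i < length ts" and e: "e \<in> set (edges (ts ! i))"
    and IH: "\<And>G. expand t' G = expand (ts ! i) (\<lambda>m. G (nrm {e} m))"
  shows "expand (Node A (ts[i := t'])) G = expand (Node A ts) (\<lambda>m. G (nrm {e} m))"
proof -
  have A: "A \<in> ops BG (length ts)"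
    and sub: "\<And>t. t \<in> set ts \<Longrightarrow> bigraft_decorated t" using dec by auto
  have prod: "combination (supports ts) (product (map expand ts))"
    by (rule product_expand_combination) (rule sub)
  have d: "distinct (concat (map blocks ts))" and top: "set (leaves (Node A ts)) \<notin> set (concat (map blocks ts))"
    using distinct_blocks[OF dec dist] by auto
  have e': "e \<in> set (blocks (ts ! i))" using e unfolding edges_def by (cases "blocks (ts ! i)") auto
  have e_top: "e \<noteq> set (leaves (Node A ts))" using e' top i by force
  have e_other: "e \<notin> set (blocks (ts ! j))" if "j < length ts" "j \<noteq> i" for j
    using distinct_concat_nth_disjoint[OF d, of i j] distinct_concat_nth_disjoint[OF d, of j i] that i e'
    by (cases "i < j") auto
  have eq: "graft (ms[i := nrm {e} (ms ! i)]) u = nrm {e} (graft ms u)"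
    if ms: "ms \<in> supports ts" and u: "u \<in> monomials (length ts)" for ms u
  proof -
    have len: "length ms = length ts" using ms by (rule supports_length)
    have "set (vars (evaluate join ((!) ms) u)) = set (leaves (Node A ts))"
      using mset_vars_evaluate[of u ms] u len supports_leaves[OF ms] by (intro mset_eq_setD) simp
    then have "nrm {e} (graft ms u) = mark (evaluate join (\<lambda>j. nrm {e} (ms ! j)) u)"
      using e_top by (simp add: graft_def nrm_mark nrm_evaluate)
    also have "evaluate join (\<lambda>j. nrm {e} (ms ! j)) u = evaluate join (\<lambda>j. ms[i := nrm {e} (ms ! i)] ! j) u"
    proof (rule evaluate_cong)
      fix j assume "j \<in> set (vars u)"
      then have j: "j < length ts" using u by (simp add: monomials_def)
      then show "nrm {e} (ms ! j) = ms[i := nrm {e} (ms ! i)] ! j"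
        using nrm_unmarked[OF supports_nth[OF ms j] e_other[OF j]] len by (cases "j = i") auto
    qed
    finally show ?thesis by (simp add: graft_def)
  qed
  have "product (map expand (ts[i := t'])) (\<lambda>ms. G (graft ms u)) =
      product (map expand ts) (\<lambda>ms. G (nrm {e} (graft ms u)))" if u: "u \<in> monomials (length ts)" for u
  proof -
    have "product (map expand (ts[i := t'])) (\<lambda>ms. G (graft ms u)) =
        product (map expand ts) (\<lambda>ms. G (graft (ms[i := nrm {e} (ms ! i)]) u))"
      using product_update[of i "map expand ts" "expand t'" "nrm {e}" "\<lambda>ms. G (graft ms u)"] i IH
      by (simp add: map_update)
    also have "\<dots> = product (map expand ts) (\<lambda>ms. G (nrm {e} (graft ms u)))"
      by (rule combination_cong[OF prod]) (use eq u in auto)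
    finally show ?thesis .
  qed
  then show ?thesis using representative(1)[OF A] by (auto intro!: lin_cong)
qed

text \<open>
  Contracting an edge at the root: composing two decorations and normalising is the same as grafting one on the
  other with a mark and then removing the mark.
\<close>

lemma expand_contract_edge:
  fixes ts :: "('k::field) class_tree list"
  assumes dec: "bigraft_decorated (Node A ts)" and dist: "distinct (leaves (Node A ts))"
    and ts: "ts = ls @ Node B ss # rs"
  shows "expand (Node (pcomp BG (length ts) (length ss) (length ls) A B) (ls @ ss @ rs)) G =
    expand (Node A ts) (\<lambda>m. G (nrm {set (leaves (Node B ss))} m))"
proof -
  let ?Q = "BG :: ('k, _) operad"
  let ?e = "set (leaves (Node B ss))" and ?i = "length ls" and ?b = "length ss"
  have A: "A \<in> ops ?Q (length ts)" and sub: "\<And>t. t \<in> set ts \<Longrightarrow> bigraft_decorated t"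
    using dec by auto
  have B: "B \<in> ops ?Q ?b" and subB: "\<And>t. t \<in> set ss \<Longrightarrow> bigraft_decorated t"
    using sub[of "Node B ss"] by (auto simp: ts)
  have subl: "\<And>t. t \<in> set ls \<Longrightarrow> bigraft_decorated t" and subr: "\<And>t. t \<in> set rs \<Longrightarrow> bigraft_decorated t"
    using sub by (auto simp: ts)
  obtain p where p: "supp p \<subseteq> monomials (length ts)" "A = bg.cls (length ts) p"
    using A unfolding bg.ops_Q by blast
  obtain q where q: "supp q \<subseteq> monomials ?b" "B = bg.cls ?b q"
    using B unfolding bg.ops_Q by blast
  have i: "?i < length ts" by (simp add: ts)
  have len: "length (ls @ ss @ rs) = length ts + ?b - 1" by (simp add: ts)
  have AB: "pcomp ?Q (length ts) ?b ?i A B = bg.cls (length (ls @ ss @ rs)) (pcomp free_operad (length ts) ?b ?i p q)"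
    unfolding p(2) q(2) len by (rule bg.pcomp_Q[OF p(1) q(1) i])
  have dB: "distinct (blocks (Node A ts))" using distinct_blocks[OF dec dist] .
  then have not_in: "?e \<noteq> set (leaves (Node A ts))" "?e \<notin> set (concat (map blocks ls))"
      "?e \<notin> set (concat (map blocks rs))" "?e \<notin> set (concat (map blocks ss))"
    unfolding ts by auto
  have eq: "graft (as @ ds @ cs) (comp_monomial ?b ?i s w) = nrm {?e} (graft (as @ graft ds w # cs) s)"
    if as: "as \<in> supports ls" and ds: "ds \<in> supports ss" and cs: "cs \<in> supports rs"
      and s: "s \<in> monomials (length ts)" and w: "w \<in> monomials ?b" for as ds cs s w
  proof -
    have la: "length as = ?i" and ld: "length ds = ?b" and lc: "length cs = length rs"
      using as ds cs by (auto dest: list_all2_lengthD)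
    let ?y = "evaluate join ((!) ds) w"
    let ?ms = "as @ graft ds w # cs"
    have lts: "length ts = length ?ms" using la lc by (simp add: ts)
    have vy: "set (vars ?y) = ?e"
      using mset_vars_evaluate[of w ds] w ld supports_leaves[OF ds] by (intro mset_eq_setD) simp
    have "graft ds w \<in> support (Node B ss)"
      using graft_support[OF ds w] sub[of "Node B ss"] by (simp add: ts)
    then have ms: "?ms \<in> supports ts" using as cs by (auto simp: ts intro: list_all2_appendI)
    have "set (vars (evaluate join (\<lambda>j. ?ms ! j) s)) = set (leaves (Node A ts))"
      using mset_vars_evaluate[of s ?ms] s lts supports_leaves[OF ms] by (intro mset_eq_setD) simp
    then have "nrm {?e} (graft ?ms s) = mark (evaluate join (\<lambda>j. nrm {?e} (?ms ! j)) s)"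
      using not_in(1) by (simp add: graft_def nrm_mark nrm_evaluate)
    also have "evaluate join (\<lambda>j. nrm {?e} (?ms ! j)) s = evaluate join (\<lambda>j. (as @ ?y # cs) ! j) s"
    proof (rule evaluate_cong)
      fix j assume "j \<in> set (vars s)"
      then have j: "j < length ts" using s by (simp add: monomials_def)
      have fix_list: "nrm {?e} m = m"
        if m: "m \<in> set xs" and xs: "xs \<in> supports us" and us: "?e \<notin> set (concat (map blocks us))"
        for m xs and us :: "'k class_tree list"
      proof -
        obtain l where l: "l < length xs" "m = xs ! l" using m by (auto simp: in_set_conv_nth)
        then have "l < length us" using supports_length[OF xs] by simp
        moreover from this have "?e \<notin> set (blocks (us ! l))" using us by auto
        ultimately show ?thesis using nrm_unmarked[OF supports_nth[OF xs], of l ?e] l(2) by simp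
      qed
      have y: "nrm {?e} (graft ds w) = ?y"
      proof -
        have "evaluate join (\<lambda>l. nrm {?e} (ds ! l)) w = ?y"
        proof (rule evaluate_cong)
          fix l assume "l \<in> set (vars w)"
          then have "ds ! l \<in> set ds" using w ld by (simp add: monomials_def)
          then show "nrm {?e} (ds ! l) = ds ! l" using fix_list[OF _ ds not_in(4)] by blast
        qed
        then show ?thesis using vy by (simp add: graft_def nrm_mark nrm_evaluate)
      qed
      have "nrm {?e} (?ms ! j) = map (nrm {?e}) ?ms ! j" using j lts by (metis nth_map)
      also have "map (nrm {?e}) ?ms = as @ ?y # cs"
        using fix_list[OF _ as not_in(2)] fix_list[OF _ cs not_in(3)] y by (simp add: map_idI)
      finally show "nrm {?e} (?ms ! j) = (as @ ?y # cs) ! j" .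
    qed
    also have "\<dots> = evaluate join (\<lambda>j. (as @ ds @ cs) ! j) (comp_monomial ?b ?i s w)"
      using evaluate_comp_append[of s as cs w ds join] s w la ld lc by (simp add: ts)
    finally show ?thesis by (simp add: graft_def)
  qed
  have cl: "combination (supports ls) (product (map expand ls))"
    by (rule product_expand_combination) (rule subl)
  have cB: "combination (supports ss) (product (map expand ss))"
    by (rule product_expand_combination) (rule subB)
  have cr: "combination (supports rs) (product (map expand rs))"
    by (rule product_expand_combination) (rule subr)
  let ?G = "\<lambda>m. G (nrm {?e} m)"
  have "expand (Node (pcomp ?Q (length ts) ?b ?i A B) (ls @ ss @ rs)) G =
      lin (\<lambda>u. product (map expand (ls @ ss @ rs)) (\<lambda>ms. G (graft ms u))) (pcomp free_operad (length ts) ?b ?i p q)"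
    unfolding AB
  proof (rule expand_Node)
    show "bigraft_decorated t" if "t \<in> set (ls @ ss @ rs)" for t
      using that subl subB subr by auto
    show "supp (pcomp free_operad (length ts) ?b ?i p q) \<subseteq> monomials (length (ls @ ss @ rs))"
      unfolding len by (rule keys_pcomp[OF p(1) q(1) i])
  qed
  also have "\<dots> = lin (\<lambda>s. lin (\<lambda>w. product (map expand ls) (\<lambda>as. product (map expand ss) (\<lambda>ds.
      product (map expand rs) (\<lambda>cs. G (graft (as @ ds @ cs) (comp_monomial ?b ?i s w)))))) q) p"
    by (simp add: lin_pcomp product_append)
  also have "\<dots> = lin (\<lambda>s. lin (\<lambda>w. product (map expand ls) (\<lambda>as. product (map expand ss) (\<lambda>ds.
      product (map expand rs) (\<lambda>cs. ?G (graft (as @ graft ds w # cs) s))))) q) p"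
  proof (intro lin_cong combination_cong[OF cl] combination_cong[OF cB] combination_cong[OF cr])
    fix s w as ds cs
    assume s: "s \<in> supp p" and w: "w \<in> supp q"
      and "as \<in> supports ls" "ds \<in> supports ss" "cs \<in> supports rs"
    then show "G (graft (as @ ds @ cs) (comp_monomial ?b ?i s w)) = ?G (graft (as @ graft ds w # cs) s)"
      using eq[of as ds cs s w] subsetD[OF p(1) s] subsetD[OF q(1) w] by simp
  qed
  also have "\<dots> = lin (\<lambda>s. product (map expand ls) (\<lambda>as. lin (\<lambda>w. product (map expand ss) (\<lambda>ds.
      product (map expand rs) (\<lambda>cs. ?G (graft (as @ graft ds w # cs) s)))) q)) p"
    by (simp only: combination_lin_fun[OF cl])
  also have "\<dots> = lin (\<lambda>s. product (map expand ts) (\<lambda>ms. ?G (graft ms s))) p"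
  proof -
    have "expand (Node B ss) F = lin (\<lambda>w. product (map expand ss) (\<lambda>ds. F (graft ds w))) q" for F
      unfolding q(2) by (rule expand_Node) (rule subB, assumption, rule q(1))
    then show ?thesis by (simp only: ts map_append list.map product_append product.simps)
  qed
  also have "\<dots> = expand (Node A ts) ?G"
    unfolding p(2) by (rule expand_Node[symmetric]) (rule sub, assumption, rule p(1))
  finally show ?thesis .
qed

lemma expand_contractions:
  fixes t :: "('k::field) class_tree"
  assumes "bigraft_decorated t" "distinct (leaves t)"
  shows "list_all2 (\<lambda>t' e. \<forall>G. expand t' G = expand t (\<lambda>m. G (nrm {e} m)))
    (contractions BG t) (edges t)"
  using assms
proof (induction t)
  case (Leaf i)
  then show ?case by (simp add: edges_def)
next
  case (Node A ts)
  let ?Q = "BG :: ('k, _) operad"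
  let ?P = "\<lambda>t' e. \<forall>G. expand t' G = expand (Node A ts) (\<lambda>m. G (nrm {e} m))"
  have step: "list_all2 ?P (contract_edge ?Q A (take i ts) (ts ! i) (drop (Suc i) ts) @
      map (\<lambda>t. Node A (ts[i := t])) (contractions ?Q (ts ! i))) (blocks (ts ! i))"
    if i: "i < length ts" for i
  proof (cases "ts ! i")
    case (Node B ss)
    have split: "ts = take i ts @ Node B ss # drop (Suc i) ts"
      using split_at[OF i] Node by simp
    have mem: "ts ! i \<in> set ts" using i by simp
    have di: "distinct (leaves (ts ! i))"
    proof -
      have "distinct (concat (map leaves (take i ts @ ts ! i # drop (Suc i) ts)))"
        using Node.prems(2) split_at[OF i] by simp
      then show ?thesis by simp
    qed
    have IH: "list_all2 (\<lambda>t' e. \<forall>G. expand t' G = expand (ts ! i) (\<lambda>m. G (nrm {e} m)))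
        (contractions ?Q (ts ! i)) (edges (ts ! i))"
      using Node.IH[OF mem _ di] Node.prems(1) mem by simp
    have "list_all2 ?P (map (\<lambda>t. Node A (ts[i := t])) (contractions ?Q (ts ! i))) (edges (ts ! i))"
      unfolding list_all2_map1
      using IH expand_contract_below[OF Node.prems i]
      by (auto simp: list_all2_conv_all_nth)
    moreover have "?P (Node (pcomp ?Q (length ts) (length ss) i A B) (take i ts @ ss @ drop (Suc i) ts))
        (set (leaves (Node B ss)))"
      using expand_contract_edge[OF Node.prems split] i by simp
    moreover have "blocks (ts ! i) = set (leaves (Node B ss)) # edges (ts ! i)"
      by (simp add: Node)
    moreover have "contract_edge ?Q A (take i ts) (ts ! i) (drop (Suc i) ts) =
        [Node (pcomp ?Q (length ts) (length ss) i A B) (take i ts @ ss @ drop (Suc i) ts)]"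
    proof -
      have "Suc (length ts - Suc 0) = length ts" using i by simp
      then show ?thesis using i by (simp add: Node)
    qed
    ultimately show ?thesis by (simp del: leaves.simps)
  qed simp
  have "list_all2 (list_all2 ?P)
      (map (\<lambda>i. contract_edge ?Q A (take i ts) (ts ! i) (drop (Suc i) ts) @
        map (\<lambda>t. Node A (ts[i := t])) (contractions ?Q (ts ! i))) [0..<length ts])
      (map (\<lambda>i. blocks (ts ! i)) [0..<length ts])"
    using step by (simp add: list_all2_conv_all_nth)
  from list_all2_concat[OF this]
  have "list_all2 ?P (contractions ?Q (Node A ts)) (concat (map (\<lambda>i. blocks (ts ! i)) [0..<length ts]))"
    by simp
  moreover have "map (\<lambda>i. blocks (ts ! i)) [0..<length ts] = map blocks ts"
    by (rule nth_equalityI) auto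
  ultimately show ?case by simp
qed

section \<open>Marked trees as decorated trees\<close>

text \<open>
  The maximal subtrees with marked root or a variable as root, from left to right.
\<close>

fun kids :: "marked \<Rightarrow> marked list" where
  "kids (Op (False, g) x y) = kids x @ kids y"
| "kids x = [x]"

text \<open>
  The monomial at the root, with its variables numbered from left to right starting with \<open>k\<close>.
\<close>

fun shape :: "nat \<Rightarrow> marked \<Rightarrow> bigraft_gen monomial" where
  "shape k (Op (False, g) x y) = Op g (shape k x) (shape (k + length (kids x)) y)"
| "shape k x = Var k"

abbreviation monomial_class :: "nat \<Rightarrow> bigraft_gen monomial \<Rightarrow> (bigraft_gen monomial \<Rightarrow>\<^sub>0 'k::field) set" where
  "monomial_class n u \<equiv> bg.cls n (single u 1)"

text \<open>
  The decorated tree of a marked tree, defined for all trees at once by listing the decorated trees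
  of the marked subtrees; \<open>realise\<close> is meant for trees with marked root or a single leaf.
\<close>

fun realise_all :: "marked \<Rightarrow> ('k::field) class_tree list" where
  "realise_all (Var i) = [Leaf i]"
| "realise_all (Op (b, g) x y) =
     (if b then [Node (monomial_class (length (kids x) + length (kids y))
          (Op g (shape 0 x) (shape (length (kids x)) y))) (realise_all x @ realise_all y)]
      else realise_all x @ realise_all y)"

definition realise :: "marked \<Rightarrow> ('k::field) class_tree" where
  "realise m = hd (realise_all m)"

lemma kids_nonempty [simp]: "kids x \<noteq> []"
  by (induction x rule: kids.induct) auto

lemma length_realise_all [simp]: "length (realise_all x) = length (kids x)"
  by (induction x rule: kids.induct) auto

lemma kids_marked: "mark m = m \<Longrightarrow> kids m = [m]"
  by (cases m rule: kids.cases) auto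

lemma realise_all_marked: "mark m = m \<Longrightarrow> realise_all m = [realise m]"
  by (cases m rule: kids.cases) (auto simp: realise_def)

lemma realise_all_kids: "realise_all x = map realise (kids x)"
  by (induction x rule: kids.induct) (auto simp: realise_def)

lemma vars_shape: "vars (shape k x) = [k..<k + length (kids x)]"
proof (induction k x rule: shape.induct)
  case (1 k g x y)
  then show ?case using upt_add_eq_append[of k "k + length (kids x)" "length (kids y)"]
    by (simp add: add.assoc)
qed auto

lemma root_shape_monomials:
  "Op g (shape 0 x) (shape (length (kids x)) y) \<in> monomials (length (kids x) + length (kids y))"
  using vars_shape[of 0 "Op (False, g) x y"] by (auto simp: monomials_def)

lemma shape_monomials: "shape 0 x \<in> monomials (length (kids x))"
  by (auto simp: monomials_def vars_shape)

lemma monomial_class_ops: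
  "u \<in> monomials n \<Longrightarrow> monomial_class n u \<in> ops BG n"
  unfolding bg.ops_Q by (intro exI[of _ "single u 1"]) simp

lemma kids_length_ge: "2 \<le> length (kids x) + length (kids y)"
  using kids_nonempty[of x] kids_nonempty[of y]
  by (metis One_nat_def Suc_leI add_mono length_greater_0_conv one_add_one)

lemma decorated_realise_all: "t \<in> set (realise_all x) \<Longrightarrow> bigraft_decorated t"
proof (induction x arbitrary: t)
  case (Op a x y)
  obtain b g where a: "a = (b, g)" by (cases a)
  show ?case
  proof (cases b)
    case True
    then show ?thesis
      using Op monomial_class_ops[OF root_shape_monomials[of g x y]] kids_length_ge[of x y] by (auto simp: a)
  next
    case False
    then show ?thesis using Op by (auto simp: a)
  qed
qed auto

lemma leaves_realise_all: "concat (map leaves (realise_all x)) = vars x"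
  by (induction x rule: realise_all.induct) auto

lemma blocks_realise_all: "set (concat (map blocks (realise_all x))) = marks x"
proof (induction x rule: marks.induct)
  case (2 b g x y)
  have "set (concat (map leaves (realise_all x @ realise_all y))) = set (vars x) \<union> set (vars y)"
    using leaves_realise_all[of x] leaves_realise_all[of y] by (metis concat_append map_append set_append)
  then show ?case using 2 by auto
qed auto

text \<open>
  Cutting a normal tree at its marks and grafting the pieces again changes nothing.
\<close>

lemma evaluate_shape:
  "normal x \<Longrightarrow> (\<And>i. i < length (kids x) \<Longrightarrow> f (k + i) = kids x ! i) \<Longrightarrow> evaluate join f (shape k x) = x"
proof (induction k x rule: shape.induct)
  case (1 k g x y)
  have "evaluate join f (shape k x) = x"
    using 1(3) 1(4) by (intro 1(1)) (auto simp: nth_append)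
  moreover have "evaluate join f (shape (k + length (kids x)) y) = y"
  proof (rule 1(2))
    fix i assume "i < length (kids y)"
    then show "f (k + length (kids x) + i) = kids y ! i"
      using 1(4)[of "length (kids x) + i"] by (simp add: nth_append add.assoc)
  qed (use 1(3) in simp)
  ultimately show ?case using 1(3) by (simp add: join_normal)
qed force+

lemma product_expand_realise_all:
  fixes H :: "marked list \<Rightarrow> 'k::field"
  shows "normal x \<Longrightarrow> product (map expand (realise_all x)) H = H (kids x)"
proof (induction x arbitrary: H)
  case (Op a x y)
  obtain b g where a: "a = (b, g)" by (cases a)
  have n: "normal x" "normal y" "normal (Op (False, g) x y)" using Op.prems by (auto simp: a)
  have both: "product (map expand (realise_all x @ realise_all y)) H = H (kids x @ kids y)"
    for H :: "marked list \<Rightarrow> 'k"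
    using Op.IH n by (simp add: product_append)
  show ?case
  proof (cases b)
    case True
    let ?u = "Op g (shape 0 x) (shape (length (kids x)) y)" 
      and ?ts = "realise_all x @ realise_all y :: 'k class_tree list"
    have "graft (kids x @ kids y) ?u = mark (Op (False, g) x y)"
      using evaluate_shape[OF n(3), of "\<lambda>i. (kids x @ kids y) ! i" 0] by (simp add: graft_def)
    moreover have "expand (Node (monomial_class (length ?ts) ?u) ?ts) G = G (graft (kids x @ kids y) ?u)"
      for G :: "marked \<Rightarrow> 'k"
    proof -
      have "expand (Node (monomial_class (length ?ts) ?u) ?ts) G =
          lin (\<lambda>u. product (map expand ?ts) (\<lambda>ms. G (graft ms u))) (single ?u 1)"
        by (rule expand_Node)
          (use decorated_realise_all root_shape_monomials[of g x y] in auto)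
      then show ?thesis using both by simp
    qed
    ultimately show ?thesis using True by (simp add: a)
  next
    case False
    then show ?thesis using both by (simp add: a)
  qed
qed auto

lemma expand_realise: "normal m \<Longrightarrow> mark m = m \<Longrightarrow> expand (realise m) G = G m"
  using product_expand_realise_all[of m "\<lambda>ms. G (hd ms)"] by (simp add: realise_all_marked kids_marked)

lemma realise_facts:
  fixes t :: "('k::field) class_tree"
  assumes t: "t = realise m" and m: "mark m = m" "distinct (vars m)"
  shows "bigraft_decorated t" "leaves t = vars m" "set (blocks t) = marks m" "vertices t = card (marks m)"
proof -
  have r: "realise_all m = [t]" unfolding t using m(1) by (rule realise_all_marked)
  show d: "bigraft_decorated t" by (rule decorated_realise_all[of _ m]) (simp add: r)
  show l: "leaves t = vars m" using leaves_realise_all[of m, where 'a = 'k] by (simp add: r)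
  show b: "set (blocks t) = marks m" using blocks_realise_all[of m, where 'a = 'k] by (simp add: r)
  have "distinct (blocks t)" using distinct_blocks[OF d] l m(2) by simp
  then show "vertices t = card (marks m)" using b distinct_card by fastforce
qed

lemma rename_shape: "rename_monomial (\<lambda>i. i + k) (shape j x) = shape (j + k) x"
  by (induction j x rule: shape.induct) (auto simp: rename_monomial_def add_ac)


definition rewrite_rules :: "(bigraft_gen \<times> bigraft_gen \<times> bigraft_gen \<times> bigraft_gen) set" where
  "rewrite_rules = {(Ast, Ast, Ast, Ast), (Ast, Succ, Succ, Succ), (Succ, Ast, Succ, Ast),
     (Prec, Prec, Prec, Ast), (Ast, Prec, Ast, Prec), (Succ, Prec, Succ, Prec)}"

text \<open>
  Equality of the classes of the monomials at the root, generated by the rewrite rules; it does not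
  mention the field.
\<close>

inductive related :: "marked \<Rightarrow> marked \<Rightarrow> bool" where
  related_refl: "related x x"
| related_sym: "related x y \<Longrightarrow> related y x"
| related_trans: "related x y \<Longrightarrow> related y z \<Longrightarrow> related x z"
| related_Op: "related x x' \<Longrightarrow> related y y' \<Longrightarrow> related (Op (False, g) x y) (Op (False, g) x' y')"
| related_rule: "(a, b, c, d) \<in> rewrite_rules \<Longrightarrow>
    related (Op (False, b) (Op (False, a) x y) z) (Op (False, c) x (Op (False, d) y z))"

lemma substitute_Var: "(\<And>i. i \<in> set (vars u) \<Longrightarrow> f i = Var i) \<Longrightarrow> substitute f u = u"
  by (induction u) auto

lemma substitute_substitute:
  "substitute f (substitute h u) = substitute (\<lambda>j. substitute f (h j)) u"
  by (induction u) auto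

abbreviation shift :: "nat \<Rightarrow> 'g monomial \<Rightarrow> 'g monomial" where
  "shift k \<equiv> rename_monomial (\<lambda>i. i + k)"

lemma pcomp_monomial_class:
  assumes "s \<in> monomials m" "t \<in> monomials n" "i < m"
  shows "monomial_class (m + n - 1) (comp_monomial n i s t) =
    pcomp BG m n i (monomial_class m s)
      (monomial_class n t :: (bigraft_gen monomial \<Rightarrow>\<^sub>0 'k::field) set)"
proof -
  have "pcomp BG m n i (monomial_class m s)
      (monomial_class n t :: (bigraft_gen monomial \<Rightarrow>\<^sub>0 'k::field) set) =
    bg.cls (m + n - 1) (pcomp free_operad m n i (single s 1) (single t 1))"
    using assms by (intro bg.pcomp_Q) auto
  then show ?thesis by simp
qed

text \<open>
  An operation applied to two monomials is a composite in the free operad, so its class depends only on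
  the classes of the two.
\<close>

lemma monomial_class_Op:
  assumes u: "u \<in> monomials a" and v: "v \<in> monomials b"
  shows "monomial_class (a + b) (Op g u (shift a v)) =
    pcomp BG (Suc a) b a
      (pcomp BG 2 a 0 (monomial_class 2 (Op g (Var 0) (Var 1))) (monomial_class a u))
      (monomial_class b v :: (bigraft_gen monomial \<Rightarrow>\<^sub>0 'k::field) set)"
proof -
  have g: "Op g (Var 0) (Var 1) \<in> monomials 2" by (auto simp: monomials_def)
  have 1: "comp_monomial a 0 (Op g (Var 0) (Var 1)) u = Op g u (Var a)"
    by (simp add: comp_monomial_def rename_monomial_def substitute_Var)
  have 2: "comp_monomial b a (Op g u (Var a)) v = Op g u (shift a v)"
  proof -
    have "substitute h u = u" if "\<And>i. i < a \<Longrightarrow> h i = Var i" for h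
      by (rule substitute_Var) (use that u in \<open>simp add: monomials_def\<close>)
    then show ?thesis by (simp add: comp_monomial_def)
  qed
  have m: "Op g u (Var a) \<in> monomials (Suc a)"
    using comp_monomials[OF g u, of 0] 1 by simp
  show ?thesis
    using pcomp_monomial_class[OF g u, of 0, where 'k = 'k] pcomp_monomial_class[OF m v, of a, where 'k = 'k]
    by (simp add: 1[simplified] 2)
qed

text \<open>
  An instance of a relation is the composite of the relation with the three monomials, inserted from
  right to left so that the positions of the remaining inputs do not move.
\<close>

lemma monomial_class_rule:
  assumes u: "u \<in> monomials k" and v: "v \<in> monomials l" and w: "w \<in> monomials n"
    and r: "(a, b, c, d) \<in> rewrite_rules"
  shows "monomial_class (k + l + n) (Op b (Op a u (shift k v)) (shift (k + l) w)) =
    (monomial_class (k + l + n) (Op c u (Op d (shift k v) (shift (k + l) w)))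
      :: (bigraft_gen monomial \<Rightarrow>\<^sub>0 'k::field) set)"
proof -
  let ?Q = "BG :: ('k, _) operad"
  let ?f = "\<lambda>T. comp_monomial k 0 (comp_monomial l 1 (comp_monomial n 2 T w) v) u"
  have cl: "monomial_class (k + l + n) (?f T) =
      pcomp ?Q (Suc (l + n)) k 0 (pcomp ?Q (Suc (Suc n)) l 1
        (pcomp ?Q 3 n 2 (monomial_class 3 T) (monomial_class n w)) (monomial_class l v)) (monomial_class k u)"
    if T: "T \<in> monomials 3" for T
  proof -
    have 1: "comp_monomial n 2 T w \<in> monomials (Suc (Suc n))"
      using comp_monomials[OF T w, of 2] by simp
    have 2: "comp_monomial l 1 (comp_monomial n 2 T w) v \<in> monomials (Suc (l + n))"
      using comp_monomials[OF 1 v, of 1] by (simp add: add.commute)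
    show ?thesis
      using pcomp_monomial_class[OF T w, of 2, where 'k = 'k] pcomp_monomial_class[OF 1 v, of 1, where 'k = 'k]
        pcomp_monomial_class[OF 2 u, of 0, where 'k = 'k]
      by (simp add: ac_simps)
  qed
  let ?L = "Op b (Op a (Var 0) (Var 1)) (Var 2)" and ?R = "Op c (Var 0) (Op d (Var 1) (Var 2))"
  have L: "?f ?L = Op b (Op a u (shift k v)) (shift (k + l) w)"
    and R: "?f ?R = Op c u (Op d (shift k v) (shift (k + l) w))"
    by (simp_all add: comp_monomial_def rename_monomial_def substitute_substitute substitute_Var ac_simps)
  have "bigraft_rel a b c d \<in> (bigraft_relations :: (_ \<Rightarrow>\<^sub>0 'k) set)"
    using r by (auto simp: rewrite_rules_def bigraft_relations_def)
  then have "bg.ideal 3 (bigraft_rel a b c d :: _ \<Rightarrow>\<^sub>0 'k)"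
    unfolding bg.ideal_def by (intro operad_ideal.rel) simp
  then have "monomial_class 3 ?L = (monomial_class 3 ?R :: (_ \<Rightarrow>\<^sub>0 'k) set)"
    unfolding bg.cls_eq_iff bigraft_rel_def .
  moreover have "?L \<in> monomials 3" "?R \<in> monomials 3" by (auto simp: monomials_def)
  ultimately show ?thesis using cl[of ?L] cl[of ?R] unfolding L R by simp
qed

lemma related_class:
  "related x y \<Longrightarrow> length (kids x) = length (kids y) \<and>
    monomial_class (length (kids x)) (shape 0 x) =
    (monomial_class (length (kids y)) (shape 0 y) :: (bigraft_gen monomial \<Rightarrow>\<^sub>0 'k::field) set)"
proof (induction rule: related.induct)
  case (related_Op x x' y y' g)
  have sh: "shape (length (kids x)) y = shift (length (kids x)) (shape 0 y)" for x y
    using rename_shape[of "length (kids x)" 0 y] by simp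
  have len: "length (kids x) = length (kids x')" "length (kids y) = length (kids y')"
    using related_Op.IH by simp_all
  have "monomial_class (length (kids x) + length (kids y)) (Op g (shape 0 x) (shift (length (kids x)) (shape 0 y))) =
      (monomial_class (length (kids x') + length (kids y')) (Op g (shape 0 x') (shift (length (kids x')) (shape 0 y')))
        :: (bigraft_gen monomial \<Rightarrow>\<^sub>0 'k) set)"
    unfolding monomial_class_Op[OF shape_monomials shape_monomials]
      conjunct2[OF related_Op.IH(1)] conjunct2[OF related_Op.IH(2)] unfolding len ..
  then show ?case using len by (simp add: sh)
next
  case (related_rule a b c d x y z)
  have sh: "shape k y = shift k (shape 0 y)" for k y
    using rename_shape[of k 0 y] by simp
  have e: "shape 0 (Op (False, b) (Op (False, a) x y) z) =
      Op b (Op a (shape 0 x) (shift (length (kids x)) (shape 0 y))) (shift (length (kids x) + length (kids y)) (shape 0 z))"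
    "shape 0 (Op (False, c) x (Op (False, d) y z)) =
      Op c (shape 0 x) (Op d (shift (length (kids x)) (shape 0 y)) (shift (length (kids x) + length (kids y)) (shape 0 z)))"
    by (simp_all flip: sh)
  show ?case unfolding e
    using monomial_class_rule[OF shape_monomials[of x] shape_monomials[of y] shape_monomials[of z] related_rule, where 'k = 'k]
    by (simp add: add.assoc)
next
  case (related_sym x y)
  show ?case
    by (rule conjI[OF conjunct1[OF related_sym.IH, symmetric] conjunct2[OF related_sym.IH, symmetric]])
next
  case (related_trans x y z)
  show ?case
    by (rule conjI[OF trans[OF conjunct1[OF related_trans.IH(1)] conjunct1[OF related_trans.IH(2)]]
          trans[OF conjunct2[OF related_trans.IH(1)] conjunct2[OF related_trans.IH(2)]]])
qed simp

lemma related_join: "related (join g x y) (Op (False, g) x y)"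
proof -
  \<comment> \<open>one rule is applied in each recursive step, backwards for those that are read from left to right\<close>
  note R = related_Op[OF related_refl] and L = related_Op[OF _ related_refl]
  have rules: "(Ast, Ast, Ast, Ast) \<in> rewrite_rules" "(Ast, Succ, Succ, Succ) \<in> rewrite_rules"
    "(Succ, Ast, Succ, Ast) \<in> rewrite_rules" "(Prec, Prec, Prec, Ast) \<in> rewrite_rules"
    "(Ast, Prec, Ast, Prec) \<in> rewrite_rules" "(Succ, Prec, Succ, Prec) \<in> rewrite_rules"
    by (simp_all add: rewrite_rules_def)
  note T = related_trans and S = related_sym
  have a: "related (join_ast x y) (Op (False, Ast) x y)" for x y
  proof (induction x rule: induct_ast)
    case (Ast u v)
    then show ?case using T[OF R S[OF related_rule[OF rules(1)]]] by simp
  qed (simp add: join_ast_base related_refl)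
  have s1: "related (insert_succ x y) (Op (False, Succ) x y)" for x y
  proof (induction y rule: induct_ast)
    case (Ast u v)
    then show ?case using T[OF L related_rule[OF rules(3)]] by simp
  qed (simp add: insert_succ_base related_refl)
  have s: "related (join_succ x y) (Op (False, Succ) x y)" for x y
  proof (induction x arbitrary: y rule: induct_ast)
    case (Ast u v)
    have "related (join_succ u (join_succ v y)) (Op (False, Succ) u (join_succ v y))" by (rule Ast)
    also have "related (Op (False, Succ) u (join_succ v y)) (Op (False, Succ) (Op (False, Ast) u v) y)"
      using T[OF R[OF Ast(2)] S[OF related_rule[OF rules(2)]]] .
    finally (T) show ?case by simp
  qed (simp add: join_succ_base s1)
  have p1: "related (insert_prec x y) (Op (False, Prec) x y)" for x y
  proof (induction y arbitrary: x rule: induct_ast)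
    case (Ast u v)
    then show ?case using T[OF Ast(2) related_rule[OF rules(4)]] by simp
  qed (simp add: insert_prec_base related_refl)
  have p: "related (join_prec x y) (Op (False, Prec) x y)" for x y
  proof (induction x rule: induct_ast_succ)
    case (Ast u v)
    then show ?case using T[OF R S[OF related_rule[OF rules(5)]]] by simp
  next
    case (Succ u v)
    then show ?case using T[OF R S[OF related_rule[OF rules(6)]]] by simp
  qed (simp add: join_prec_base p1)
  show ?thesis by (cases g) (simp_all add: a s p)
qed

definition plain :: "bigraft_gen \<Rightarrow> marked \<Rightarrow> marked \<Rightarrow> marked" where
  "plain g x y = Op (False, g) x y"

lemma related_evaluate: "related (evaluate join f u) (evaluate plain f u)"
proof (induction u)
  case (Op g s t)
  show ?case
    using related_trans[OF related_join related_Op[OF Op.IH]] by (simp add: plain_def)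
qed (simp add: related_refl)

lemma kids_join [simp]: "kids (join g x y) = kids x @ kids y"
  by (rule join_append_hom) simp

lemma kids_evaluate: "kids (evaluate join f u) = concat (map (\<lambda>i. kids (f i)) (vars u))"
  by (induction u) auto

lemma kids_evaluate_plain: "kids (evaluate plain f u) = concat (map (\<lambda>i. kids (f i)) (vars u))"
  by (induction u) (auto simp: plain_def)

lemma shape_marked: "mark m = m \<Longrightarrow> shape k m = Var k"
  by (cases "(k, m)" rule: shape.cases) auto

text \<open>
  Every multilinear monomial is a planar one with renamed variables.
\<close>

lemma rename_shape_evaluate_plain:
  assumes "\<And>i. i \<in> set (vars u) \<Longrightarrow> mark (f i) = f i"
    and "\<And>i. i < length (vars u) \<Longrightarrow> \<sigma> (k + i) = vars u ! i"
  shows "rename_monomial \<sigma> (shape k (evaluate plain f u)) = u"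
  using assms
proof (induction u arbitrary: k)
  case (Var i)
  then show ?case using Var(2)[of 0] by (simp add: shape_marked rename_monomial_def)
next
  case (Op g s t)
  have ls: "length (kids (evaluate plain f s)) = length (vars s)"
  proof -
    have "map (\<lambda>i. kids (f i)) (vars s) = map (\<lambda>i. [f i]) (vars s)"
      using Op.prems(1) by (auto simp: kids_marked)
    then show ?thesis unfolding kids_evaluate_plain by (simp only: concat_map_singleton length_map)
  qed
  have "rename_monomial \<sigma> (shape k (evaluate plain f s)) = s"
  proof (rule Op.IH(1))
    show "\<sigma> (k + i) = vars s ! i" if "i < length (vars s)" for i
      using that Op.prems(2)[of i] by (simp add: nth_append)
  qed (use Op.prems(1) in auto)
  moreover have "rename_monomial \<sigma> (shape (k + length (vars s)) (evaluate plain f t)) = t"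
  proof (rule Op.IH(2))
    show "\<sigma> (k + length (vars s) + i) = vars t ! i" if "i < length (vars t)" for i
      using that Op.prems(2)[of "length (vars s) + i"] by (simp add: nth_append add.assoc)
  qed (use Op.prems(1) in auto)
  moreover have "evaluate plain f (Op g s t) = Op (False, g) (evaluate plain f s) (evaluate plain f t)"
    unfolding evaluate.simps plain_def[of g "evaluate plain f s" "evaluate plain f t"] ..
  ultimately show ?case by (simp add: ls rename_monomial_def del: evaluate.simps)
qed

section \<open>Forms factor through the expansion\<close>

fun compose_ctxt :: "'a ctxt \<Rightarrow> 'a ctxt \<Rightarrow> 'a ctxt" where
  "compose_ctxt Hole D = D"
| "compose_ctxt (In p ls C rs) D = In p ls (compose_ctxt C D) rs"

lemma plug_compose [simp]: "plug (compose_ctxt C D) t = plug C (plug D t)"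
  by (induction C) auto

lemma mset_leaves_Node: "mset (leaves (Node p ts)) = sum_list (map (\<lambda>t. mset (leaves t)) ts)"
  by (induction ts) auto

lemma dtrees_plug_replace:
  assumes "plug C t \<in> dtrees P n v" "decorated P u" "mset (leaves u) = mset (leaves t)" "vertices u = vertices t"
  shows "plug C u \<in> dtrees P n v"
proof -
  have "decorated P (plug C t) \<Longrightarrow> decorated P (plug C u)"
    using assms(2) by (induction C) auto
  moreover have m: "mset (leaves (plug C u)) = mset (leaves (plug C t))"
    using assms(3) by (induction C) auto
  moreover have "vertices (plug C u) = vertices (plug C t)"
    using assms(4) by (induction C) auto
  ultimately show ?thesis
    using assms(1) mset_eq_imp_distinct_iff[OF m] mset_eq_setD[OF m] by (simp add: dtrees_def)
qed

abbreviation bigraft_dtrees :: "nat \<Rightarrow> nat \<Rightarrow> ('k::field) class_tree set" where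
  "bigraft_dtrees \<equiv> dtrees BG"

lemma dtrees_plugD:
  assumes "plug C t \<in> dtrees P n v"
  shows "decorated P t" "distinct (leaves t)"
  using assms decorated_plugD distinct_leaves_plugD unfolding dtrees_def by blast+

lemma distinct_leaves_child: "distinct (leaves (Node p ts)) \<Longrightarrow> t \<in> set ts \<Longrightarrow> distinct (leaves t)"
  by (auto dest: split_list)

lemma realise_support:
  fixes t t' :: "('k::field) class_tree"
  assumes "m \<in> support t" "bigraft_decorated t" "distinct (leaves t)" "t' = realise m"
  shows "bigraft_decorated t'" "mset (leaves t') = mset (leaves t)" "vertices t' = vertices t"
proof -
  have m: "mset (vars m) = mset (leaves t)" "marks m = set (blocks t)" "mark m = m"
    using assms(1) by (auto simp: support_def)
  have d: "distinct (vars m)" using mset_eq_imp_distinct_iff[OF m(1)] assms(3) by simp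
  note f = realise_facts[OF assms(4) m(3) d]
  show "bigraft_decorated t'" "mset (leaves t') = mset (leaves t)" using f m by simp_all
  show "vertices t' = vertices t"
    using f(4) m(2) distinct_card[OF distinct_blocks[OF assms(2,3)]] by simp
qed

context
  fixes n v :: nat and f :: "('k::field) class_tree \<Rightarrow> 'k"
  assumes f: "invariant_form BG n v f"
begin

lemma form_decoration_change:
  assumes "plug C (Node A ts) \<in> bigraft_dtrees n v" "B \<in> ops BG (length ts)"
  shows "plug C (Node B ts) \<in> bigraft_dtrees n v"
  by (rule dtrees_plug_replace[OF assms(1)]) (use dtrees_plugD(1)[OF assms(1)] assms(2) in auto)

text \<open>
  Additivity and homogeneity, stated for operations of the operad, give linearity in the polynomial
  that represents a decoration.
\<close>

lemma form_lin:
  assumes t: "plug C (Node A ts) \<in> bigraft_dtrees n v"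
    and p: "supp p \<subseteq> monomials (length ts)"
  shows "f (plug C (Node (bg.cls (length ts) p) ts)) =
    lin (\<lambda>u. f (plug C (Node (monomial_class (length ts) u) ts))) p"
proof -
  let ?Q = "BG :: ('k, _) operad" and ?N = "length ts"
  let ?f = "\<lambda>p. f (plug C (Node (bg.cls ?N p) ts))"
  have tree: "plug C (Node (bg.cls ?N p) ts) \<in> bigraft_dtrees n v"
    if "supp p \<subseteq> monomials ?N" for p
    by (rule form_decoration_change[OF t]) (use that bg.ops_Q in blast)
  have scale: "?f (Poly_Mapping.map (\<lambda>a. c * a) p) = c * ?f p" if "supp p \<subseteq> monomials ?N" for c p
    using f tree[OF that] unfolding invariant_form_def bg.scl_Q[symmetric] by blast
  have plus: "?f (p + q) = ?f p + ?f q"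
    if "supp p \<subseteq> monomials ?N" "supp q \<subseteq> monomials ?N" for p q
    using f tree[OF that(1)] tree[OF that(2)] unfolding invariant_form_def bg.add_Q[symmetric] by blast
  have map0: "Poly_Mapping.map (\<lambda>a. 0 * a) (0 :: bigraft_gen monomial \<Rightarrow>\<^sub>0 'k) = 0"
    by (rule poly_mapping_eqI) (subst lookup_map_times, simp)
  have map1: "single u c = Poly_Mapping.map (\<lambda>a. c * a) (single u (1 :: 'k))"
    for u :: "bigraft_gen monomial" and c
    by (rule poly_mapping_eqI) (subst lookup_map_times, simp add: lookup_single when_def)
  have zero: "?f 0 = 0" using scale[of 0 0] unfolding map0 by simp
  have single: "?f (single u c) = c * ?f (single u 1)" if "u \<in> monomials ?N" for u c
    unfolding map1[of u c] by (rule scale) (use that in simp)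
  have "?f (\<Sum>u\<in>S. single u (c u)) = (\<Sum>u\<in>S. c u * ?f (single u 1))"
    if "finite S" "S \<subseteq> monomials ?N" for S c
    using that
  proof (induction S)
    case (insert u S)
    have "supp (single u (c u)) \<subseteq> monomials ?N"
      "supp (\<Sum>u\<in>S. single u (c u)) \<subseteq> monomials ?N"
      using insert.prems by (auto intro!: keys_single_subset keys_sum_subset del: subsetI)
    then show ?case using insert plus single[of u "c u"] by simp
  qed (use zero in simp)
  from this[OF _ p, of "coeff p"]
  have "?f (\<Sum>u\<in>supp p. single u (coeff p u)) =
      lin (\<lambda>u. ?f (single u 1)) p"
    by (simp add: lin_def)
  moreover have "(\<Sum>u\<in>supp p. single u (coeff p u)) = p"
    by (rule poly_mapping_eqI)
      (simp add: lookup_sum lookup_single when_def in_keys_iff)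
  ultimately show ?thesis by simp
qed

lemma form_children:
  assumes "\<And>t C. t \<in> set us \<Longrightarrow> plug C t \<in> bigraft_dtrees n v \<Longrightarrow>
      f (plug C t) = expand t (\<lambda>m. f (plug C (realise m)))"
    and "plug C (Node B (ls @ us)) \<in> bigraft_dtrees n v"
  shows "f (plug C (Node B (ls @ us))) =
    product (map expand us) (\<lambda>ms. f (plug C (Node B (ls @ map realise ms))))"
  using assms
proof (induction us arbitrary: ls)
  case (Cons t us)
  let ?D = "compose_ctxt C (In B ls Hole us)"
  have D: "plug ?D t \<in> bigraft_dtrees n v" using Cons.prems(2) by simp
  note t = dtrees_plugD[OF D]
  have "f (plug C (Node B (ls @ t # us))) = expand t (\<lambda>m. f (plug ?D (realise m)))"
    using Cons.prems(1)[OF _ D] by simp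
  also have "\<dots> = expand t (\<lambda>m. product (map expand us)
      (\<lambda>ms. f (plug C (Node B (ls @ map realise (m # ms))))))"
  proof (rule combination_cong[OF expand_combination[OF t(1)]])
    fix m assume m: "m \<in> support t"
    have "plug ?D (realise m) \<in> bigraft_dtrees n v"
      using realise_support[OF m t refl] by (intro dtrees_plug_replace[OF D])
    then have "plug C (Node B ((ls @ [realise m]) @ us)) \<in> bigraft_dtrees n v" by simp
    from Cons.IH[OF Cons.prems(1) this]
    show "f (plug ?D (realise m)) =
        product (map expand us) (\<lambda>ms. f (plug C (Node B (ls @ map realise (m # ms)))))"
      by simp
  qed
  finally show ?case by simp
qed simp

text \<open>
  The class of \<open>u\<close> is a permuted class of a planar normal monomial; by invariance of the form, the
  permutation moves to the subtrees, and puts them in the order in which they occur in the grafted tree.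
\<close>

lemma form_graft:
  assumes t: "plug C (Node A ts) \<in> bigraft_dtrees n v" and ms: "ms \<in> supports ts"
    and u: "u \<in> monomials (length ts)"
    and tree: "plug C (Node (monomial_class (length ts) u) (map realise ms)) \<in> bigraft_dtrees n v"
  shows "f (plug C (Node (monomial_class (length ts) u) (map realise ms))) = f (plug C (realise (graft ms u)))"
proof -
  let ?N = "length ts" and ?Q = "BG :: ('k, _) operad"
  have len: "length ms = ?N" using ms by (rule supports_length)
  have vu: "distinct (vars u)" "set (vars u) = {..<?N}" using u by (auto simp: monomials_def)
  then have lu: "length (vars u) = ?N" using distinct_card by fastforce
  \<comment> \<open>the permutation that renames the variables of the planar monomial to those of \<open>u\<close>\<close>
  define \<sigma> where "\<sigma> i = (if i < ?N then vars u ! i else i)" for i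
  have \<sigma>: "\<sigma> permutes {..<?N}"
  proof (rule bij_imp_permutes)
    have "bij_betw ((!) (vars u)) {..<?N} (set (vars u))"
      using bij_betw_nth[OF vu(1), of "{..<?N}" "set (vars u)"] lu by simp
    then show "bij_betw \<sigma> {..<?N} {..<?N}"
      unfolding vu(2) by (subst bij_betw_cong[of _ _ "(!) (vars u)"]) (auto simp: \<sigma>_def)
  qed (simp add: \<sigma>_def)
  let ?x = "evaluate join ((!) ms) u" and ?y = "evaluate plain ((!) ms) u"
  have marked: "mark (ms ! i) = ms ! i" if "i < ?N" for i
    using supports_nth[OF ms that] by (simp add: support_def)
  have "map (\<lambda>i. kids (ms ! i)) (vars u) = map (\<lambda>i. [ms ! i]) (vars u)"
    using marked vu(2) by (auto simp: kids_marked)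
  then have kx: "kids ?x = map ((!) ms) (vars u)" and ky: "kids ?y = map ((!) ms) (vars u)"
    unfolding kids_evaluate kids_evaluate_plain by (simp_all only: concat_map_singleton)
  have s: "shape 0 ?x \<in> monomials ?N" "shape 0 ?y \<in> monomials ?N"
    using shape_monomials[of ?x] shape_monomials[of ?y] by (simp_all add: kx ky lu)
  have "rename_monomial \<sigma> (shape 0 ?y) = u"
    by (rule rename_shape_evaluate_plain) (use marked vu lu in \<open>auto simp: \<sigma>_def\<close>)
  then have "monomial_class ?N u = act ?Q ?N \<sigma> (monomial_class ?N (shape 0 ?y))"
    by (simp add: bg.act_Q[OF \<sigma>])
  also have "monomial_class ?N (shape 0 ?y) = (monomial_class ?N (shape 0 ?x) :: (_ \<Rightarrow>\<^sub>0 'k) set)"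
    using related_class[OF related_evaluate[of "\<lambda>i. ms ! i" u], where 'k = 'k] by (simp add: kx ky lu)
  finally have cls: "monomial_class ?N u = act ?Q ?N \<sigma> (monomial_class ?N (shape 0 ?x))" .
  have "plug C (Node (monomial_class ?N (shape 0 ?x)) (map realise ms)) \<in> bigraft_dtrees n v"
    by (rule form_decoration_change[OF tree]) (use monomial_class_ops[OF s(1)] len in simp)
  then have "f (plug C (Node (act ?Q ?N \<sigma> (monomial_class ?N (shape 0 ?x))) (map realise ms))) =
      f (plug C (Node (monomial_class ?N (shape 0 ?x)) (permute \<sigma> (map realise ms))))"
    using f \<sigma> len unfolding invariant_form_def by (metis length_map)
  moreover have "permute \<sigma> (map realise ms) = (map realise (kids ?x) :: 'k class_tree list)"
  proof -
    have "vars u ! i < ?N" if "i < ?N" for i using nth_mem[of i "vars u"] that lu vu(2) by simp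
    then show ?thesis unfolding kx by (intro nth_equalityI) (simp_all add: len lu \<sigma>_def)
  qed
  moreover have "realise (graft ms u) =
      (Node (monomial_class ?N (shape 0 ?x)) (map realise (kids ?x)) :: 'k class_tree)"
  proof -
    obtain g a b where x: "?x = Op (False, g) a b"
      using monomial_is_Op[OF u] dtrees_plugD(1)[OF t] join_is_Op
      by (metis decorated.simps(2) evaluate.simps(2) plain_root_Some option.exhaust)
    have "length (kids a) + length (kids b) = ?N" using arg_cong[OF kx, of length] lu by (simp add: x)
    moreover have "realise_all a @ realise_all b = (map realise (kids ?x) :: 'k class_tree list)"
      unfolding x kids.simps map_append realise_all_kids ..
    ultimately show ?thesis
      unfolding graft_def x mark.simps realise_def[of "Op (True, g) a b"] by simp
  qed
  ultimately show ?thesis using cls by simp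
qed

text \<open>
  An invariant form is determined by its values on the realisations of marked trees.
\<close>

lemma form_expand:
  "plug C t \<in> bigraft_dtrees n v \<Longrightarrow> f (plug C t) = expand t (\<lambda>m. f (plug C (realise m)))"
proof (induction t arbitrary: C)
  case (Node A ts)
  let ?N = "length ts" and ?F = "\<lambda>m. f (plug C (realise m))"
  note d = dtrees_plugD[OF Node.prems]
  have A: "A \<in> ops BG ?N" and sub: "\<And>t. t \<in> set ts \<Longrightarrow> bigraft_decorated t"
    using d(1) by auto
  obtain p where p: "supp p \<subseteq> monomials ?N" "A = bg.cls ?N p"
    using A unfolding bg.ops_Q by blast
  have prod: "combination (supports ts) (product (map expand ts))"
    by (rule product_expand_combination) (rule sub)
  have tree: "plug C (Node (monomial_class ?N u) ts) \<in> bigraft_dtrees n v" if "u \<in> monomials ?N" for u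
    by (rule form_decoration_change[OF Node.prems monomial_class_ops[OF that]])
  have "f (plug C (Node A ts)) = lin (\<lambda>u. f (plug C (Node (monomial_class ?N u) ts))) p"
    unfolding p(2) by (rule form_lin[OF Node.prems p(1)])
  also have "\<dots> = lin (\<lambda>u. product (map expand ts) (\<lambda>ms. ?F (graft ms u))) p"
  proof (rule lin_cong)
    fix u assume "u \<in> supp p"
    then have u: "u \<in> monomials ?N" using p(1) by blast
    let ?B = "monomial_class ?N u :: (_ \<Rightarrow>\<^sub>0 'k) set"
    have "f (plug C (Node ?B ([] @ ts))) =
        product (map expand ts) (\<lambda>ms. f (plug C (Node ?B ([] @ map realise ms))))"
      by (rule form_children) (use Node.IH tree[OF u] in auto)
    also have "\<dots> = product (map expand ts) (\<lambda>ms. ?F (graft ms u))"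
    proof (rule combination_cong[OF prod])
      fix ms assume ms: "ms \<in> supports ts"
      have len: "length ms = ?N" using ms by (rule supports_length)
      have child: "bigraft_decorated (realise (ms ! i) :: 'k class_tree)"
          "mset (leaves (realise (ms ! i) :: 'k class_tree)) = mset (leaves (ts ! i))"
          "vertices (realise (ms ! i) :: 'k class_tree) = vertices (ts ! i)" if "i < ?N" for i
        using realise_support[OF supports_nth[OF ms that], OF _ _ refl] sub[OF nth_mem[OF that]]
          distinct_leaves_child[OF d(2) nth_mem[OF that]] by auto
      let ?us = "map realise ms :: 'k class_tree list"
      have "map (\<lambda>t. mset (leaves t)) ?us = map (\<lambda>t. mset (leaves t)) ts"
        "map vertices ?us = map vertices ts"
        by (rule nth_equalityI; use child len in simp)+
      then have "mset (leaves (Node ?B ?us)) = mset (leaves (Node ?B ts))"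
        "vertices (Node ?B ?us) = vertices (Node ?B ts)"
        by (simp_all only: mset_leaves_Node vertices.simps)
      moreover have "bigraft_decorated (Node ?B ?us)"
      proof -
        have "bigraft_decorated t" if "t \<in> set ?us" for t
          using that child(1) len by (auto simp: in_set_conv_nth)
        then show ?thesis using d(1) monomial_class_ops[OF u] len by simp
      qed
      ultimately have "plug C (Node ?B ?us) \<in> bigraft_dtrees n v"
        using dtrees_plug_replace[OF tree[OF u]] by blast
      then show "f (plug C (Node ?B ([] @ map realise ms))) = ?F (graft ms u)"
        using form_graft[OF Node.prems ms u] by simp
    qed
    finally show "f (plug C (Node ?B ts)) = product (map expand ts) (\<lambda>ms. ?F (graft ms u))" by simp
  qed
  also have "\<dots> = expand (Node A ts) ?F"
    unfolding p(2) by (rule expand_Node[symmetric]) (rule sub, assumption, rule p(1))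
  finally show ?case .
qed (simp add: realise_def)

end

section \<open>The expansion is an invariant form\<close>

lemma lin_linear: "lin (\<lambda>u. a * K u + b * L u) p = a * lin K p + b * lin L p"
  by (simp add: lin_def sum_distrib_left distrib_left sum.distrib mult.left_commute)

text \<open>
  A linear relation between expansions survives in any context.  It is used for sums, multiples and
  permuted operations alike.
\<close>

lemma expand_plug_linear:
  fixes X Y Z :: "('k::field) class_tree"
  assumes "\<And>G. expand X G = a * expand Y G + b * expand Z G" "bigraft_decorated (plug C Y)"
  shows "expand (plug C X) G = a * expand (plug C Y) G + b * expand (plug C Z) G"
  using assms(2)
proof (induction C arbitrary: G)
  case (In r ls C rs)
  have cl: "combination (supports ls) (product (map expand ls))"
    using In.prems by (intro product_expand_combination) auto
  have IH: "expand (plug C X) G = a * expand (plug C Y) G + b * expand (plug C Z) G" for G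
    using In by simp
  show ?case
    by (simp add: product_append IH combination_plus_fun[OF cl] combination_scale_fun[OF cl] lin_linear)
qed (simp add: assms(1))

lemma invariant_form_expand:
  "invariant_form BG n v (\<lambda>t. expand t G :: 'k::field)"
proof -
  let ?Q = "BG :: ('k, _) operad"
  have node: "2 \<le> length ts" "A \<in> ops ?Q (length ts)" "\<And>t. t \<in> set ts \<Longrightarrow> bigraft_decorated t"
    "bigraft_decorated (plug C (Node A ts))"
    if "plug C (Node A ts) \<in> bigraft_dtrees n v" for C A ts
    using dtrees_plugD(1)[OF that] that by (auto simp: dtrees_def)
  have "expand (plug C (Node (add ?Q (length ts) A B) ts)) G =
      expand (plug C (Node A ts)) G + expand (plug C (Node B ts)) G"
    if A: "plug C (Node A ts) \<in> bigraft_dtrees n v" and B: "plug C (Node B ts) \<in> bigraft_dtrees n v" for C A B ts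
  proof -
    obtain p q where p: "supp p \<subseteq> monomials (length ts)" "A = bg.cls (length ts) p"
      and q: "supp q \<subseteq> monomials (length ts)" "B = bg.cls (length ts) q"
      using node(2)[OF A] node(2)[OF B] unfolding bg.ops_Q by blast
    have "expand (Node (add ?Q (length ts) A B) ts) G = 1 * expand (Node A ts) G + 1 * expand (Node B ts) G" for G
      using expand_Node[OF node(3)[OF A] p(1)] expand_Node[OF node(3)[OF A] q(1)]
        expand_Node[OF node(3)[OF A] keys_add_subset[OF p(1) q(1)]]
      by (simp add: p(2) q(2) bg.add_Q)
    from expand_plug_linear[OF this node(4)[OF A]] show ?thesis by simp
  qed
  moreover have "expand (plug C (Node (scl ?Q (length ts) c A) ts)) G = c * expand (plug C (Node A ts)) G"
    if A: "plug C (Node A ts) \<in> bigraft_dtrees n v" for C c A ts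
  proof -
    obtain p where p: "supp p \<subseteq> monomials (length ts)" "A = bg.cls (length ts) p"
      using node(2)[OF A] unfolding bg.ops_Q by blast
    have "expand (Node (scl ?Q (length ts) c A) ts) G = c * expand (Node A ts) G + 0 * expand (Node A ts) G" for G
      using expand_Node[OF node(3)[OF A] p(1)]
        expand_Node[OF node(3)[OF A] keys_scl_subset[OF p(1), of c]]
      by (simp add: p(2) bg.scl_Q)
    from expand_plug_linear[OF this node(4)[OF A]] show ?thesis by simp
  qed
  moreover have "expand (plug C (Node (act ?Q (length ts) \<sigma> A) ts)) G = expand (plug C (Node A (permute \<sigma> ts))) G"
    if A: "plug C (Node A ts) \<in> bigraft_dtrees n v" and \<sigma>: "\<sigma> permutes {..<length ts}" for C \<sigma> A ts
  proof -
    let ?N = "length ts" and ?us = "permute \<sigma> ts"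
    obtain p where p: "supp p \<subseteq> monomials ?N" "A = bg.cls ?N p"
      using node(2)[OF A] unfolding bg.ops_Q by blast
    have us: "bigraft_decorated t" if "t \<in> set ?us" for t
      using that node(3)[OF A] mset_eq_setD[OF mset_permute[OF \<sigma>]] by blast
    have prod: "combination (supports ts) (product (map expand ts))"
      by (rule product_expand_combination) (rule node(3)[OF A])
    have base: "expand (Node (act ?Q ?N \<sigma> A) ts) G = 1 * expand (Node A ?us) G + 0 * expand (Node A ?us) G" for G
    proof -
      have "expand (Node (act ?Q ?N \<sigma> A) ts) G =
          lin (\<lambda>u. product (map expand ts) (\<lambda>ms. G (graft ms u))) (act free_operad ?N \<sigma> p)"
        unfolding p(2) bg.act_Q[OF \<sigma>]
        by (rule expand_Node) (rule node(3)[OF A], assumption, rule keys_act[OF p(1) \<sigma>])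
      also have "\<dots> = lin (\<lambda>u. product (map expand ts) (\<lambda>ms. G (graft ms (rename_monomial \<sigma> u)))) p"
        by (rule lin_act)
      also have "\<dots> = lin (\<lambda>u. product (map expand ts) (\<lambda>ms. G (graft (permute \<sigma> ms) u))) p"
      proof (intro lin_cong combination_cong[OF prod] arg_cong[of _ _ G])
        fix u ms assume u: "u \<in> supp p" and ms: "ms \<in> supports ts"
        have "length ms = ?N" using ms by (rule supports_length)
        moreover have "set (vars u) = {..<?N}" using u p(1) by (auto simp: monomials_def)
        ultimately have "evaluate join (\<lambda>i. ms ! \<sigma> i) u = evaluate join (\<lambda>i. permute \<sigma> ms ! i) u"
          by (intro evaluate_cong) simp
        then show "graft ms (rename_monomial \<sigma> u) = graft (permute \<sigma> ms) u"
          by (simp only: graft_def evaluate_rename)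
      qed
      also have "\<dots> = lin (\<lambda>u. product (map expand ?us) (\<lambda>ms. G (graft ms u))) p"
        by (intro lin_cong product_permute[OF expand_combination \<sigma>, symmetric]) (rule node(3)[OF A])
      also have "\<dots> = expand (Node A ?us) G"
      proof -
        have "expand (Node (bg.cls (length ?us) p) ?us) G =
            lin (\<lambda>u. product (map expand ?us) (\<lambda>ms. G (graft ms u))) p"
          by (rule expand_Node) (rule us, assumption, use p(1) in simp)
        then show ?thesis by (simp add: p(2))
      qed
      finally show ?thesis by simp
    qed
    have "bigraft_decorated (plug C (Node A ?us))"
    proof -
      have "bigraft_decorated (Node A ?us)" using node[OF A] us by simp
      moreover have "mset (leaves (Node A ?us)) = mset (leaves (Node A ts))"
        using mset_concat_permute[OF \<sigma>, of leaves] by simp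
      moreover have "vertices (Node A ?us) = vertices (Node A ts)"
        using arg_cong[OF mset_permute[OF \<sigma>], of "\<lambda>M. sum_mset (image_mset vertices M)"]
        by (simp add: sum_mset_sum_list[symmetric] del: mset_map flip: mset_map)
      ultimately show ?thesis using dtrees_plug_replace[OF A] by (simp add: dtrees_def)
    qed
    from expand_plug_linear[OF base this] show ?thesis by simp
  qed
  ultimately show ?thesis unfolding invariant_form_def by blast
qed

section \<open>Koszulness\<close>

lemma support_models:
  fixes t :: "('k::field) class_tree"
  assumes t: "t \<in> bigraft_dtrees n (Suc w)" and m: "m \<in> support t"
  shows "m \<in> models n (Suc w)" "inner_marks m = set (edges t)"
proof -
  have d: "bigraft_decorated t" "distinct (leaves t)" "set (leaves t) = {..<n}" "vertices t = Suc w"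
    using t by (auto simp: dtrees_def)
  have s: "mset (vars m) = mset (leaves t)" "normal m" "marks m = set (blocks t)"
    using m by (auto simp: support_def nrm_id_iff)
  have b: "blocks t = {..<n} # edges t" using d(3,4) by (cases t) auto
  have dist: "distinct (blocks t)" using distinct_blocks[OF d(1,2)] .
  then have card: "card (marks m) = Suc w" using s(3) d(4) distinct_card[OF dist] by simp
  have vars: "set (vars m) = {..<n}" using mset_eq_setD[OF s(1)] d(3) by simp
  show "m \<in> models n (Suc w)"
    using s card vars b mset_eq_imp_distinct_iff[OF s(1)] d(2) by (simp add: models_def)
  show "inner_marks m = set (edges t)"
    using s(3) b dist vars by (auto simp: inner_marks_def)
qed

text \<open>
  By the invariant orientation, the \<open>j\<close>-th contraction in preorder carries the sign of the
  corresponding mark, which is the same for all marked trees in the expansion.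
\<close>

lemma codiff_expand:
  fixes t :: "('k::field) class_tree"
  assumes t: "t \<in> bigraft_dtrees n (Suc w)"
    and \<phi>: "\<And>u. u \<in> bigraft_dtrees n w \<Longrightarrow> signed \<phi> u = expand u g"
  shows "list_sign (edges t) * codiff BG \<phi> t = expand t (delta g)"
proof -
  let ?Q = "BG :: ('k, _) operad" and ?es = "edges t"
  have d: "bigraft_decorated t" "distinct (leaves t)" using t by (auto simp: dtrees_def)
  note ex = expand_contractions[OF d]
  have comb: "combination (support t) (expand t)" by (rule expand_combination[OF d(1)])
  have dist: "distinct ?es" using distinct_blocks[OF d] by (simp add: edges_def distinct_tl)
  have face: "signed \<phi> (contractions ?Q t ! j) = expand t (\<lambda>m. g (nrm {?es ! j} m))" if j: "j < length ?es" for j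
  proof -
    have len: "length (contractions ?Q t) = length ?es" using ex by (rule list_all2_lengthD)
    have "contractions ?Q t ! j \<in> bigraft_dtrees n w"
      by (rule contractions_dtrees[OF bg.pcomp_ops_Q t]) (use j len in simp_all)
    then show ?thesis using \<phi> list_all2_nthD2[OF ex j] by simp
  qed
  have "list_sign ?es * codiff ?Q \<phi> t =
      (\<Sum>j<length ?es. (- 1) ^ rank (set ?es) (?es ! j) * expand t (\<lambda>m. g (nrm {?es ! j} m)))"
    unfolding signed_codiff[OF d] by (rule sum.cong) (use face in auto)
  also have "\<dots> = (\<Sum>e\<in>set ?es. (- 1) ^ rank (set ?es) e * expand t (\<lambda>m. g (nrm {e} m)))"
    by (rule sum.reindex_bij_betw[OF bij_betw_nth[OF dist]]) auto
  also have "\<dots> = expand t (\<lambda>m. \<Sum>e\<in>set ?es. (- 1) ^ rank (set ?es) e * g (nrm {e} m))"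
    by (simp only: combination_sum_fun[OF comb] combination_scale_fun[OF comb])
  also have "\<dots> = expand t (delta g)"
    by (rule combination_cong[OF comb]) (simp add: delta_def support_models(2)[OF t])
  finally show ?thesis .
qed

lemma realise_models:
  assumes m: "m \<in> models n v" and t: "t = (realise m :: ('k::field) class_tree)"
  shows "t \<in> bigraft_dtrees n v" "expand t G = G m"
proof -
  have mk: "mark m = m"
  proof (cases m)
    case (Op a x y)
    have "mark_at (marks m) m = m" "{..<n} \<in> marks m" "set (vars m) = {..<n}"
      using m by (auto simp: models_def mark_at_marks)
    then show ?thesis using Op by (cases a) auto
  qed simp
  have mm: "distinct (vars m)" "set (vars m) = {..<n}" "card (marks m) = v" "normal m"
    using m by (auto simp: models_def)
  show "t \<in> bigraft_dtrees n v"
    using realise_facts[OF t mk mm(1)] mm by (simp add: dtrees_def)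
  show "expand t G = G m" unfolding t by (rule expand_realise[OF mm(4) mk])
qed

theorem theorem50:
  shows "koszul (bigraft :: ('k::field, (bigraft_gen monomial \<Rightarrow>\<^sub>0 'k) set) operad)"
  unfolding koszul_def bigraft_eq
proof (intro allI impI, elim conjE)
  let ?Q = "BG :: ('k, _) operad"
  fix n v and \<phi> :: "'k class_tree \<Rightarrow> 'k"
  assume v: "Suc v < n - 1" and \<phi>: "cochain ?Q n (Suc v) \<phi>"
    and closed: "\<forall>t\<in>bigraft_dtrees n (Suc (Suc v)). codiff ?Q \<phi> t = 0"
  \<comment> \<open>the cocycle of marked trees that corresponds to \<open>\<phi>\<close>\<close>
  define g where "g m = signed \<phi> (realise m)" for m
  have expand_\<phi>: "signed \<phi> t = expand t g" if "t \<in> bigraft_dtrees n (Suc v)" for t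
    using form_expand[OF \<phi>[unfolded cochain_iff_invariant_form], of Hole t] that
    by (simp add: g_def[abs_def])
  have "delta g m = 0" if "m \<in> models n (Suc (Suc v))" for m
  proof -
    let ?t = "realise m :: 'k class_tree"
    note t = realise_models[OF that refl, where 'k = 'k]
    have "delta g m = expand ?t (delta g)" using t(2) by simp
    also have "\<dots> = list_sign (edges ?t) * codiff ?Q \<phi> ?t"
      by (rule codiff_expand[OF t(1) expand_\<phi>, symmetric])
    finally show ?thesis using closed t(1) by simp
  qed
  then have exact: "delta (primitive g) m = g m" if "m \<in> models n (Suc v)" for m
    using delta_primitive[OF v] that by blast
  define \<psi> where "\<psi> = signed (\<lambda>t. expand t (primitive g) :: 'k)"
  have "cochain ?Q n v \<psi>"
    unfolding cochain_iff_invariant_form \<psi>_def signed_signed by (rule invariant_form_expand)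
  moreover have "\<phi> t = codiff ?Q \<psi> t" if t: "t \<in> bigraft_dtrees n (Suc v)" for t
  proof -
    have "bigraft_decorated t" using t by (simp add: dtrees_def)
    have "list_sign (edges t) * codiff ?Q \<psi> t = expand t (delta (primitive g))"
      by (rule codiff_expand[OF t]) (simp add: \<psi>_def)
    also have "\<dots> = expand t g"
      by (rule combination_cong[OF expand_combination[OF \<open>bigraft_decorated t\<close>]])
        (use exact support_models(1)[OF t] in blast)
    also have "\<dots> = list_sign (edges t) * \<phi> t"
      using expand_\<phi>[OF t] by (simp add: signed_def)
    finally show ?thesis by simp
  qed
  ultimately show "\<exists>\<psi>. cochain ?Q n v \<psi> \<and> (\<forall>t\<in>bigraft_dtrees n (Suc v). \<phi> t = codiff ?Q \<psi> t)"
    by blast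
qed

end
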